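(* Consider any allocation process satisfying both conditions $\mathcal{P}_2$ and $\mathcal{W}_1$, or both conditions $\mathcal{P}_1$ and $\mathcal{W}_2$. Then there exists a constant $\kappa>0$ (independent of $n$ and $m$) such that for all sufficiently large $n$ and any round $m\ge 0$, $$\Pr\Big[\max_{i\in[n]}\Big|x_i^m-\frac{W^m}{n}\Big|\le \kappa\log n\Big]\ge 1-n^{-4};$$ so in particular $\Pr[\mathrm{Gap}(m)\le\kappa\log n]\ge 1-n^{-4}$.
   Context: Allocation processes. For each $n$, balls are sequentially allocated into $n$ bins. $x^t\in\mathbb{Z}_{\ge 0}^n$ is the load vector after $t$ allocations (round $t=0,1,2,\dots$), with $x^0=(0,\dots,0)$. In the $(t+1)$-th allocation exactly one bin is chosen and it receives one or more balls. $W^t=\sum_i x_i^t$, normalized loads are $y_i^t=x_i^t-W^t/n$, and $\mathrm{Gap}(t)=\max_{i\in[n]}x_i^t-W^t/n$. $\mathfrak{F}^t$ is the filtration of the first $t$ allocations. At each round $t$ bins are relabelled so that $x_1^t\ge\dots\ge x_n^t$, and $p_i^t$ (which may depend on $\mathfrak F^t$) is the conditional probability, given $\mathfrak{F}^t$, that the bin chosen in the $(t+1)$-th allocation is the $i$-th heaviest. $B_+^t=\{i: y_i^t\ge 0\}$ (overloaded bins), $B_-^t=[n]\setminus B_+^t$ (underloaded bins), $\delta^t=|B_+^t|/n$, $P_-^t=\sum_{i\in B_-^t}p_i^t$. For vectors of equal length, $p\succeq q$ (equivalently $q\preceq p$) means $\sum_{i=1}^k p_i\ge\sum_{i=1}^k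 q_i$ for every $k$. Conditions on an empty set of bins are vacuous. "Constant" means independent of $t$ and $n$. Condition $\mathcal{P}_1$: there are an integer constant $k_1\ge1$ and a constant $k_2\in(0,1]$ such that for each round $t\ge0$: $\max_{i\in B_+^t}p_i^t\le k_1/n$ and $(p_1^t,\dots,p_{\delta^tn}^t)\preceq(\frac1n,\dots,\frac1n)$; and $\min_{i\in B_-^t}p_i^t\ge k_2/n$ and $(p_n^t,p_{n-1}^t,\dots,p_{\delta^tn+1}^t)\succeq(\frac1n,\dots,\frac1n)$. Condition $\mathcal{P}_2$: there are an integer constant $k_1\ge1$ and constants $k_2,k_3,k_4\in(0,1]$ such that for each round $t\ge0$: $\max_{i\in B_+^t}p_i^t\le k_1/n$ and $(p_1^t,\dots,p_{\delta^tn}^t)\preceq(\frac1n-\frac{k_3(1-\delta^t)}{n},\dots,\frac1n-\frac{k_3(1-\delta^t)}{n})$; and $\min_{i\in B_-^t}p_i^t\ge k_2/n$ and $(p_n^t,\dots,p_{\delta^tn+1}^t)\succeq(\frac1n+\frac{k_4\delta^t}{n},\dots,\frac1n+\frac{k_4\delta^t}{n})$. Condition $\mathcal{W}_1$: for each round $t\ge0$, when bin $i$ is chosen for allocation, $w_-$ balls are allocated to $i$ if $y_i^t<0$ and $w_+$ balls are allocated to $i$ if $y_i^t\ge0$, where $1\le w_+\le w_-$ are constant integers. Condition $\mathcal{W}_2$: as $\mathcal{W}_1$, but with $w_+<w_-$, and additionally for each round $t\ge0$, $(p_n^t,\dots,p_{\delta^tn+1}^t)\succeq(\frac{P_-^t}{|B_-^t|},\dots,\frac{P_-^t}{|B_-^t|})$.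 *)

theory Defs
  imports "HOL-Probability.Probability"
begin

(* One allocation process on a fixed number n of bins, realised on a probability space.
   Bins carry fixed labels 1..n.  "load t i" is x_i^t for bin label i, "chosen t" is the label of
   the bin chosen in the (t+1)-th allocation, and "relabel t w j" is the label of the bin that is
   the j-th heaviest after t allocations. *)

record 'a alloc_proc =
  prob_sp :: "'a measure"
  load :: "nat \<Rightarrow> nat \<Rightarrow> 'a \<Rightarrow> nat"
  chosen :: "nat \<Rightarrow> 'a \<Rightarrow> nat"
  relabel :: "nat \<Rightarrow> 'a \<Rightarrow> nat \<Rightarrow> nat"

(* Ties in the relabelling are broken arbitrarily: the permutation is only required to be measurable,
   so random tie-breaking is allowed as well as tie-breaking determined by the past. *)

definition allocation_process :: "nat \<Rightarrow> 'a alloc_proc \<Rightarrow> bool" where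
  "allocation_process n A \<longleftrightarrow>
     prob_space (prob_sp A) \<and>
     (\<forall>t. \<forall>i\<in>{1..n}. load A t i \<in> measurable (prob_sp A) (count_space UNIV)) \<and>
     (\<forall>t. chosen A t \<in> measurable (prob_sp A) (count_space UNIV)) \<and>
     (\<forall>t. \<forall>j\<in>{1..n}. (\<lambda>\<omega>. relabel A t \<omega> j) \<in> measurable (prob_sp A) (count_space UNIV)) \<and>
     (\<forall>\<omega>\<in>space (prob_sp A).
        (\<forall>i\<in>{1..n}. load A 0 i \<omega> = 0) \<and>
        (\<forall>t. chosen A t \<omega> \<in> {1..n} \<and>
             load A t (chosen A t \<omega>) \<omega> < load A (Suc t) (chosen A t \<omega>) \<omega> \<and>
             (\<forall>i\<in>{1..n} - {chosen A t \<omega>}. load A (Suc t) i \<omega> = load A t i \<omega>) \<and>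
             bij_betw (relabel A t \<omega>) {1..n} {1..n} \<and>
             (\<forall>i\<in>{1..n}. \<forall>j\<in>{1..n}. i \<le> j \<longrightarrow>
                load A t (relabel A t \<omega> j) \<omega> \<le> load A t (relabel A t \<omega> i) \<omega>)))"

definition total_load :: "nat \<Rightarrow> 'a alloc_proc \<Rightarrow> nat \<Rightarrow> 'a \<Rightarrow> nat" where
  "total_load n A t \<omega> = (\<Sum>i\<in>{1..n}. load A t i \<omega>)"

definition norm_load :: "nat \<Rightarrow> 'a alloc_proc \<Rightarrow> nat \<Rightarrow> nat \<Rightarrow> 'a \<Rightarrow> real" where
  "norm_load n A t i \<omega> = real (load A t i \<omega>) - real (total_load n A t \<omega>) / real n"

definition gap :: "nat \<Rightarrow> 'a alloc_proc \<Rightarrow> nat \<Rightarrow> 'a \<Rightarrow> real" where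
  "gap n A t \<omega> = real (Max ((\<lambda>i. load A t i \<omega>) ` {1..n})) - real (total_load n A t \<omega>) / real n"

(* The sigma-algebra of the first t allocations.  The bins chosen in these allocations are determined
   by the loads x^0, ..., x^t, because every allocation strictly increases the load of exactly the
   chosen bin. *)

definition alloc_filtration :: "nat \<Rightarrow> 'a alloc_proc \<Rightarrow> nat \<Rightarrow> 'a measure" where
  "alloc_filtration n A t = sigma (space (prob_sp A))
     {load A s i -` {k} \<inter> space (prob_sp A) | s i k. s \<le> t \<and> i \<in> {1..n}}"

lemma subalgebra_alloc_filtration:
  assumes "allocation_process n A"
  shows "subalgebra (prob_sp A) (alloc_filtration n A t)"
proof -
  have "load A s i -` {k} \<inter> space (prob_sp A) \<in> sets (prob_sp A)" if "i \<in> {1..n}" for s i k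
  proof (rule measurable_sets)
    show "load A s i \<in> measurable (prob_sp A) (count_space UNIV)"
      using assms that unfolding allocation_process_def by blast
  qed simp
  hence "{load A s i -` {k} \<inter> space (prob_sp A) | s i k. s \<le> t \<and> i \<in> {1..n}} \<subseteq> sets (prob_sp A)"
    by blast
  thus ?thesis
    unfolding subalgebra_def alloc_filtration_def
    by (subst sets_measure_of) (auto intro!: sets.sigma_sets_subset simp: space_measure_of_conv)
qed

(* p_j^t: the conditional probability that the (t+1)-th chosen bin is the j-th heaviest one. *)

definition rank_prob :: "nat \<Rightarrow> 'a alloc_proc \<Rightarrow> nat \<Rightarrow> nat \<Rightarrow> 'a \<Rightarrow> real" where
  "rank_prob n A t j = real_cond_exp (prob_sp A) (alloc_filtration n A t)
     (indicator {\<omega> \<in> space (prob_sp A). chosen A t \<omega> = relabel A t \<omega> j})"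

(* Overloaded and underloaded bins as sets of ranks. As the loads are sorted, over_bins consists of
   the ranks 1..k with k = card over_bins = delta * n, and under_bins of the ranks k+1..n. *)

definition over_bins :: "nat \<Rightarrow> 'a alloc_proc \<Rightarrow> nat \<Rightarrow> 'a \<Rightarrow> nat set" where
  "over_bins n A t \<omega> = {j \<in> {1..n}. 0 \<le> norm_load n A t (relabel A t \<omega> j) \<omega>}"

definition under_bins :: "nat \<Rightarrow> 'a alloc_proc \<Rightarrow> nat \<Rightarrow> 'a \<Rightarrow> nat set" where
  "under_bins n A t \<omega> = {1..n} - over_bins n A t \<omega>"

lemma over_bins_eq:
  assumes "allocation_process n A" "\<omega> \<in> space (prob_sp A)"
  shows "over_bins n A t \<omega> = {1..card (over_bins n A t \<omega>)}"
proof (cases "over_bins n A t \<omega> = {}")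
  case False
  let ?B = "over_bins n A t \<omega>"
  have fin: "finite ?B" by (simp add: over_bins_def)
  have down: "i \<in> ?B" if "j \<in> ?B" "1 \<le> i" "i \<le> j" for i j
  proof -
    have mem: "i \<in> {1..n}" "j \<in> {1..n}" using that by (auto simp: over_bins_def)
    hence "load A t (relabel A t \<omega> j) \<omega> \<le> load A t (relabel A t \<omega> i) \<omega>"
      using assms that unfolding allocation_process_def by blast
    thus ?thesis using that mem by (auto simp: over_bins_def norm_load_def)
  qed
  have "?B = {1..Max ?B}"
  proof
    show "?B \<subseteq> {1..Max ?B}" using Max_ge[OF fin] by (auto simp: over_bins_def)
    show "{1..Max ?B} \<subseteq> ?B" using down Max_in[OF fin False] by auto
  qed
  thus ?thesis by (metis card_atLeastAtMost diff_Suc_1)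
qed simp

definition over_frac :: "nat \<Rightarrow> 'a alloc_proc \<Rightarrow> nat \<Rightarrow> 'a \<Rightarrow> real" where
  "over_frac n A t \<omega> = real (card (over_bins n A t \<omega>)) / real n"

definition under_prob :: "nat \<Rightarrow> 'a alloc_proc \<Rightarrow> nat \<Rightarrow> 'a \<Rightarrow> real" where
  "under_prob n A t \<omega> = (\<Sum>j\<in>under_bins n A t \<omega>. rank_prob n A t j \<omega>)"

(* Partial-sum domination of vectors of equal length (the entries are not sorted). *)

definition dominates :: "real list \<Rightarrow> real list \<Rightarrow> bool" where
  "dominates p q \<longleftrightarrow> length p = length q \<and>
     (\<forall>k\<le>length p. sum_list (take k q) \<le> sum_list (take k p))"

(* (p_1, ..., p_{delta n}) and (p_n, p_{n-1}, ..., p_{delta n + 1}) *)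

definition over_vec :: "nat \<Rightarrow> 'a alloc_proc \<Rightarrow> nat \<Rightarrow> 'a \<Rightarrow> real list" where
  "over_vec n A t \<omega> =
     map (\<lambda>j. rank_prob n A t j \<omega>) [1..<Suc (card (over_bins n A t \<omega>))]"

definition under_vec :: "nat \<Rightarrow> 'a alloc_proc \<Rightarrow> nat \<Rightarrow> 'a \<Rightarrow> real list" where
  "under_vec n A t \<omega> =
     map (\<lambda>j. rank_prob n A t j \<omega>) (rev [Suc (card (over_bins n A t \<omega>))..<Suc n])"

(* The conditions are imposed on a family (A n) of processes, one for each number n of bins, so that
   the constants do not depend on n or t.  As the p_j^t are conditional probabilities, the conditions
   are required almost surely. *)

definition cond_P1 :: "(nat \<Rightarrow> 'a alloc_proc) \<Rightarrow> bool" where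
  "cond_P1 A \<longleftrightarrow> (\<exists>(k1::nat) (k2::real). 1 \<le> k1 \<and> k2 \<in> {0<..1} \<and>
     (\<forall>n\<ge>1. \<forall>t. AE \<omega> in prob_sp (A n).
        (\<forall>j\<in>over_bins n (A n) t \<omega>. rank_prob n (A n) t j \<omega> \<le> real k1 / real n) \<and>
        dominates (replicate (card (over_bins n (A n) t \<omega>)) (1 / real n))
          (over_vec n (A n) t \<omega>) \<and>
        (\<forall>j\<in>under_bins n (A n) t \<omega>. k2 / real n \<le> rank_prob n (A n) t j \<omega>) \<and>
        dominates (under_vec n (A n) t \<omega>)
          (replicate (card (under_bins n (A n) t \<omega>)) (1 / real n))))"

definition cond_P2 :: "(nat \<Rightarrow> 'a alloc_proc) \<Rightarrow> bool" where
  "cond_P2 A \<longleftrightarrow> (\<exists>(k1::nat) (k2::real) (k3::real) (k4::real).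
     1 \<le> k1 \<and> k2 \<in> {0<..1} \<and> k3 \<in> {0<..1} \<and> k4 \<in> {0<..1} \<and>
     (\<forall>n\<ge>1. \<forall>t. AE \<omega> in prob_sp (A n).
        (\<forall>j\<in>over_bins n (A n) t \<omega>. rank_prob n (A n) t j \<omega> \<le> real k1 / real n) \<and>
        dominates (replicate (card (over_bins n (A n) t \<omega>))
            (1 / real n - k3 * (1 - over_frac n (A n) t \<omega>) / real n))
          (over_vec n (A n) t \<omega>) \<and>
        (\<forall>j\<in>under_bins n (A n) t \<omega>. k2 / real n \<le> rank_prob n (A n) t j \<omega>) \<and>
        dominates (under_vec n (A n) t \<omega>)
          (replicate (card (under_bins n (A n) t \<omega>))
            (1 / real n + k4 * over_frac n (A n) t \<omega> / real n))))"

definition weight_rule :: "(nat \<Rightarrow> 'a alloc_proc) \<Rightarrow> nat \<Rightarrow> nat \<Rightarrow> bool" where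
  "weight_rule A wp wm \<longleftrightarrow> (\<forall>n\<ge>1. \<forall>t. AE \<omega> in prob_sp (A n).
     load (A n) (Suc t) (chosen (A n) t \<omega>) \<omega> = load (A n) t (chosen (A n) t \<omega>) \<omega> +
       (if norm_load n (A n) t (chosen (A n) t \<omega>) \<omega> < 0 then wm else wp))"

definition cond_W1 :: "(nat \<Rightarrow> 'a alloc_proc) \<Rightarrow> bool" where
  "cond_W1 A \<longleftrightarrow> (\<exists>wp wm. 1 \<le> wp \<and> wp \<le> wm \<and> weight_rule A wp wm)"

definition cond_W2 :: "(nat \<Rightarrow> 'a alloc_proc) \<Rightarrow> bool" where
  "cond_W2 A \<longleftrightarrow> (\<exists>wp wm. 1 \<le> wp \<and> wp < wm \<and> weight_rule A wp wm) \<and>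
     (\<forall>n\<ge>1. \<forall>t. AE \<omega> in prob_sp (A n).
        dominates (under_vec n (A n) t \<omega>)
          (replicate (card (under_bins n (A n) t \<omega>))
            (under_prob n (A n) t \<omega> / real (card (under_bins n (A n) t \<omega>)))))"

end

theory Submission
  imports Defs
begin

text \<open>
  Since \<open>\<kappa>\<close> is free, it is enough to find a function \<open>V\<close> of the load vector that dominates
  \<open>exp (\<alpha> |y\<^sub>i|)\<close> up to a constant factor, for a constant \<open>\<alpha> > 0\<close>, and whose expectation is \<open>O(n)\<close> at
  all times; Markov's inequality does the rest. The bound on the expectation follows from the one-step
  drift \<open>E V' \<le> (1 - \<alpha>\<^sup>2/n) V + K\<close>.

  Let \<open>X\<close> and \<open>Y\<close> be (smoothed) exponential potentials of the overloads and the underloads, each at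
  least \<open>n\<close>. Relative to its size, \<open>X\<close> drops at rate \<open>\<alpha>(1-\<delta>)/n\<close>, \<open>Y\<close> drops at rate \<open>\<alpha>\<delta>/n\<close>, and the
  second-order terms cost only \<open>\<alpha>\<^sup>2/n\<close>. Hence the product \<open>XY\<close> decreases for every \<open>\<delta>\<close>, unless one of the two
  potentials is \<open>O(n)\<close>; in particular it decreases at a large multiple of \<open>\<alpha>\<^sup>2/n\<close> if the total overload
  \<open>D\<close> exceeds \<open>L n\<close> for a large constant \<open>L\<close>. If \<open>D \<le> L n\<close> and, say, \<open>Y = O(n)\<close>, then \<open>X\<close> can only fail
  to drop while \<open>\<delta>\<close> is close to \<open>1\<close>. In that situation a bounded functional (\<open>over_slack\<close>)
  decreases at constant rate, because the overloaded bins near the mean drift towards it while being hit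
  with probability at most \<open>k\<^sub>1/n\<close> each; so \<open>X exp (\<beta> over_slack)\<close> with \<open>\<beta>\<close> of order \<open>\<alpha>\<^sup>2\<close> drops always. The
  roles of \<open>X\<close> and \<open>Y\<close> are symmetric (\<open>under_slack\<close>), and \<open>V\<close> is the sum of \<open>XY/n\<close> and the two tilted
  potentials.
\<close>

section \<open>Exponential potentials\<close>

text \<open>The conditions bound the probabilities of underloaded bins from below only, so one such
  bin may be chosen with probability of order one. With a plain truncated exponential, lifting it
  across the mean would raise \<open>X\<close> by order \<alpha> and the product by order \<alpha>
  \<open>Y\<close>/n per step, more than tilts of order \<alpha>^2 can repair. Hence the smoothing:
  \<open>hinge\<close> is continuously differentiable, and a crossing costs order \<alpha>^2. The
  same obstacle is the reason why the product of the increments of \<open>X\<close> and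
  \<open>Y\<close> is bounded for each choice separately and not on average, and why
  \<open>over_slack\<close> carries correction terms. The tilts live at order \<alpha>^2 because
  this is the order of the errors that they must beat; being bounded, they change a potential by at
  most a factor 2 and interact with its increments only at order \<alpha>^3. Both pairs of
  conditions enter through the single locale \<open>alloc_step\<close>. Its surplus \<open>c\<close>
  comes from biased probabilities in one case and from unequal weights in the other.\<close>

declare One_nat_def [simp del]

definition avg :: "nat \<Rightarrow> (nat \<Rightarrow> nat) \<Rightarrow> real" where
  "avg n x = (\<Sum>i\<in>{1..n}. real (x i)) / real n"

definition dev :: "nat \<Rightarrow> (nat \<Rightarrow> nat) \<Rightarrow> nat \<Rightarrow> real" where
  "dev n x i = real (x i) - avg n x"

definition weight :: "nat \<Rightarrow> nat \<Rightarrow> nat \<Rightarrow> (nat \<Rightarrow> nat) \<Rightarrow> nat \<Rightarrow> nat" where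
  "weight n wp wm x j = (if dev n x j < 0 then wm else wp)"

definition allocate :: "nat \<Rightarrow> nat \<Rightarrow> nat \<Rightarrow> (nat \<Rightarrow> nat) \<Rightarrow> nat \<Rightarrow> nat \<Rightarrow> nat" where
  "allocate n wp wm x j = x(j := x j + weight n wp wm x j)"

definition hexp :: "real \<Rightarrow> real \<Rightarrow> real" where
  "hexp \<alpha> z = exp (\<alpha> * max z 0)"

text \<open>The exponential minus its tangent at 0, cut off below 0. The derivative \<alpha>
  (\<open>hexp \<alpha> z\<close> - 1) vanishes at the cut.\<close>

definition hinge :: "real \<Rightarrow> real \<Rightarrow> real" where
  "hinge \<alpha> z = exp (\<alpha> * max z 0) - 1 - \<alpha> * max z 0"

text \<open>The summand n makes an absolute error of order \<alpha>^2 per step a relative error of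
  order \<alpha>^2/n. The sign \<open>s\<close> = 1 selects overloads, \<open>s\<close> = -1
  underloads.\<close>

definition pot :: "real \<Rightarrow> real \<Rightarrow> nat \<Rightarrow> (nat \<Rightarrow> nat) \<Rightarrow> real" where
  "pot \<alpha> s n x = real n + (\<Sum>i\<in>{1..n}. hinge \<alpha> (s * dev n x i))"

section \<open>Second-order estimates for the smoothed exponential\<close>

lemma exp_le_quadratic:
  fixes s :: real
  assumes "s \<le> 1"
  shows "exp s \<le> 1 + s + s\<^sup>2"
proof (cases "0 \<le> s")
  case True
  thus ?thesis using exp_bound assms by blast
next
  case False
  define t where "t = - s"
  have t: "0 \<le> t" using False by (simp add: t_def)
  have q: "1 + t + t\<^sup>2/2 \<le> exp t" using exp_lower_Taylor_quadratic[OF t] by simp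
  \<comment> \<open>With t = -s the claim is 1 <= (1 - t + t^2) exp(t). Replacing exp(t) by its
    quadratic Taylor minorant leaves 1 plus nonnegative terms.\<close>
  have "(1 - t + t\<^sup>2) * (1 + t + t\<^sup>2/2) = 1 + t\<^sup>2/2 + t^3/2 + t^4/2"
    by (simp add: field_simps power2_eq_square power3_eq_cube power4_eq_xxxx)
  hence "1 \<le> (1 - t + t\<^sup>2) * (1 + t + t\<^sup>2/2)" using t by simp
  also have "\<dots> \<le> (1 - t + t\<^sup>2) * exp t"
  proof (rule mult_left_mono[OF q])
    have "0 \<le> (t - 1/2)\<^sup>2" by simp
    thus "0 \<le> 1 - t + t\<^sup>2" by (simp add: power2_eq_square algebra_simps)
  qed
  finally have "exp (-t) \<le> 1 - t + t\<^sup>2"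
    by (simp add: exp_minus field_simps)
  thus ?thesis by (simp add: t_def)
qed

lemma hexp_ge_1: "0 \<le> \<alpha> \<Longrightarrow> 1 \<le> hexp \<alpha> z"
  by (simp add: hexp_def)

lemma hinge_nonneg: "0 \<le> hinge \<alpha> z"
  using exp_ge_add_one_self[of "\<alpha> * max z 0"] unfolding hinge_def by linarith

lemma hinge_nonpos_arg: "z \<le> 0 \<Longrightarrow> hinge \<alpha> z = 0"
  by (simp add: hinge_def max_def)

lemma hexp_nonpos_arg: "z \<le> 0 \<Longrightarrow> hexp \<alpha> z = 1"
  by (simp add: hexp_def max_def)

lemma hinge_hexp: "hinge \<alpha> z = hexp \<alpha> z - 1 - \<alpha> * max z 0"
  by (simp add: hinge_def hexp_def)

text \<open>This amounts to 2 s <= exp(s): removing the tangent costs at most a factor 2, so sums of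
  \<open>hexp\<close> are controlled by \<open>pot\<close>.\<close>

lemma hexp_le_hinge: "hexp \<alpha> z \<le> 2 * (1 + hinge \<alpha> z)"
proof -
  let ?s = "\<alpha> * max z 0"
  have "2 * ?s \<le> exp ?s"
  proof (cases "0 \<le> ?s")
    case True
    have "1 + ?s + ?s\<^sup>2/2 \<le> exp ?s" using exp_lower_Taylor_quadratic[OF True] by simp
    moreover have "0 \<le> (?s - 1)\<^sup>2" by simp
    ultimately show ?thesis by (simp add: power2_eq_square algebra_simps)
  next
    case False
    thus ?thesis using exp_ge_zero[of ?s] by linarith
  qed
  thus ?thesis by (simp add: hexp_def hinge_def algebra_simps)
qed

text \<open>For z >= 0 the branch without cut majorizes \<open>hinge\<close> even past 0, and
  exp(\<alpha> \<xi>) is expanded to second order. For z < 0 only the part of \<xi> beyond 0 acts,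
  and there \<open>hinge\<close> starts quadratically, so no linear term appears.\<close>

lemma hinge_tangent_upper:
  assumes "0 \<le> \<alpha>" "\<alpha> * \<bar>\<xi>\<bar> \<le> 1"
  shows "hinge \<alpha> (z + \<xi>) \<le> hinge \<alpha> z + \<alpha> * (hexp \<alpha> z - 1) * \<xi> + \<alpha>\<^sup>2 * \<xi>\<^sup>2 * hexp \<alpha> z"
proof -
  have s: "\<alpha> * \<xi> \<le> 1"
    using assms by (metis abs_ge_self mult_left_mono order_trans)
  have q: "exp (\<alpha> * \<xi>) \<le> 1 + \<alpha> * \<xi> + (\<alpha> * \<xi>)\<^sup>2" by (rule exp_le_quadratic[OF s])
  show ?thesis
  proof (cases "0 \<le> z")
    case True
    have "exp (\<alpha> * z) * exp (\<alpha> * \<xi>) \<le> exp (\<alpha> * z) * (1 + \<alpha> * \<xi> + (\<alpha> * \<xi>)\<^sup>2)"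
      by (rule mult_left_mono[OF q]) simp
    hence e: "exp (\<alpha> * (z + \<xi>)) - 1 - \<alpha> * (z + \<xi>)
        \<le> hinge \<alpha> z + \<alpha> * (hexp \<alpha> z - 1) * \<xi> + \<alpha>\<^sup>2 * \<xi>\<^sup>2 * hexp \<alpha> z"
      using True by (simp add: hinge_def hexp_def exp_add algebra_simps power_mult_distrib)
    have "0 \<le> exp (\<alpha> * (z + \<xi>)) - 1 - \<alpha> * (z + \<xi>)"
      using exp_ge_add_one_self[of "\<alpha> * (z + \<xi>)"] by linarith
    hence "hinge \<alpha> (z + \<xi>) \<le> exp (\<alpha> * (z + \<xi>)) - 1 - \<alpha> * (z + \<xi>)"
      by (auto simp: hinge_def max_def)
    with e show ?thesis by linarith
  next
    case False
    hence z: "hinge \<alpha> z = 0" "hexp \<alpha> z = 1" by (simp_all add: hinge_nonpos_arg hexp_nonpos_arg)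
    show ?thesis
    proof (cases "0 \<le> z + \<xi>")
      case True
      let ?t = "\<alpha> * (z + \<xi>)"
      have t: "0 \<le> ?t" "?t \<le> \<alpha> * \<xi>" using True False assms by (auto intro: mult_left_mono)
      hence "exp ?t \<le> 1 + ?t + ?t\<^sup>2" using s by (intro exp_le_quadratic) linarith
      hence "hinge \<alpha> (z + \<xi>) \<le> ?t\<^sup>2" using True by (simp add: hinge_def)
      also have "\<dots> \<le> (\<alpha> * \<xi>)\<^sup>2" using t by (intro power_mono)
      finally show ?thesis by (simp add: z power_mult_distrib)
    qed (simp add: z hinge_nonpos_arg)
  qed
qed

text \<open>Convexity of \<open>hinge\<close>, checked separately on the two sides of the
  cut.\<close>

lemma hinge_tangent_lower:
  assumes "0 \<le> \<alpha>"
  shows "hinge \<alpha> z + \<alpha> * (hexp \<alpha> z - 1) * \<xi> \<le> hinge \<alpha> (z + \<xi>)"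
proof (cases "0 \<le> z")
  case z: True
  show ?thesis
  proof (cases "0 \<le> z + \<xi>")
    case True
    have "exp (\<alpha> * z) * (1 + \<alpha> * \<xi>) \<le> exp (\<alpha> * z) * exp (\<alpha> * \<xi>)"
      by (intro mult_left_mono exp_ge_add_one_self) simp
    thus ?thesis using True z
      by (simp add: hinge_def hexp_def exp_add algebra_simps)
  next
    case False
    have "\<alpha> * (hexp \<alpha> z - 1) * \<xi> \<le> \<alpha> * (hexp \<alpha> z - 1) * (- z)"
      using False assms hexp_ge_1[OF assms, of z] by (intro mult_left_mono) auto
    moreover have "exp (\<alpha> * z) * (1 - \<alpha> * z) \<le> exp (\<alpha> * z) * exp (- (\<alpha> * z))"
      using exp_ge_add_one_self[of "- (\<alpha> * z)"] by (intro mult_left_mono) auto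
    hence "exp (\<alpha> * z) * (1 - \<alpha> * z) \<le> 1" by (simp flip: exp_add)
    hence "hinge \<alpha> z + \<alpha> * (hexp \<alpha> z - 1) * (- z) \<le> 0"
      using z by (simp add: hinge_def hexp_def algebra_simps)
    ultimately show ?thesis using hinge_nonneg[of \<alpha> "z + \<xi>"] by linarith
  qed
next
  case False
  thus ?thesis by (simp add: hinge_nonpos_arg hexp_nonpos_arg hinge_nonneg)
qed

lemma hinge_diff_bound:
  assumes "0 \<le> \<alpha>" "\<alpha> * \<bar>\<xi>\<bar> \<le> 1"
  shows "\<bar>hinge \<alpha> (z + \<xi>) - hinge \<alpha> z\<bar> \<le> 2 * \<alpha> * \<bar>\<xi>\<bar> * hexp \<alpha> z"
proof -
  have h: "1 \<le> hexp \<alpha> z" by (rule hexp_ge_1[OF assms(1)])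
  have "\<bar>\<alpha> * (hexp \<alpha> z - 1) * \<xi>\<bar> = \<alpha> * \<bar>\<xi>\<bar> * (hexp \<alpha> z - 1)"
    using assms(1) h by (simp add: abs_mult)
  also have "\<dots> \<le> \<alpha> * \<bar>\<xi>\<bar> * hexp \<alpha> z" using assms(1) by (intro mult_left_mono) auto
  finally have a: "\<bar>\<alpha> * (hexp \<alpha> z - 1) * \<xi>\<bar> \<le> \<alpha> * \<bar>\<xi>\<bar> * hexp \<alpha> z" .
  have "\<alpha>\<^sup>2 * \<xi>\<^sup>2 = (\<alpha> * \<bar>\<xi>\<bar>) * (\<alpha> * \<bar>\<xi>\<bar>)" by (simp add: power2_eq_square algebra_simps)
  also have "\<dots> \<le> (\<alpha> * \<bar>\<xi>\<bar>) * 1" using assms by (intro mult_left_mono) auto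
  finally have "\<alpha>\<^sup>2 * \<xi>\<^sup>2 * hexp \<alpha> z \<le> \<alpha> * \<bar>\<xi>\<bar> * hexp \<alpha> z"
    using h by (intro mult_right_mono) auto
  thus ?thesis
    using a hinge_tangent_upper[OF assms, of z] hinge_tangent_lower[OF assms(1), of z \<xi>]
    by linarith
qed

lemma pot_ge: "real n \<le> pot \<alpha> s n x"
  by (simp add: pot_def sum_nonneg hinge_nonneg)

lemma sum_hexp_le_pot: "(\<Sum>i\<in>{1..n}. hexp \<alpha> (s * dev n x i)) \<le> 2 * pot \<alpha> s n x"
proof -
  have "(\<Sum>i\<in>{1..n}. hexp \<alpha> (s * dev n x i)) \<le> (\<Sum>i\<in>{1..n}. 2 * (1 + hinge \<alpha> (s * dev n x i)))"
    by (intro sum_mono hexp_le_hinge)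
  also have "\<dots> = 2 * pot \<alpha> s n x"
    by (simp add: pot_def sum.distrib sum_distrib_left algebra_simps)
  finally show ?thesis .
qed

lemma sum_mult_affine:
  "(\<Sum>i\<in>I. f i * (g i * a + b)) = a * (\<Sum>i\<in>I. f i * g i) + b * (\<Sum>i\<in>I. f i)"
  for f g :: "'b \<Rightarrow> real"
  by (simp add: sum_distrib_left sum.distrib algebra_simps)

text \<open>The common abstraction of both pairs of conditions, later instantiated with ranks as bin
  labels. \<open>over_drift\<close> and \<open>under_drift\<close> are the prefix-sum conditions
  tested against all monotone weights, which is the form needed for derivatives of potentials. They
  compare the balls sent to a bin with the mean number of balls per bin; the surplus
  \<open>c\<close> makes overloads and underloads shrink.\<close>

locale alloc_step =
  fixes n :: nat and x :: "nat \<Rightarrow> nat" and p :: "nat \<Rightarrow> real" and wp wm k1 :: nat and k2 c :: real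
  assumes n_pos: "1 \<le> n"
    and p_nonneg: "j \<in> {1..n} \<Longrightarrow> 0 \<le> p j"
    and p_sum: "(\<Sum>j\<in>{1..n}. p j) = 1"
    and wp_ge: "1 \<le> wp" and wp_le: "wp \<le> wm"
    and p_over: "j \<in> {1..n} \<Longrightarrow> 0 \<le> dev n x j \<Longrightarrow> p j \<le> real k1 / real n"
    and p_under: "j \<in> {1..n} \<Longrightarrow> dev n x j < 0 \<Longrightarrow> k2 / real n \<le> p j"
    and c_pos: "0 < c" and c_le: "c \<le> 1" and k2_pos: "0 < k2"
    and over_drift: "mono \<phi> \<Longrightarrow> (\<And>z. 0 \<le> \<phi> z) \<Longrightarrow>
      real wp * (\<Sum>j\<in>{j\<in>{1..n}. 0 \<le> dev n x j}. \<phi> (dev n x j) * p j)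
       \<le> ((\<Sum>j\<in>{1..n}. p j * real (weight n wp wm x j))
            - c * (1 - real (card {j\<in>{1..n}. 0 \<le> dev n x j}) / real n)) / real n
          * (\<Sum>j\<in>{j\<in>{1..n}. 0 \<le> dev n x j}. \<phi> (dev n x j))"
    and under_drift: "antimono \<phi> \<Longrightarrow> (\<And>z. 0 \<le> \<phi> z) \<Longrightarrow>
      ((\<Sum>j\<in>{1..n}. p j * real (weight n wp wm x j))
            + c * (real (card {j\<in>{1..n}. 0 \<le> dev n x j}) / real n)) / real n
          * (\<Sum>j\<in>{j\<in>{1..n}. dev n x j < 0}. \<phi> (dev n x j))
       \<le> real wm * (\<Sum>j\<in>{j\<in>{1..n}. dev n x j < 0}. \<phi> (dev n x j) * p j)"
begin

definition "y i = dev n x i"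
definition "wt j = real (weight n wp wm x j)"
definition "w = real wm"
definition "heavy = {j\<in>{1..n}. 0 \<le> dev n x j}"
definition "light = {j\<in>{1..n}. dev n x j < 0}"
definition "\<delta> = real (card heavy) / real n"
definition "wbar = (\<Sum>j\<in>{1..n}. p j * wt j)"
definition "\<xi> i j = (if i = j then wt j else 0) - wt j / real n"
definition "nx j = allocate n wp wm x j"

lemma heavy_light: "heavy \<union> light = {1..n}" "heavy \<inter> light = {}" "finite heavy" "finite light"
  by (auto simp: heavy_def light_def)

lemma sum_split: "(\<Sum>i\<in>{1..n}. f i) = (\<Sum>i\<in>heavy. f i) + (\<Sum>i\<in>light. f i)" for f :: "nat \<Rightarrow> real"
  by (metis heavy_light sum.union_disjoint)

lemma card_split: "real (card heavy) + real (card light) = real n"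
  using card_Un_disjoint[of heavy light] heavy_light by simp

lemma card_heavy: "real (card heavy) = \<delta> * real n"
  using n_pos by (simp add: \<delta>_def)

lemma card_light: "real (card light) = (1 - \<delta>) * real n"
  using card_split card_heavy by (simp add: algebra_simps)

lemma \<delta>_bounds: "0 \<le> \<delta>" "\<delta> \<le> 1"
  using card_split n_pos by (auto simp: \<delta>_def)

lemma divide_n_le: "0 \<le> r \<Longrightarrow> r / real n \<le> r" for r :: real
  using n_pos by (simp add: divide_le_eq mult_le_cancel_left1)

lemma w_ge: "1 \<le> w" using wp_ge wp_le by (simp add: w_def)

lemma wt_bounds: "1 \<le> wt j" "wt j \<le> w"
  using wp_ge wp_le by (auto simp: wt_def weight_def w_def)

lemma wt_light: "j \<in> light \<Longrightarrow> wt j = w" and wt_heavy: "j \<in> heavy \<Longrightarrow> wt j = real wp"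
  by (auto simp: wt_def weight_def w_def light_def heavy_def)

lemma mean_bound:
  assumes "\<And>j. j \<in> {1..n} \<Longrightarrow> f j \<le> b"
  shows "(\<Sum>j\<in>{1..n}. p j * f j) \<le> b"
proof -
  have "(\<Sum>j\<in>{1..n}. p j * f j) \<le> (\<Sum>j\<in>{1..n}. p j * b)"
    using assms p_nonneg by (intro sum_mono mult_left_mono)
  thus ?thesis by (simp add: p_sum flip: sum_distrib_right)
qed

lemma wbar_le: "wbar \<le> w" unfolding wbar_def by (intro mean_bound wt_bounds)

lemma dev_nx: "j \<in> {1..n} \<Longrightarrow> dev n (nx j) i = y i + \<xi> i j"
proof -
  assume j: "j \<in> {1..n}"
  have "(\<Sum>i\<in>{1..n}. real (nx j i)) = (\<Sum>i\<in>{1..n}. real (x i) + (if i = j then wt j else 0))"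
    by (intro sum.cong) (auto simp: nx_def allocate_def wt_def)
  also have "\<dots> = (\<Sum>i\<in>{1..n}. real (x i)) + wt j" using j by (simp add: sum.distrib)
  finally have "avg n (nx j) = avg n x + wt j / real n" by (simp add: avg_def add_divide_distrib)
  thus ?thesis by (auto simp: dev_def y_def \<xi>_def nx_def allocate_def wt_def)
qed

lemma \<xi>_abs: "\<bar>\<xi> i j\<bar> \<le> w"
proof -
  have "wt j / real n \<le> wt j" "0 \<le> wt j / real n"
    using wt_bounds[of j] by (auto intro: divide_n_le)
  thus ?thesis using wt_bounds[of j] unfolding \<xi>_def by (smt (verit))
qed

lemma \<xi>_neq: "i \<noteq> j \<Longrightarrow> \<bar>\<xi> i j\<bar> \<le> w / real n"
  using wt_bounds[of j] by (auto simp: \<xi>_def intro: divide_right_mono)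

lemma \<xi>_mean: "i \<in> {1..n} \<Longrightarrow> (\<Sum>j\<in>{1..n}. p j * \<xi> i j) = p i * wt i - wbar / real n"
proof -
  assume i: "i \<in> {1..n}"
  have "(\<Sum>j\<in>{1..n}. p j * \<xi> i j)
     = (\<Sum>j\<in>{1..n}. (if i = j then p j * wt j else 0) - p j * wt j / real n)"
    by (intro sum.cong) (auto simp: \<xi>_def algebra_simps)
  also have "\<dots> = p i * wt i - wbar / real n"
    using i by (simp add: sum_subtractf wbar_def sum_divide_distrib)
  finally show ?thesis .
qed

lemma \<xi>_sq: "i \<in> {1..n} \<Longrightarrow> (\<Sum>j\<in>{1..n}. p j * (\<xi> i j)\<^sup>2) \<le> p i * w\<^sup>2 + w\<^sup>2 / (real n)\<^sup>2"
proof -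
  assume i: "i \<in> {1..n}"
  have "(\<xi> i j)\<^sup>2 \<le> (if i = j then w\<^sup>2 else 0) + w\<^sup>2 / (real n)\<^sup>2" for j
  proof (cases "i = j")
    case True
    have "\<bar>\<xi> i j\<bar>\<^sup>2 \<le> w\<^sup>2" by (intro power_mono \<xi>_abs) auto
    thus ?thesis using True by (simp add: add_increasing2)
  next
    case False
    have "\<bar>\<xi> i j\<bar>\<^sup>2 \<le> (w / real n)\<^sup>2" using \<xi>_neq[OF False] by (intro power_mono) auto
    thus ?thesis using False by (simp add: power_divide)
  qed
  hence "(\<Sum>j\<in>{1..n}. p j * (\<xi> i j)\<^sup>2)
     \<le> (\<Sum>j\<in>{1..n}. p j * ((if i = j then w\<^sup>2 else 0) + w\<^sup>2 / (real n)\<^sup>2))"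
    using p_nonneg by (intro sum_mono mult_left_mono)
  also have "\<dots> = (\<Sum>j\<in>{1..n}. (if i = j then p j * w\<^sup>2 else 0) + p j * (w\<^sup>2 / (real n)\<^sup>2))"
    by (intro sum.cong) (auto simp: algebra_simps)
  also have "\<dots> = p i * w\<^sup>2 + w\<^sup>2 / (real n)\<^sup>2"
    unfolding sum.distrib sum_distrib_right[symmetric] p_sum using i by simp
  finally show ?thesis .
qed

section \<open>Drift of the overload and underload potentials\<close>

lemma pot_mean_step:
  assumes a: "0 \<le> \<alpha>" "\<alpha> * w \<le> 1" and s: "\<bar>s\<bar> = 1"
  shows "(\<Sum>j\<in>{1..n}. p j * pot \<alpha> s n (nx j)) \<le> pot \<alpha> s n x
    + (\<Sum>i\<in>{1..n}. \<alpha> * (hexp \<alpha> (s * y i) - 1) * (s * (p i * wt i - wbar / real n)))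
    + \<alpha>\<^sup>2 * (\<Sum>i\<in>{1..n}. hexp \<alpha> (s * y i) * (p i * w\<^sup>2 + w\<^sup>2 / (real n)\<^sup>2))"
proof -
  let ?e = "\<lambda>i. hexp \<alpha> (s * y i)"
  have s2: "s\<^sup>2 = 1" using s by (metis power2_abs one_power2)
  have step: "hinge \<alpha> (s * (y i + \<xi> i j)) \<le> hinge \<alpha> (s * y i) + \<alpha> * (?e i - 1) * s * \<xi> i j
      + \<alpha>\<^sup>2 * ?e i * (\<xi> i j)\<^sup>2" for i j
  proof -
    have "\<alpha> * \<bar>s * \<xi> i j\<bar> \<le> 1"
      using mult_left_mono[OF \<xi>_abs a(1), of i j] a(2) s by (simp add: abs_mult)
    from hinge_tangent_upper[OF a(1) this, of "s * y i"] show ?thesis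
      by (simp add: distrib_left power_mult_distrib s2 mult_ac)
  qed
  have "(\<Sum>j\<in>{1..n}. p j * pot \<alpha> s n (nx j))
      = (\<Sum>j\<in>{1..n}. p j * (real n + (\<Sum>i\<in>{1..n}. hinge \<alpha> (s * (y i + \<xi> i j)))))"
    by (intro sum.cong) (auto simp: pot_def dev_nx)
  also have "\<dots> \<le> (\<Sum>j\<in>{1..n}. p j * (real n + (\<Sum>i\<in>{1..n}. hinge \<alpha> (s * y i)
      + \<alpha> * (?e i - 1) * s * \<xi> i j + \<alpha>\<^sup>2 * ?e i * (\<xi> i j)\<^sup>2)))"
    using p_nonneg by (intro sum_mono mult_left_mono add_left_mono step)
  also have "\<dots> = (\<Sum>j\<in>{1..n}. p j * pot \<alpha> s n x)
      + (\<Sum>j\<in>{1..n}. \<Sum>i\<in>{1..n}. \<alpha> * (?e i - 1) * s * (p j * \<xi> i j))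
      + (\<Sum>j\<in>{1..n}. \<Sum>i\<in>{1..n}. \<alpha>\<^sup>2 * ?e i * (p j * (\<xi> i j)\<^sup>2))"
    by (simp add: pot_def y_def sum.distrib distrib_left sum_distrib_left mult_ac)
  also have "(\<Sum>j\<in>{1..n}. p j * pot \<alpha> s n x) = pot \<alpha> s n x"
    by (simp add: p_sum flip: sum_distrib_right)
  also have "(\<Sum>j\<in>{1..n}. \<Sum>i\<in>{1..n}. \<alpha> * (?e i - 1) * s * (p j * \<xi> i j))
      = (\<Sum>i\<in>{1..n}. \<alpha> * (?e i - 1) * (s * (p i * wt i - wbar / real n)))"
    by (subst sum.swap, intro sum.cong) (simp_all add: \<xi>_mean flip: sum_distrib_left)
  also have "(\<Sum>j\<in>{1..n}. \<Sum>i\<in>{1..n}. \<alpha>\<^sup>2 * ?e i * (p j * (\<xi> i j)\<^sup>2))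
      = \<alpha>\<^sup>2 * (\<Sum>i\<in>{1..n}. ?e i * (\<Sum>j\<in>{1..n}. p j * (\<xi> i j)\<^sup>2))"
    by (subst sum.swap) (simp add: sum_distrib_left mult_ac)
  also have "\<dots> \<le> \<alpha>\<^sup>2 * (\<Sum>i\<in>{1..n}. ?e i * (p i * w\<^sup>2 + w\<^sup>2 / (real n)\<^sup>2))"
    using hexp_ge_1[OF a(1)] by (intro mult_left_mono sum_mono \<xi>_sq) (auto intro: order_trans[OF zero_le_one])
  finally show ?thesis by simp
qed

definition "S \<alpha> s = (\<Sum>i\<in>{1..n}. hexp \<alpha> (s * y i) - 1)"
definition "D = (\<Sum>i\<in>{1..n}. max (y i) 0)"

lemma sum_hexp: "(\<Sum>i\<in>{1..n}. hexp \<alpha> (s * y i)) = real n + S \<alpha> s"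
  by (simp add: S_def sum_subtractf)

lemma S_nonneg: "0 \<le> \<alpha> \<Longrightarrow> 0 \<le> S \<alpha> s"
  using hexp_ge_1 by (auto simp: S_def intro: sum_nonneg)

text \<open>The derivative \<open>hexp\<close> - 1 is a nonnegative increasing function of the load
  that vanishes on underloaded bins, so \<open>over_drift\<close> applies to it and gives the linear
  term. In the quadratic term underloaded bins have \<open>hexp\<close> = 1 and contribute at most
  their total probability.\<close>

lemma over_pot_drift:
  assumes a: "0 \<le> \<alpha>" "\<alpha> * w \<le> 1"
  shows "(\<Sum>j\<in>{1..n}. p j * pot \<alpha> 1 n (nx j)) \<le> pot \<alpha> 1 n x
    - c * \<alpha> * (1 - \<delta>) / real n * S \<alpha> 1 + 8 * w\<^sup>2 * (real k1 + 2) * \<alpha>\<^sup>2 * pot \<alpha> 1 n x / real n"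
proof -
  let ?e = "\<lambda>i. hexp \<alpha> (y i)"
  have e0: "?e i = 1" if "i \<in> light" for i
    using that by (simp add: light_def y_def hexp_nonpos_arg)
  have n0: "0 < real n" using n_pos by simp
  have Sov: "S \<alpha> 1 = (\<Sum>i\<in>heavy. ?e i - 1)"
    by (simp add: S_def sum_split e0)
  have "mono (\<lambda>z. hexp \<alpha> z - 1)"
    using a(1) by (auto simp: mono_def hexp_def intro!: mult_left_mono)
  from over_drift[OF this, folded heavy_def light_def] hexp_ge_1[OF a(1)]
  have od: "real wp * (\<Sum>j\<in>heavy. (?e j - 1) * p j) \<le> (wbar - c * (1 - \<delta>)) / real n * S \<alpha> 1"
    by (simp add: Sov wbar_def wt_def \<delta>_def y_def)
  have "(\<Sum>i\<in>{1..n}. \<alpha> * (?e i - 1) * (p i * wt i - wbar / real n))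
     = (\<Sum>i\<in>heavy. \<alpha> * (?e i - 1) * (p i * wt i - wbar / real n))"
    by (simp add: sum_split e0)
  also have "\<dots> = (\<Sum>i\<in>heavy. \<alpha> * (real wp * ((?e i - 1) * p i)) - \<alpha> * (wbar / real n * (?e i - 1)))"
    by (intro sum.cong) (auto simp: wt_heavy algebra_simps diff_divide_distrib)
  also have "\<dots> = \<alpha> * (real wp * (\<Sum>i\<in>heavy. (?e i - 1) * p i)) - \<alpha> * (wbar / real n * S \<alpha> 1)"
    unfolding Sov sum_distrib_left by (simp add: sum_subtractf[symmetric])
  also have "\<dots> \<le> \<alpha> * ((wbar - c * (1 - \<delta>)) / real n * S \<alpha> 1) - \<alpha> * (wbar / real n * S \<alpha> 1)"
    using mult_left_mono[OF od a(1)] by linarith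
  also have "\<dots> = - c * \<alpha> * (1 - \<delta>) / real n * S \<alpha> 1"
    using n0 by (simp add: field_simps)
  finally have first: "(\<Sum>i\<in>{1..n}. \<alpha> * (?e i - 1) * (p i * wt i - wbar / real n))
     \<le> - c * \<alpha> * (1 - \<delta>) / real n * S \<alpha> 1" .
  have E: "real n \<le> (\<Sum>i\<in>{1..n}. ?e i)"
    using sum_hexp[of \<alpha> 1] S_nonneg[OF a(1), of 1] by simp
  have "(\<Sum>i\<in>{1..n}. ?e i * p i) = (\<Sum>i\<in>heavy. ?e i * p i) + (\<Sum>i\<in>light. p i)"
    by (simp add: sum_split e0)
  also have "(\<Sum>i\<in>heavy. ?e i * p i) \<le> (\<Sum>i\<in>heavy. ?e i * (real k1 / real n))"
    using p_over hexp_ge_1[OF a(1)] by (intro sum_mono mult_left_mono) (auto simp: heavy_def intro: order_trans[OF zero_le_one])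
  also have "\<dots> \<le> (\<Sum>i\<in>{1..n}. ?e i * (real k1 / real n))"
    using hexp_ge_1[OF a(1)] by (intro sum_mono2) (auto simp: heavy_def intro!: divide_nonneg_nonneg mult_nonneg_nonneg intro: order_trans[OF zero_le_one])
  also have "(\<Sum>i\<in>light. p i) \<le> (\<Sum>i\<in>{1..n}. p i)"
    using p_nonneg by (intro sum_mono2) (auto simp: light_def)
  also have "\<dots> \<le> (\<Sum>i\<in>{1..n}. ?e i) / real n"
    using E n0 by (simp add: p_sum)
  finally have pe: "(\<Sum>i\<in>{1..n}. ?e i * p i) \<le> (real k1 + 1) / real n * (\<Sum>i\<in>{1..n}. ?e i)"
    unfolding sum_distrib_right[symmetric] using n0 by (simp add: field_simps)
  have "(\<Sum>i\<in>{1..n}. ?e i * (p i * w\<^sup>2 + w\<^sup>2 / (real n)\<^sup>2))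
     = w\<^sup>2 * (\<Sum>i\<in>{1..n}. ?e i * p i) + w\<^sup>2 / (real n)\<^sup>2 * (\<Sum>i\<in>{1..n}. ?e i)"
    by (rule sum_mult_affine)
  also have "\<dots> \<le> w\<^sup>2 * ((real k1 + 1) / real n * (\<Sum>i\<in>{1..n}. ?e i)) + w\<^sup>2 / real n * (\<Sum>i\<in>{1..n}. ?e i)"
    using pe E n_pos by (intro add_mono mult_left_mono mult_right_mono divide_left_mono)
       (auto simp: power2_eq_square intro: order_trans[OF of_nat_0_le_iff])
  also have "\<dots> = w\<^sup>2 * (real k1 + 2) / real n * (\<Sum>i\<in>{1..n}. ?e i)"
    using n0 by (simp add: field_simps)
  also have "\<dots> \<le> w\<^sup>2 * (real k1 + 2) / real n * (2 * pot \<alpha> 1 n x)"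
    using sum_hexp_le_pot[of \<alpha> 1 n x] by (intro mult_left_mono) (auto simp: y_def)
  also have "\<dots> \<le> w\<^sup>2 * (real k1 + 2) / real n * (8 * pot \<alpha> 1 n x)"
    using pot_ge[of n \<alpha> 1 x] by (intro mult_left_mono) auto
  finally have "\<alpha>\<^sup>2 * (\<Sum>i\<in>{1..n}. ?e i * (p i * w\<^sup>2 + w\<^sup>2 / (real n)\<^sup>2))
      \<le> \<alpha>\<^sup>2 * (w\<^sup>2 * (real k1 + 2) / real n * (8 * pot \<alpha> 1 n x))"
    by (intro mult_left_mono) auto
  also have "\<dots> = 8 * w\<^sup>2 * (real k1 + 2) * \<alpha>\<^sup>2 * pot \<alpha> 1 n x / real n" by simp
  finally show ?thesis
    using first pot_mean_step[OF a, of 1, unfolded mult_1, OF abs_one] by linarith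
qed

text \<open>Here the quadratic term weights large exponentials by probabilities that may themselves
  be large. Its critical part \<alpha>^2 w^2 P is absorbed into the linear term - \<alpha> w P; to
  the rest, with coefficient \<alpha> (1 - \<alpha> w), \<open>under_drift\<close> still
  applies.\<close>

lemma under_pot_drift:
  assumes a: "0 \<le> \<alpha>" "\<alpha> * w \<le> 1"
  shows "(\<Sum>j\<in>{1..n}. p j * pot \<alpha> (-1) n (nx j)) \<le> pot \<alpha> (-1) n x
    - c * \<alpha> * \<delta> / real n * S \<alpha> (-1) + 8 * w\<^sup>2 * (real k1 + 2) * \<alpha>\<^sup>2 * pot \<alpha> (-1) n x / real n"
proof -
  let ?e = "\<lambda>i. hexp \<alpha> (- y i)"
  let ?S = "S \<alpha> (-1)"
  have e0: "?e i = 1" if "i \<in> heavy" for i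
    using that by (simp add: heavy_def y_def hexp_nonpos_arg)
  have n0: "0 < real n" using n_pos by simp
  have Sun: "?S = (\<Sum>i\<in>light. ?e i - 1)"
    by (simp add: S_def sum_split e0)
  have S0: "0 \<le> ?S" by (rule S_nonneg[OF a(1)])
  define P where "P = (\<Sum>j\<in>light. (?e j - 1) * p j)"
  have "antimono (\<lambda>z. hexp \<alpha> (- z) - 1)"
    using a(1) by (auto simp: antimono_def hexp_def intro!: mult_left_mono)
  from under_drift[OF this, folded heavy_def light_def] hexp_ge_1[OF a(1)]
  have ud: "(wbar + c * \<delta>) / real n * ?S \<le> w * P"
    by (simp add: Sun wbar_def wt_def \<delta>_def y_def w_def P_def)
  have "(\<Sum>i\<in>{1..n}. \<alpha> * (?e i - 1) * (-1 * (p i * wt i - wbar / real n)))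
     = (\<Sum>i\<in>light. \<alpha> * (?e i - 1) * (-1 * (p i * wt i - wbar / real n)))"
    by (simp add: sum_split e0)
  also have "\<dots> = (\<Sum>i\<in>light. \<alpha> * (wbar / real n * (?e i - 1)) - \<alpha> * (w * ((?e i - 1) * p i)))"
    by (intro sum.cong) (auto simp: wt_light algebra_simps diff_divide_distrib)
  also have "\<dots> = \<alpha> * (wbar / real n * ?S) - \<alpha> * (w * P)"
    unfolding Sun P_def sum_distrib_left by (simp add: sum_subtractf[symmetric])
  finally have first: "(\<Sum>i\<in>{1..n}. \<alpha> * (?e i - 1) * (-1 * (p i * wt i - wbar / real n)))
     = \<alpha> * (wbar / real n * ?S) - \<alpha> * (w * P)" .
  have "(\<Sum>i\<in>{1..n}. ?e i * p i) = (\<Sum>i\<in>{1..n}. (?e i - 1) * p i) + 1"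
    by (simp add: algebra_simps sum_subtractf p_sum)
  also have "\<dots> = P + 1" by (simp add: sum_split e0 P_def)
  finally have pe: "(\<Sum>i\<in>{1..n}. ?e i * p i) = P + 1" .
  have second: "(\<Sum>i\<in>{1..n}. ?e i * (p i * w\<^sup>2 + w\<^sup>2 / (real n)\<^sup>2))
     = w\<^sup>2 * (P + 1) + w\<^sup>2 / (real n)\<^sup>2 * (real n + ?S)"
  proof -
    have "(\<Sum>i\<in>{1..n}. ?e i) = real n + ?S" using sum_hexp[of \<alpha> "-1"] by simp
    thus ?thesis by (simp only: sum_mult_affine pe)
  qed
  have le: "w\<^sup>2 / (real n)\<^sup>2 * (real n + ?S) \<le> w\<^sup>2 / real n * (real n + ?S)"
    using n_pos S0 by (intro mult_right_mono divide_left_mono) (auto simp: power2_eq_square)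
  define Z where "Z = ?S / real n"
  have Z0: "0 \<le> Z" using S0 by (simp add: Z_def)
  have ZS: "r / real n * ?S = r * Z" for r by (simp add: Z_def)
  define R where "R = w\<^sup>2 / (real n)\<^sup>2 * (real n + ?S)"
  have R: "R \<le> w\<^sup>2 + w\<^sup>2 * Z" using le n0 by (simp add: R_def Z_def field_simps)
  have m1: "\<alpha> * (1 - \<alpha> * w) * ((wbar + c * \<delta>) * Z) \<le> \<alpha> * (1 - \<alpha> * w) * (w * P)"
    using a ud[unfolded ZS] by (intro mult_left_mono) auto
  have m2: "\<alpha> * (\<alpha> * w) * ((wbar + c * \<delta>) * Z) \<le> \<alpha> * (\<alpha> * w) * (2 * w * Z)"
  proof -
    have "c * \<delta> \<le> 1" using c_pos c_le \<delta>_bounds by (simp add: mult_le_one)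
    hence "wbar + c * \<delta> \<le> 2 * w" using wbar_le w_ge by linarith
    thus ?thesis using a w_ge Z0 by (intro mult_left_mono mult_right_mono) auto
  qed
  have m3: "\<alpha>\<^sup>2 * R \<le> \<alpha>\<^sup>2 * (w\<^sup>2 + w\<^sup>2 * Z)" by (intro mult_left_mono R) simp
  have m4: "0 \<le> \<alpha>\<^sup>2 * w\<^sup>2 * Z" using Z0 by simp
  have m5: "0 \<le> \<alpha>\<^sup>2 * w\<^sup>2" by simp
  have "\<alpha> * (wbar * Z) - \<alpha> * (w * P) + \<alpha>\<^sup>2 * (w\<^sup>2 * (P + 1) + R)
    \<le> - c * \<alpha> * \<delta> * Z + 4 * \<alpha>\<^sup>2 * w\<^sup>2 * (1 + Z)"
    using m1 m2 m3 m4 m5 by (simp add: algebra_simps power2_eq_square)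
  also have "4 * \<alpha>\<^sup>2 * w\<^sup>2 * (1 + Z) = 4 * \<alpha>\<^sup>2 * w\<^sup>2 / real n * (real n + ?S)"
    using n0 by (simp add: Z_def field_simps)
  also have "4 * \<alpha>\<^sup>2 * w\<^sup>2 / real n * (real n + ?S) \<le> 4 * \<alpha>\<^sup>2 * w\<^sup>2 / real n * (2 * pot \<alpha> (-1) n x)"
    using sum_hexp_le_pot[of \<alpha> "-1" n x] sum_hexp[of \<alpha> "-1"]
    by (intro mult_left_mono) (auto simp: y_def)
  also have "\<dots> = 8 * w\<^sup>2 * 1 * \<alpha>\<^sup>2 * pot \<alpha> (-1) n x / real n" by simp
  \<comment> \<open>Enlarged so that both potentials share one error constant.\<close>
  also have "\<dots> \<le> 8 * w\<^sup>2 * (real k1 + 2) * \<alpha>\<^sup>2 * pot \<alpha> (-1) n x / real n"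
    using pot_ge[of n \<alpha> "-1" x]
    by (intro divide_right_mono mult_right_mono mult_left_mono) auto
  finally show ?thesis
    using pot_mean_step[OF a, of "-1"] first second by (simp add: Z_def R_def)
qed

text \<open>Separates the chosen bin, which may move by w, from the others, which move by at most
  w/n each. The others together change the potential only by a relative amount of order
  \<alpha>/n.\<close>

lemma pot_diff_split:
  assumes a: "0 \<le> \<alpha>" "\<alpha> * w \<le> 1" and s: "\<bar>s\<bar> = 1" and j: "j \<in> {1..n}"
  defines "b \<equiv> hinge \<alpha> (s * (y j + \<xi> j j)) - hinge \<alpha> (s * y j)"
  shows "\<bar>pot \<alpha> s n (nx j) - pot \<alpha> s n x - b\<bar> \<le> 4 * \<alpha> * w * pot \<alpha> s n x / real n"
    and "\<bar>b\<bar> \<le> 4 * \<alpha> * w * pot \<alpha> s n x"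
proof -
  let ?e = "\<lambda>i. hexp \<alpha> (s * y i)"
  have ax: "\<alpha> * \<bar>s * \<xi> i j\<bar> \<le> 1" for i
    using mult_left_mono[OF \<xi>_abs a(1), of i j] a(2) s by (simp add: abs_mult)
  have e0: "0 \<le> ?e i" for i using hexp_ge_1[OF a(1)] by (auto intro: order_trans[OF zero_le_one])
  have E: "(\<Sum>i\<in>{1..n}. ?e i) \<le> 2 * pot \<alpha> s n x"
    using sum_hexp_le_pot[of \<alpha> s n x] by (simp add: y_def)
  have d: "\<bar>hinge \<alpha> (s * (y i + \<xi> i j)) - hinge \<alpha> (s * y i)\<bar> \<le> 2 * \<alpha> * \<bar>\<xi> i j\<bar> * ?e i" for i
    using hinge_diff_bound[OF a(1) ax, of "s * y i" i] s by (simp add: distrib_left abs_mult)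
  have "pot \<alpha> s n (nx j) - pot \<alpha> s n x
      = (\<Sum>i\<in>{1..n}. hinge \<alpha> (s * (y i + \<xi> i j)) - hinge \<alpha> (s * y i))"
    using j by (simp add: pot_def dev_nx sum_subtractf y_def)
  also have "\<dots> = b + (\<Sum>i\<in>{1..n}-{j}. hinge \<alpha> (s * (y i + \<xi> i j)) - hinge \<alpha> (s * y i))"
    using j by (simp add: sum.remove b_def)
  finally have "\<bar>pot \<alpha> s n (nx j) - pot \<alpha> s n x - b\<bar>
      \<le> (\<Sum>i\<in>{1..n}-{j}. \<bar>hinge \<alpha> (s * (y i + \<xi> i j)) - hinge \<alpha> (s * y i)\<bar>)" by simp
  also have "\<dots> \<le> (\<Sum>i\<in>{1..n}-{j}. 2 * \<alpha> * (w / real n) * ?e i)"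
  proof (intro sum_mono order_trans[OF d] mult_right_mono mult_left_mono e0)
    fix i assume "i \<in> {1..n} - {j}"
    thus "\<bar>\<xi> i j\<bar> \<le> w / real n" using \<xi>_neq by simp
  qed (use a in auto)
  also have "\<dots> \<le> (\<Sum>i\<in>{1..n}. 2 * \<alpha> * (w / real n) * ?e i)"
    using a w_ge e0 by (intro sum_mono2) auto
  also have "\<dots> \<le> 2 * \<alpha> * (w / real n) * (2 * pot \<alpha> s n x)"
    using a w_ge E by (subst sum_distrib_left[symmetric]) (intro mult_left_mono, auto)
  finally show "\<bar>pot \<alpha> s n (nx j) - pot \<alpha> s n x - b\<bar> \<le> 4 * \<alpha> * w * pot \<alpha> s n x / real n"
    by simp
  have "?e j \<le> (\<Sum>i\<in>{1..n}. ?e i)" using j e0 by (intro member_le_sum) auto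
  hence ej: "?e j \<le> 2 * pot \<alpha> s n x" using E by linarith
  have "\<bar>b\<bar> \<le> 2 * \<alpha> * \<bar>\<xi> j j\<bar> * ?e j" using d[of j] by (simp add: b_def)
  also have "\<dots> \<le> 2 * \<alpha> * w * (2 * pot \<alpha> s n x)"
    using a w_ge e0 ej \<xi>_abs by (intro mult_mono) auto
  finally show "\<bar>b\<bar> \<le> 4 * \<alpha> * w * pot \<alpha> s n x" by simp
qed

lemma pot_diff_bound:
  assumes a: "0 \<le> \<alpha>" "\<alpha> * w \<le> 1" and s: "\<bar>s\<bar> = 1" and j: "j \<in> {1..n}"
  shows "\<bar>pot \<alpha> s n (nx j) - pot \<alpha> s n x\<bar> \<le> 8 * \<alpha> * w * pot \<alpha> s n x"
proof -
  have "4 * \<alpha> * w * pot \<alpha> s n x / real n \<le> 4 * \<alpha> * w * pot \<alpha> s n x"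
    by (rule divide_n_le) (use a w_ge pot_ge[of n \<alpha> s x] in auto)
  thus ?thesis using pot_diff_split[OF assms] by linarith
qed

text \<open>Each increment is a spread-out part of relative size \<alpha>/n plus the part
  \<open>b\<close> or \<open>b'\<close> of the chosen bin, so every product with a spread-out factor
  is small enough. For \<open>b * b'\<close>: if the bin is overloaded, \<open>b'\<close> is 0;
  otherwise \<open>b\<close> is at most (\<alpha> w)^2, because the bin starts in the flat part of
  \<open>hinge\<close>. The bound holds for each \<open>j\<close>, however likely.\<close>

lemma pot_cross_bound:
  assumes a: "0 \<le> \<alpha>" "\<alpha> * w \<le> 1" and j: "j \<in> {1..n}"
  shows "(pot \<alpha> 1 n (nx j) - pot \<alpha> 1 n x) * (pot \<alpha> (-1) n (nx j) - pot \<alpha> (-1) n x)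
     \<le> 52 * w\<^sup>2 * \<alpha>\<^sup>2 * pot \<alpha> 1 n x * pot \<alpha> (-1) n x / real n"
proof -
  let ?X = "pot \<alpha> 1 n x" and ?Y = "pot \<alpha> (-1) n x"
  define b where "b = hinge \<alpha> (y j + \<xi> j j) - hinge \<alpha> (y j)"
  define b' where "b' = hinge \<alpha> (- (y j + \<xi> j j)) - hinge \<alpha> (- y j)"
  define a1 where "a1 = pot \<alpha> 1 n (nx j) - ?X - b"
  define a2 where "a2 = pot \<alpha> (-1) n (nx j) - ?Y - b'"
  define q where "q = \<alpha> * w"
  have n1: "1 \<le> real n" using n_pos by simp
  have q: "0 \<le> q" "q \<le> 1" using a w_ge by (auto simp: q_def)
  have XY: "real n \<le> ?X" "real n \<le> ?Y" by (rule pot_ge)+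
  have 1: "\<bar>a1\<bar> \<le> 4 * q * ?X / real n" "\<bar>b\<bar> \<le> 4 * q * ?X"
    using pot_diff_split[OF a _ j, of 1] by (simp_all add: a1_def b_def q_def mult_ac)
  have 2: "\<bar>a2\<bar> \<le> 4 * q * ?Y / real n" "\<bar>b'\<bar> \<le> 4 * q * ?Y"
    using pot_diff_split[OF a _ j, of "-1"] by (simp_all add: a2_def b'_def q_def mult_ac)
  have \<xi>0: "0 \<le> \<xi> j j"
    using wt_bounds[of j] n1 by (simp add: \<xi>_def field_simps)
  have bb: "b * b' \<le> 4 * q\<^sup>2 * ?Y"
  proof (cases "0 \<le> y j")
    case True
    hence "b' = 0" using \<xi>0 by (simp add: b'_def hinge_nonpos_arg)
    thus ?thesis using XY n1 by simp
  next
    case False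
    have ax: "\<alpha> * \<bar>\<xi> j j\<bar> \<le> 1" using mult_left_mono[OF \<xi>_abs a(1), of j j] a(2) by simp
    have "b \<le> \<alpha>\<^sup>2 * (\<xi> j j)\<^sup>2" using hinge_tangent_upper[OF a(1) ax, of "y j"] False
      by (simp add: b_def hexp_nonpos_arg)
    also have "\<dots> = (\<alpha> * \<bar>\<xi> j j\<bar>)\<^sup>2" by (simp add: power_mult_distrib)
    also have "\<dots> \<le> q\<^sup>2" unfolding q_def using a \<xi>_abs by (intro power_mono mult_left_mono) auto
    finally have "b \<le> q\<^sup>2" .
    moreover have "0 \<le> b" using False by (simp add: b_def hinge_nonpos_arg hinge_nonneg)
    ultimately have "\<bar>b\<bar> * \<bar>b'\<bar> \<le> q\<^sup>2 * (4 * q * ?Y)" using 2 by (intro mult_mono) auto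
    also have "\<dots> \<le> q\<^sup>2 * (4 * 1 * ?Y)" using q XY n1 by (intro mult_left_mono mult_right_mono) auto
    finally show ?thesis using abs_ge_self[of "b * b'"] by (simp add: abs_mult mult_ac)
  qed
  \<comment> \<open>\<open>?X\<close> is at least n, so a bound by \<open>?Y\<close> alone is good
    enough.\<close>
  have "?Y \<le> ?X * ?Y / real n" using XY n1 by (simp add: field_simps mult_right_mono)
  hence "4 * q\<^sup>2 * ?Y \<le> 4 * q\<^sup>2 * (?X * ?Y / real n)" by (intro mult_left_mono) auto
  hence bb: "b * b' \<le> 4 * q\<^sup>2 * ?X * ?Y / real n" using bb by (simp add: mult_ac)
  have cross: "u * v \<le> 16 * q\<^sup>2 * ?X * ?Y / real n"
    if "\<bar>u\<bar> * \<bar>v\<bar> \<le> (4 * q * ?X / real n) * (4 * q * ?Y)" for u v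
    using that abs_ge_self[of "u * v"] by (simp add: abs_mult power2_eq_square mult_ac)
  have le: "4 * q * ?Y / real n \<le> 4 * q * ?Y"
    by (rule divide_n_le) (use q n1 XY in auto)
  have "\<bar>a1\<bar> * \<bar>a2\<bar> \<le> (4 * q * ?X / real n) * (4 * q * ?Y)"
    using 1 2 le q n1 XY by (intro mult_mono) auto
  note c1 = cross[OF this]
  have "\<bar>a1\<bar> * \<bar>b'\<bar> \<le> (4 * q * ?X / real n) * (4 * q * ?Y)"
    using 1 2 le q n1 XY by (intro mult_mono) auto
  note c2 = cross[OF this]
  have "\<bar>b\<bar> * \<bar>a2\<bar> \<le> (4 * q * ?X) * (4 * q * ?Y / real n)"
    using 1 2 le q n1 XY by (intro mult_mono) auto
  hence "\<bar>b\<bar> * \<bar>a2\<bar> \<le> (4 * q * ?X / real n) * (4 * q * ?Y)" by simp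
  note c3 = cross[OF this]
  have "(pot \<alpha> 1 n (nx j) - ?X) * (pot \<alpha> (-1) n (nx j) - ?Y) = (a1 + b) * (a2 + b')"
    by (simp add: a1_def a2_def)
  also have "\<dots> = a1 * a2 + a1 * b' + b * a2 + b * b'" by (simp add: algebra_simps)
  \<comment> \<open>52 = 16 + 16 + 16 + 4.\<close>
  also have "\<dots> \<le> 52 * q\<^sup>2 * ?X * ?Y / real n" using c1 c2 c3 bb by simp
  finally show ?thesis by (simp add: q_def power_mult_distrib mult_ac)
qed

section \<open>The total overload D equals the total underload\<close>

lemma sum_y: "(\<Sum>i\<in>{1..n}. y i) = 0"
  using n_pos by (simp add: y_def dev_def sum_subtractf avg_def)

lemma D_under: "(\<Sum>i\<in>{1..n}. max (- y i) 0) = D"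
proof -
  have "D - (\<Sum>i\<in>{1..n}. max (- y i) 0) = (\<Sum>i\<in>{1..n}. y i)"
    unfolding D_def sum_subtractf[symmetric] by (intro sum.cong) (auto simp: max_def)
  thus ?thesis using sum_y by simp
qed

lemma D_over_sum: "(\<Sum>i\<in>heavy. y i) = D"
proof -
  have "(\<Sum>i\<in>heavy. max (y i) 0) = (\<Sum>i\<in>heavy. y i)" "(\<Sum>i\<in>light. max (y i) 0) = 0"
    by (auto simp: heavy_def light_def y_def intro: sum.cong sum.neutral)
  thus ?thesis unfolding D_def sum_split by simp
qed

lemma D_under_sum: "(\<Sum>i\<in>light. - y i) = D"
proof -
  have "(\<Sum>i\<in>light. max (- y i) 0) = (\<Sum>i\<in>light. - y i)" "(\<Sum>i\<in>heavy. max (- y i) 0) = 0"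
    by (auto simp: heavy_def light_def y_def simp del: sum_negf intro: sum.cong sum.neutral)
  thus ?thesis unfolding D_under[symmetric] sum_split by simp
qed

lemma pot_S: "s = 1 \<or> s = -1 \<Longrightarrow> pot \<alpha> s n x = real n + S \<alpha> s - \<alpha> * D"
  using D_under
  by (auto simp: pot_def S_def hinge_hexp sum_subtractf y_def D_def simp flip: sum_distrib_left)

text \<open>As D is also the total underload, a large D forces both unsmoothed potentials up at the
  same time. This drives the case D > L n.\<close>

lemma S_ge: "s = 1 \<or> s = -1 \<Longrightarrow> \<alpha> * D \<le> S \<alpha> s"
  using pot_S[of s \<alpha>] pot_ge[of n \<alpha> s x] by simp

end

section \<open>Tilting functionals for the balanced phase\<close>

text \<open>
  Underloaded bins may be chosen with probability of order one, and lifting them above the mean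
  increases the first summand. Each such allocation decreases the number of underloaded bins, which the
  second summand rewards as long as that number is below \<open>\<epsilon> n\<close>. Bins turn from overloaded to underloaded
  only when \<open>\<lceil>W/n\<rceil>\<close> jumps, and then the third summand falls by enough to pay for the growth of the second one.
\<close>

definition over_slack :: "real \<Rightarrow> real \<Rightarrow> nat \<Rightarrow> nat \<Rightarrow> (nat \<Rightarrow> nat) \<Rightarrow> real" where
  "over_slack lam \<epsilon> wm n x =
     - (\<Sum>i\<in>{1..n}. exp (- lam * max (dev n x i + real wm / real n) 0)) / real n
     + min (real (card {i\<in>{1..n}. dev n x i < 0}) / real n) \<epsilon>
     + \<epsilon> * (avg n x - of_int \<lceil>avg n x\<rceil>)"

text \<open>For n >= 2 wm an underloaded bin jumps by at least 1/2 when chosen, so its term grows by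
  the factor exp(\<mu>/2). The cap at 1 keeps the functional bounded but leaves room for this jump
  from just below 0. A higher normalized load never raises \<open>under_slack\<close>, so a large
  probability of an underloaded bin is favourable here.\<close>

definition under_slack :: "real \<Rightarrow> nat \<Rightarrow> (nat \<Rightarrow> nat) \<Rightarrow> real" where
  "under_slack \<mu> n x = - (\<Sum>i\<in>{1..n}. exp (\<mu> * min (dev n x i) 1)) / real n"

section \<open>Boundedness and Lipschitz estimates for the slacks\<close>

lemma exp_diff_bound:
  fixes a b M :: real
  assumes "a \<le> M" "b \<le> M"
  shows "\<bar>exp a - exp b\<bar> \<le> exp M * \<bar>a - b\<bar>"
proof -
  have *: "\<bar>exp a - exp b\<bar> \<le> exp M * \<bar>a - b\<bar>" if "a \<le> b" "b \<le> M" for a b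
  proof -
    have "exp b * (1 + (a - b)) \<le> exp b * exp (a - b)" by (intro mult_left_mono exp_ge_add_one_self) simp
    hence "exp b - exp a \<le> exp b * (b - a)" by (simp add: algebra_simps flip: exp_add)
    also have "\<dots> \<le> exp M * (b - a)" using that by (intro mult_right_mono) auto
    finally show ?thesis using that by simp
  qed
  show ?thesis
    using *[of a b] *[of b a] assms by (cases "a \<le> b") (auto simp: abs_minus_commute)
qed

lemma sum_mean_abs:
  fixes f :: "nat \<Rightarrow> real"
  assumes "j \<in> {1..n}" "\<And>i. i \<in> {1..n} \<Longrightarrow> i \<noteq> j \<Longrightarrow> \<bar>f i\<bar> \<le> r / real n" "\<bar>f j\<bar> \<le> r'" "0 \<le> r"
  shows "\<bar>\<Sum>i\<in>{1..n}. f i\<bar> \<le> r + r'"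
proof -
  have n0: "0 < real n" using assms(1) by simp
  have "\<bar>\<Sum>i\<in>{1..n}. f i\<bar> \<le> (\<Sum>i\<in>{1..n}. \<bar>f i\<bar>)" by (rule sum_abs)
  also have "\<dots> \<le> (\<Sum>i\<in>{1..n}. r / real n + (if i = j then r' else 0))"
    using assms n0 by (intro sum_mono) (auto simp: add_increasing)
  also have "\<dots> = r + r'" using assms(1) n0 by (simp add: sum.distrib)
  finally show ?thesis .
qed

lemma abs_over_slack_le:
  assumes "1 \<le> n" "0 \<le> lam" "0 \<le> \<epsilon>" "\<epsilon> \<le> 1"
  shows "\<bar>over_slack lam \<epsilon> wm n x\<bar> \<le> 2"
proof -
  let ?h = "\<lambda>i. exp (- lam * max (dev n x i + real wm / real n) 0)"
  have n0: "0 < real n" using assms by simp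
  have "(\<Sum>i\<in>{1..n}. ?h i) \<le> (\<Sum>i\<in>{1..n}. 1)" using assms by (intro sum_mono) auto
  hence "(\<Sum>i\<in>{1..n}. ?h i) / real n \<le> 1" using n0 by simp
  moreover have "0 \<le> (\<Sum>i\<in>{1..n}. ?h i) / real n" by (intro divide_nonneg_nonneg sum_nonneg) auto
  moreover have "0 \<le> min (real (card {i\<in>{1..n}. dev n x i < 0}) / real n) \<epsilon>"
    "min (real (card {i\<in>{1..n}. dev n x i < 0}) / real n) \<epsilon> \<le> 1" using assms by auto
  moreover have "\<bar>\<epsilon> * (avg n x - of_int \<lceil>avg n x\<rceil>)\<bar> \<le> 1 * 1"
    unfolding abs_mult using assms ceiling_correct[of "avg n x"] by (intro mult_mono) auto
  ultimately show ?thesis unfolding over_slack_def by linarith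
qed

lemma abs_under_slack_le:
  assumes "1 \<le> n" "0 \<le> \<mu>"
  shows "\<bar>under_slack \<mu> n x\<bar> \<le> exp \<mu>"
proof -
  let ?h = "\<lambda>i. exp (\<mu> * min (dev n x i) 1)"
  have n0: "0 < real n" using assms by simp
  have "?h i \<le> exp \<mu>" for i using assms mult_left_mono[of "min (dev n x i) 1" 1 \<mu>] by simp
  hence "(\<Sum>i\<in>{1..n}. ?h i) \<le> (\<Sum>i\<in>{1..n}. exp \<mu>)" by (intro sum_mono)
  hence "(\<Sum>i\<in>{1..n}. ?h i) / real n \<le> exp \<mu>" using n0 by (simp add: field_simps)
  moreover have "0 \<le> (\<Sum>i\<in>{1..n}. ?h i) / real n" by (intro divide_nonneg_nonneg sum_nonneg) auto
  ultimately show ?thesis unfolding under_slack_def by simp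
qed

text \<open>The left side is nonpositive beyond 4 L and at most its leading factor before. Being
  affine in z, it can be summed over bins knowing only the total of z: a Markov inequality that
  counts the bins within 4 L of the mean.\<close>

lemma exp_neg_ge_affine:
  fixes lam L z r :: real
  assumes "0 \<le> lam" "0 < L" "0 \<le> z" "r \<le> 1"
  shows "exp (- lam * (4 * L + 1)) * (1 - z / (4 * L)) \<le> exp (- lam * (z + r))"
proof (cases "z \<le> 4 * L")
  case True
  have "exp (- lam * (4 * L + 1)) * (1 - z / (4 * L)) \<le> exp (- lam * (4 * L + 1)) * 1"
    using assms by (intro mult_left_mono) auto
  also have "\<dots> \<le> exp (- lam * (z + r))"
    using mult_left_mono[of "z + r" "4 * L + 1" lam] True assms by simp
  finally show ?thesis .
next
  case False
  hence "exp (- lam * (4 * L + 1)) * (1 - z / (4 * L)) \<le> 0"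
    using assms by (intro mult_nonneg_nonpos) auto
  thus ?thesis using exp_ge_zero order_trans by blast
qed

context alloc_step
begin

section \<open>Drift of the two slacks in one step\<close>

lemma avg_nx: "j \<in> {1..n} \<Longrightarrow> avg n (nx j) = avg n x + wt j / real n"
proof -
  assume j: "j \<in> {1..n}"
  have "dev n (nx j) j = y j + \<xi> j j" by (rule dev_nx[OF j])
  thus ?thesis by (simp add: dev_def y_def \<xi>_def nx_def allocate_def wt_def)
qed

text \<open>Loads are integers, so the set of underloaded bins sees the average only through its
  ceiling. This is where the ceiling in \<open>over_slack\<close> comes from.\<close>

lemma dev_neg_iff: "dev n z i < 0 \<longleftrightarrow> int (z i) < \<lceil>avg n z\<rceil>"
  by (simp add: dev_def less_ceiling_iff)

definition "H lam i = exp (- lam * max (y i + w / real n) 0)"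

lemma over_slack_step:
  assumes j: "j \<in> {1..n}" and \<epsilon>: "0 \<le> \<epsilon>"
  shows "over_slack lam \<epsilon> wm n (nx j) \<le> over_slack lam \<epsilon> wm n x
     + (- (\<Sum>i\<in>{1..n}. exp (- lam * max (y i + \<xi> i j + w / real n) 0) - H lam i)
        - (if j \<in> light \<and> 0 \<le> y j + w \<and> real (card light) \<le> \<epsilon> * real n then 1 else 0)
        + \<epsilon> * w) / real n"
proof -
  let ?q = "(if j \<in> light \<and> 0 \<le> y j + w \<and> real (card light) \<le> \<epsilon> * real n then 1 else 0) :: real"
  let ?u = "real (card light) / real n"
  define B where "B = {i\<in>{1..n}. dev n (nx j) i < 0}"
  define a where "a = avg n x"
  define a' where "a' = avg n (nx j)"
  have n0: "0 < real n" using n_pos by simp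
  have aa: "a' = a + wt j / real n" using avg_nx[OF j] by (simp add: a_def a'_def)
  have le: "a \<le> a'" using wt_bounds[of j] by (simp add: aa)
  have aw: "a' \<le> a + w / real n" using wt_bounds[of j] n0 by (simp add: aa divide_right_mono)
  have fin: "finite light" by (simp add: light_def)
  have main: "min (real (card B) / real n) \<epsilon> - \<epsilon> * of_int \<lceil>a'\<rceil>
      \<le> min ?u \<epsilon> - \<epsilon> * of_int \<lceil>a\<rceil> - ?q / real n"
  proof (cases "\<lceil>a'\<rceil> = \<lceil>a\<rceil>")
    case True
    \<comment> \<open>Loads never decrease and the integer threshold is unchanged, so no bin can
      become underloaded.\<close>
    have sub: "B \<subseteq> light"
    proof
      fix i assume "i \<in> B"
      hence "i \<in> {1..n}" "int (nx j i) < \<lceil>a\<rceil>" by (auto simp: B_def dev_neg_iff a'_def[symmetric] True)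
      moreover have "x i \<le> nx j i" by (simp add: nx_def allocate_def)
      ultimately show "i \<in> light" by (auto simp: light_def dev_neg_iff a_def)
    qed
    show ?thesis
    proof (cases "?q = 1")
      case q: True
      hence jl: "j \<in> light" "0 \<le> y j + w" "real (card light) \<le> \<epsilon> * real n" by (auto split: if_splits)
      have "real (x j) + w \<ge> a" using jl by (simp add: y_def dev_def a_def)
      hence "int (x j) + int wm \<ge> \<lceil>a\<rceil>" by (simp add: ceiling_le_iff w_def)
      hence "\<not> int (nx j j) < \<lceil>a'\<rceil>"
        using jl True by (simp add: nx_def allocate_def weight_def light_def)
      hence "j \<notin> B" by (simp add: B_def dev_neg_iff a'_def)
      hence "B \<subseteq> light - {j}" using sub by blast
      hence "card B \<le> card light - 1" using fin jl by (metis card_Diff_singleton card_mono finite_Diff)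
      moreover have "1 \<le> card light" using jl fin by (metis One_nat_def Suc_leI card_gt_0_iff empty_iff)
      ultimately have "real (card B) \<le> real (card light) - 1" by linarith
      hence "real (card B) / real n \<le> ?u - 1 / real n"
        using n0 by (simp add: field_simps)
      moreover have "min ?u \<epsilon> = ?u" using jl n0 by (simp add: field_simps)
      ultimately show ?thesis using q True by simp
    next
      case False
      hence q: "?q = 0" by (auto split: if_splits)
      have "real (card B) / real n \<le> ?u"
        using card_mono[OF fin sub] n0 by (simp add: divide_right_mono)
      thus ?thesis using True q by auto
    qed
  next
    case False
    \<comment> \<open>The threshold moves. The new second summand is at most \<epsilon>, which the
      ceiling term pays, and \<open>?q\<close>/n is at most the old second summand, which is given
      up.\<close>
    hence "\<lceil>a\<rceil> + 1 \<le> \<lceil>a'\<rceil>" using le ceiling_mono[OF le] by linarith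
    hence "of_int \<lceil>a\<rceil> + 1 \<le> (of_int \<lceil>a'\<rceil> :: real)" by linarith
    hence "\<epsilon> * (of_int \<lceil>a\<rceil> + 1) \<le> \<epsilon> * of_int \<lceil>a'\<rceil>" using \<epsilon> by (intro mult_left_mono) auto
    moreover have "?q / real n \<le> min ?u \<epsilon>"
    proof (cases "?q = 1")
      case True
      hence jl: "j \<in> light" "real (card light) \<le> \<epsilon> * real n" by (auto split: if_splits)
      have "1 \<le> card light" using jl fin by (metis One_nat_def Suc_leI card_gt_0_iff empty_iff)
      hence "1 \<le> real (card light)" by simp
      moreover have "?u \<le> \<epsilon>" using jl n0 by (simp add: field_simps)
      ultimately show ?thesis using True n0 by (simp add: divide_right_mono)
    qed (use \<epsilon> in \<open>auto split: if_splits\<close>)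
    moreover have "min (real (card B) / real n) \<epsilon> \<le> \<epsilon>" by simp
    ultimately show ?thesis unfolding distrib_left mult_1_right by linarith
  qed
  have "\<epsilon> * a' \<le> \<epsilon> * a + \<epsilon> * w / real n"
    using mult_left_mono[OF aw \<epsilon>] by (simp add: algebra_simps)
  moreover have "over_slack lam \<epsilon> wm n (nx j)
      = - (\<Sum>i\<in>{1..n}. exp (- lam * max (y i + \<xi> i j + w / real n) 0)) / real n
        + min (real (card B) / real n) \<epsilon> + \<epsilon> * a' - \<epsilon> * of_int \<lceil>a'\<rceil>"
    by (simp add: over_slack_def B_def a'_def w_def algebra_simps dev_nx[OF j])
  moreover have "over_slack lam \<epsilon> wm n x
      = - (\<Sum>i\<in>{1..n}. H lam i) / real n + min ?u \<epsilon> + \<epsilon> * a - \<epsilon> * of_int \<lceil>a\<rceil>"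
    by (simp add: over_slack_def light_def a_def w_def algebra_simps H_def y_def)
  ultimately show ?thesis
    using main by (simp add: sum_subtractf add_divide_distrib diff_divide_distrib)
qed

text \<open>The growth of the average multiplies the term \<open>H\<close> of an overloaded bin by
  at least 1 + \<open>lam\<close>/n, while being chosen, with probability at most k1/n, costs at
  most this enlarged term. The choice of \<open>lam\<close> leaves a net gain of \<open>H\<close>/n.
  A majorant \<open>U\<close> of the increment is returned because the increments of the correction
  terms are controlled from above only.\<close>

lemma over_slack_drift:
  assumes \<epsilon>: "0 < \<epsilon>" "\<epsilon> \<le> 1" and lam: "lam = 2 * real k1 + 2"
    and n: "2 * k1 \<le> n" "wm \<le> n" "lam \<le> \<epsilon> * real n"
  obtains U where
    "\<And>j. j \<in> {1..n} \<Longrightarrow> over_slack lam \<epsilon> wm n (nx j) \<le> over_slack lam \<epsilon> wm n x + U j"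
    "\<And>j. j \<in> {1..n} \<Longrightarrow> \<bar>U j\<bar> \<le> (lam * w + 2 + w) / real n"
    "real n * (\<Sum>j\<in>{1..n}. p j * U j)
       \<le> - (\<Sum>i\<in>heavy. H lam i) / real n + (1 - \<delta>) / \<epsilon> + 2 * \<epsilon> * w"
proof
  define h where "h z = exp (- lam * max (z + w / real n) 0)" for z
  \<comment> \<open>\<open>cr\<close> marks the choice of an underloaded bin that may cross the
    mean, where \<open>h\<close> can drop by as much as 1. \<open>q\<close> marks those crossings
    that are repaid by the falling number of underloaded bins.\<close>
  define cr where "cr j = (if j \<in> light \<and> 0 \<le> y j + w then 1 else 0 :: real)" for j
  define q where "q j = (if j \<in> light \<and> 0 \<le> y j + w \<and> real (card light) \<le> \<epsilon> * real n
      then 1 else 0 :: real)" for j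
  define \<Delta> where "\<Delta> i j = h (y i + \<xi> i j) - H lam i" for i j
  define U where "U j = (- (\<Sum>i\<in>{1..n}. \<Delta> i j) - q j + \<epsilon> * w) / real n" for j
  have n0: "0 < real n" using n_pos by simp
  have lam0: "0 \<le> lam" by (simp add: lam)
  have Hh: "H lam i = h (y i)" for i by (simp add: H_def h_def)
  have h1: "h z \<le> 1" "0 \<le> h z" for z using lam0 by (auto simp: h_def)
  have lip: "\<bar>h a - h b\<bar> \<le> lam * \<bar>a - b\<bar>" for a b
  proof -
    have "\<bar>h a - h b\<bar> \<le> exp 0 * \<bar>- lam * max (a + w / real n) 0 - (- lam * max (b + w / real n) 0)\<bar>"
      unfolding h_def using lam0 by (intro exp_diff_bound) auto
    also have "\<dots> = lam * \<bar>max (a + w / real n) 0 - max (b + w / real n) 0\<bar>"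
      using lam0 by (simp add: abs_mult abs_minus_commute flip: right_diff_distrib)
    also have "\<dots> \<le> lam * \<bar>a - b\<bar>" using lam0 by (intro mult_left_mono) auto
    finally show ?thesis .
  qed
  have anti: "h b \<le> h a" if "a \<le> b" for a b
    using that lam0 by (auto simp: h_def intro!: mult_left_mono)
  show "over_slack lam \<epsilon> wm n (nx j) \<le> over_slack lam \<epsilon> wm n x + U j" if "j \<in> {1..n}" for j
    using over_slack_step[OF that, of \<epsilon> lam] \<epsilon> by (simp add: U_def q_def \<Delta>_def h_def)
  show "\<bar>U j\<bar> \<le> (lam * w + 2 + w) / real n" if j: "j \<in> {1..n}" for j
  proof -
    have "\<bar>\<Sum>i\<in>{1..n}. \<Delta> i j\<bar> \<le> lam * w + 1"
    proof (rule sum_mean_abs[OF j])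
      fix i assume "i \<noteq> j"
      thus "\<bar>\<Delta> i j\<bar> \<le> lam * w / real n"
        using lip[of "y i + \<xi> i j" "y i"] mult_left_mono[OF \<xi>_neq lam0, of i j]
        by (simp add: \<Delta>_def Hh)
    next
      show "\<bar>\<Delta> j j\<bar> \<le> 1" using h1[of "y j"] h1[of "y j + \<xi> j j"] by (simp add: \<Delta>_def Hh)
    qed (use lam0 w_ge in auto)
    moreover have "0 \<le> q j" "q j \<le> 1" by (auto simp: q_def)
    moreover have "0 \<le> \<epsilon> * w" "\<epsilon> * w \<le> w" using \<epsilon> w_ge by (auto simp: mult_le_cancel_right1)
    ultimately have "\<bar>- (\<Sum>i\<in>{1..n}. \<Delta> i j) - q j + \<epsilon> * w\<bar> \<le> lam * w + 2 + w" by linarith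
    thus ?thesis using n0 by (simp add: U_def abs_divide divide_right_mono)
  qed
  have elem: "(if i \<in> heavy then lam / real n * H lam i else 0)
      - (if i = j then (if j \<in> heavy then (1 + lam / real n) * H lam j else 0) + cr j + lam * w / real n else 0)
      \<le> \<Delta> i j" if i: "i \<in> {1..n}" and j: "j \<in> {1..n}" for i j
  proof (cases "i = j")
    case False
    define d where "d = wt j / real n"
    have d: "1 / real n \<le> d" "d \<le> w / real n"
      using wt_bounds[of j] n0 by (auto simp: d_def divide_right_mono)
    have xi: "\<xi> i j = - d" using False by (simp add: \<xi>_def d_def)
    show ?thesis
    proof (cases "i \<in> heavy")
      case True
      hence y0: "0 \<le> y i" by (simp add: heavy_def y_def)
      have d0: "0 \<le> d" using d(1) n0 by (auto intro: order_trans[rotated])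
      \<comment> \<open>The shift by w/n in \<open>h\<close> keeps an overloaded bin out of the
        cut-off even after the average has moved, so the factor is exact.\<close>
      have "h (y i - d) = exp (lam * d) * H lam i"
      proof -
        have "max (y i - d + w / real n) 0 = y i - d + w / real n" "max (y i + w / real n) 0 = y i + w / real n"
          using y0 d d0 by linarith+
        thus ?thesis by (simp add: h_def H_def algebra_simps flip: exp_add)
      qed
      moreover have "1 + lam / real n \<le> exp (lam * d)"
        using mult_left_mono[OF d(1) lam0] exp_ge_add_one_self[of "lam * d"] by (simp only: times_divide_eq_right mult_1_right)
      ultimately have "(1 + lam / real n) * H lam i \<le> h (y i - d)"
        by (simp add: mult_right_mono H_def)
      thus ?thesis using True False by (simp add: \<Delta>_def xi algebra_simps)
    next
      case F: False
      have "0 \<le> d" using d(1) n0 by (auto intro: order_trans[rotated])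
      hence "h (y i) \<le> h (y i - d)" by (intro anti) simp
      thus ?thesis using False F by (simp add: \<Delta>_def xi Hh)
    qed
  next
    case True
    have lw: "0 \<le> lam * w / real n" using lam0 w_ge by simp
    show ?thesis
    proof (cases "j \<in> heavy")
      case jh: True
      have "cr j = 0" using jh by (auto simp: cr_def heavy_def light_def)
      thus ?thesis using True jh h1(2)[of "y j + \<xi> j j"] lw by (simp add: \<Delta>_def algebra_simps)
    next
      case F: False
      hence jl: "j \<in> light" using j heavy_light(1) by blast
      have "- cr j - lam * w / real n \<le> \<Delta> j j"
      proof (cases "0 \<le> y j + w")
        case c: True
        thus ?thesis using jl lw h1(1)[of "y j"] h1(2)[of "y j + \<xi> j j"] by (simp add: cr_def \<Delta>_def Hh)
      next
        case c: False
        \<comment> \<open>Without a crossing the bin stays where \<open>h\<close> is at least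
          \<open>h 0\<close>, which differs from the maximum 1 only through the shift by
          w/n.\<close>
        have "y j + \<xi> j j \<le> 0" using c \<xi>_abs[of j j] by linarith
        hence "h 0 \<le> h (y j + \<xi> j j)" by (rule anti)
        moreover have "1 - lam * w / real n \<le> h 0"
          using w_ge exp_ge_add_one_self[of "- (lam * w / real n)"] by (simp add: h_def)
        ultimately show ?thesis using h1(1)[of "y j"] by (auto simp: \<Delta>_def Hh cr_def)
      qed
      thus ?thesis using True F by simp
    qed
  qed
  let ?HS = "\<Sum>i\<in>heavy. H lam i"
  have col: "lam / real n * ?HS - (if j \<in> heavy then (1 + lam / real n) * H lam j else 0) - cr j
      - lam * w / real n \<le> (\<Sum>i\<in>{1..n}. \<Delta> i j)" if j: "j \<in> {1..n}" for j
  proof -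
    have "heavy \<subseteq> {1..n}" by (auto simp: heavy_def)
    hence "(\<Sum>i\<in>{1..n}. if i \<in> heavy then lam / real n * H lam i else 0) = lam / real n * ?HS"
      by (simp add: sum.If_cases Int_absorb1 sum_distrib_left)
    moreover have "(\<Sum>i\<in>{1..n}. (if i \<in> heavy then lam / real n * H lam i else 0)
      - (if i = j then (if j \<in> heavy then (1 + lam / real n) * H lam j else 0) + cr j + lam * w / real n else 0))
      \<le> (\<Sum>i\<in>{1..n}. \<Delta> i j)" by (intro sum_mono elem j)
    ultimately show ?thesis using j by (simp add: sum_subtractf)
  qed
  \<comment> \<open>A crossing that is not repaid happens only if more than \<epsilon> n bins are
    underloaded, that is, if 1 - \<delta> > \<epsilon>.\<close>
  have q_cr: "cr j - q j \<le> (1 - \<delta>) / \<epsilon>" for j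
  proof (cases "cr j - q j = 0")
    case True
    thus ?thesis using \<delta>_bounds \<epsilon> by simp
  next
    case False
    hence "\<epsilon> * real n < real (card light)" "cr j - q j = 1" by (auto simp: cr_def q_def split: if_splits)
    thus ?thesis using \<epsilon> n0 by (simp add: card_light)
  qed
  let ?P = "\<Sum>j\<in>heavy. p j * ((1 + lam / real n) * H lam j)"
  have "real n * (\<Sum>j\<in>{1..n}. p j * U j) = (\<Sum>j\<in>{1..n}. p j * (- (\<Sum>i\<in>{1..n}. \<Delta> i j) - q j + \<epsilon> * w))"
    using n0 by (simp add: U_def sum_distrib_left)
  also have "\<dots> \<le> (\<Sum>j\<in>{1..n}. p j * ((- (lam / real n * ?HS) + (1 - \<delta>) / \<epsilon> + lam * w / real n + \<epsilon> * w)
      + (if j \<in> heavy then (1 + lam / real n) * H lam j else 0)))"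
  proof (intro sum_mono mult_left_mono p_nonneg)
    fix j assume j: "j \<in> {1..n}"
    show "- (\<Sum>i\<in>{1..n}. \<Delta> i j) - q j + \<epsilon> * w
       \<le> (- (lam / real n * ?HS) + (1 - \<delta>) / \<epsilon> + lam * w / real n + \<epsilon> * w)
      + (if j \<in> heavy then (1 + lam / real n) * H lam j else 0)"
      using col[OF j] q_cr[of j] by linarith
  qed
  also have "\<dots> = (- (lam / real n * ?HS) + (1 - \<delta>) / \<epsilon> + lam * w / real n + \<epsilon> * w)
      + (\<Sum>j\<in>{1..n}. if j \<in> heavy then p j * ((1 + lam / real n) * H lam j) else 0)"
    unfolding distrib_left sum.distrib sum_distrib_right[symmetric] p_sum
    by (auto intro!: sum.cong)
  also have "(\<Sum>j\<in>{1..n}. if j \<in> heavy then p j * ((1 + lam / real n) * H lam j) else 0) = ?P"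
    by (subst sum_split) (use heavy_light(2) in \<open>auto intro!: sum.neutral\<close>)
  also have "?P \<le> (\<Sum>j\<in>heavy. (lam - 1) / real n * H lam j)"
  proof (rule sum_mono)
    fix j assume j: "j \<in> heavy"
    \<comment> \<open>For n >= 2 k1: k1 (1 + \<open>lam\<close>/n) <= k1 + \<open>lam\<close>/2 = 2
      k1 + 1 = \<open>lam\<close> - 1.\<close>
    have "real k1 * lam / real n \<le> lam / 2"
      using mult_right_mono[of "2 * real k1" "real n" lam] n lam0 n0 by (simp add: field_simps)
    hence "real k1 * (1 + lam / real n) \<le> lam - 1" using lam unfolding distrib_left times_divide_eq_right by linarith
    hence "real k1 / real n * (1 + lam / real n) \<le> (lam - 1) / real n"
      using divide_right_mono[of _ _ "real n"] by fastforce
    moreover have "p j \<le> real k1 / real n" using p_over j by (auto simp: heavy_def)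
    hence "p j * (1 + lam / real n) \<le> real k1 / real n * (1 + lam / real n)"
      using lam0 by (intro mult_right_mono) auto
    ultimately have "p j * (1 + lam / real n) \<le> (lam - 1) / real n" by linarith
    hence "p j * (1 + lam / real n) * H lam j \<le> (lam - 1) / real n * H lam j"
      by (intro mult_right_mono) (auto simp: H_def)
    thus "p j * ((1 + lam / real n) * H lam j) \<le> (lam - 1) / real n * H lam j" by simp
  qed
  also have "\<dots> = (lam - 1) / real n * ?HS" by (simp add: sum_distrib_left)
  also have "(- (lam / real n * ?HS) + (1 - \<delta>) / \<epsilon> + lam * w / real n + \<epsilon> * w) + (lam - 1) / real n * ?HS
     = - ?HS / real n + (1 - \<delta>) / \<epsilon> + \<epsilon> * w + lam * w / real n"
    by (simp add: diff_divide_distrib algebra_simps)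
  also have "lam * w / real n \<le> \<epsilon> * w"
    using mult_right_mono[OF n(3), of w] w_ge n0 by (simp add: field_simps)
  finally show "real n * (\<Sum>j\<in>{1..n}. p j * U j) \<le> - ?HS / real n + (1 - \<delta>) / \<epsilon> + 2 * \<epsilon> * w"
    by simp
qed

lemma H_heavy_sum:
  assumes "0 \<le> lam" "0 < L" "wm \<le> n" "D \<le> L * real n"
  shows "exp (- lam * (4 * L + 1)) * (\<delta> - 1 / 4) \<le> (\<Sum>i\<in>heavy. H lam i) / real n"
proof -
  let ?k = "exp (- lam * (4 * L + 1))"
  have n0: "0 < real n" using n_pos by simp
  have wn: "w / real n \<le> 1" "0 \<le> w / real n" using assms(3) n0 by (simp_all add: w_def)
  have "D / (4 * L) \<le> real n / 4" using assms(2,4) by (simp add: field_simps)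
  hence "?k * (\<delta> * real n - real n / 4) \<le> ?k * (\<delta> * real n - D / (4 * L))"
    by (intro mult_left_mono) auto
  also have "\<dots> = (\<Sum>i\<in>heavy. ?k * (1 - y i / (4 * L)))"
    by (simp add: D_over_sum card_heavy sum_subtractf flip: sum_distrib_left sum_divide_distrib)
  also have "\<dots> \<le> (\<Sum>i\<in>heavy. H lam i)"
  proof (rule sum_mono)
    fix i assume "i \<in> heavy"
    hence "0 \<le> y i" by (simp add: heavy_def y_def)
    thus "?k * (1 - y i / (4 * L)) \<le> H lam i"
      using exp_neg_ge_affine[of lam L "y i" "w / real n"] assms wn by (simp add: H_def)
  qed
  finally show ?thesis using n0 by (simp add: field_simps)
qed

text \<open>The value of \<epsilon> makes the cost 2 \<epsilon> w of the moving average equal to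
  \<kappa>/4. If D <= L n, another \<kappa>/4 is lost to the bins farther than 4 L from the mean, so
  \<kappa>/2 remains at \<delta> = 1, up to a deficit linear in 1 - \<delta>. For unrestricted D the
  sum over overloaded bins is simply dropped.\<close>

lemma over_slack_bounds:
  assumes lam: "lam = 2 * real k1 + 2" and L: "0 < L"
    and \<kappa>: "\<kappa> = exp (- lam * (4 * L + 1))" and \<epsilon>: "\<epsilon> = \<kappa> / (8 * w)"
    and n: "2 * k1 \<le> n" "wm \<le> n" "lam \<le> \<epsilon> * real n"
  obtains U where
    "\<And>j. j \<in> {1..n} \<Longrightarrow> over_slack lam \<epsilon> wm n (nx j) \<le> over_slack lam \<epsilon> wm n x + U j"
    "\<And>j. j \<in> {1..n} \<Longrightarrow> \<bar>U j\<bar> \<le> (lam * w + 2 + w) / real n"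
    "real n * (\<Sum>j\<in>{1..n}. p j * U j) \<le> \<kappa> / 2 + (1 + 1 / \<epsilon>) * (1 - \<delta>)"
    "D \<le> L * real n \<Longrightarrow> real n * (\<Sum>j\<in>{1..n}. p j * U j) \<le> - \<kappa> / 2 + (1 + 1 / \<epsilon>) * (1 - \<delta>)"
proof -
  have "0 \<le> lam * (4 * L + 1)" using lam L by simp
  hence k: "0 < \<kappa>" "\<kappa> \<le> 1" by (simp_all add: \<kappa>)
  have e: "0 < \<epsilon>" "\<epsilon> \<le> 1" using k w_ge by (auto simp: \<epsilon> divide_le_eq_1)
  obtain U where U:
    "\<And>j. j \<in> {1..n} \<Longrightarrow> over_slack lam \<epsilon> wm n (nx j) \<le> over_slack lam \<epsilon> wm n x + U j"
    "\<And>j. j \<in> {1..n} \<Longrightarrow> \<bar>U j\<bar> \<le> (lam * w + 2 + w) / real n"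
    "real n * (\<Sum>j\<in>{1..n}. p j * U j)
       \<le> - (\<Sum>i\<in>heavy. H lam i) / real n + (1 - \<delta>) / \<epsilon> + 2 * \<epsilon> * w"
    using over_slack_drift[OF e lam n] by blast
  have ew: "2 * \<epsilon> * w = \<kappa> / 4" using w_ge by (simp add: \<epsilon>)
  have H0: "0 \<le> (\<Sum>i\<in>heavy. H lam i) / real n" by (auto simp: H_def intro!: sum_nonneg divide_nonneg_nonneg)
  have "real n * (\<Sum>j\<in>{1..n}. p j * U j) \<le> \<kappa> / 2 + (1 + 1 / \<epsilon>) * (1 - \<delta>)"
  proof -
    have "(1 + 1 / \<epsilon>) * (1 - \<delta>) = (1 - \<delta>) + (1 - \<delta>) / \<epsilon>" by (simp add: distrib_right)
    thus ?thesis using U(3) H0 ew \<delta>_bounds k by linarith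
  qed
  moreover have "real n * (\<Sum>j\<in>{1..n}. p j * U j) \<le> - \<kappa> / 2 + (1 + 1 / \<epsilon>) * (1 - \<delta>)"
    if "D \<le> L * real n"
  proof -
    have "\<kappa> * (\<delta> - 1 / 4) \<le> (\<Sum>i\<in>heavy. H lam i) / real n"
      using H_heavy_sum[OF _ L n(2) that, of lam] lam by (simp add: \<kappa>)
    moreover have "\<kappa> * (1 - \<delta>) \<le> 1 * (1 - \<delta>)" using k \<delta>_bounds by (intro mult_right_mono) auto
    moreover have sp: "(1 + 1 / \<epsilon>) * (1 - \<delta>) = (1 - \<delta>) + (1 - \<delta>) / \<epsilon>" by (simp add: distrib_right)
    moreover have "\<kappa> * (\<delta> - 1 / 4) = \<kappa> * \<delta> - \<kappa> / 4" "\<kappa> * (1 - \<delta>) = \<kappa> - \<kappa> * \<delta>"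
      by (simp_all add: algebra_simps)
    ultimately show ?thesis using U(3) ew unfolding minus_divide_left[symmetric] sp by argo
  qed
  ultimately show ?thesis using U that by blast
qed

text \<open>The hypothesis on \<mu> says that the expected gain of an underloaded bin, at rate k2
  (exp(\<mu>/2) - 1)/n, exceeds its loss \<mu> w/n from the growing average by 1/n. Overloaded bins
  are charged only with their loss, and their terms are at most exp(\<mu>), whence the multiple of
  \<delta>.\<close>

lemma under_slack_drift:
  assumes \<mu>: "0 \<le> \<mu>" "\<mu> * w + 1 \<le> k2 * (exp (\<mu> / 2) - 1)" and n: "2 * wm \<le> n"
  defines "U \<equiv> \<lambda>j. under_slack \<mu> n (nx j) - under_slack \<mu> n x"
  shows "j \<in> {1..n} \<Longrightarrow> \<bar>U j\<bar> \<le> (exp \<mu> * \<mu> * w + exp \<mu>) / real n"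
    and "real n * (\<Sum>j\<in>{1..n}. p j * U j) \<le> \<mu> * w * exp \<mu> * \<delta> - (\<Sum>i\<in>light. exp (\<mu> * y i)) / real n"
proof -
  define h where "h z = exp (\<mu> * min z 1)" for z
  define \<Delta> where "\<Delta> i j = h (y i + \<xi> i j) - h (y i)" for i j
  have n0: "0 < real n" using n_pos by simp
  have U: "U j = - (\<Sum>i\<in>{1..n}. \<Delta> i j) / real n" if "j \<in> {1..n}" for j
    using that by (simp add: U_def under_slack_def \<Delta>_def h_def dev_nx y_def sum_subtractf diff_divide_distrib)
  have h1: "h z \<le> exp \<mu>" "0 \<le> h z" for z
    using mult_left_mono[OF _ \<mu>(1), of "min z 1" 1] by (auto simp: h_def)
  have lip: "\<bar>h a - h b\<bar> \<le> exp \<mu> * (\<mu> * \<bar>a - b\<bar>)" for a b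
  proof -
    have "\<bar>h a - h b\<bar> \<le> exp \<mu> * \<bar>\<mu> * min a 1 - \<mu> * min b 1\<bar>"
      unfolding h_def using mult_left_mono[OF _ \<mu>(1), of _ 1] by (intro exp_diff_bound) auto
    also have "\<bar>\<mu> * min a 1 - \<mu> * min b 1\<bar> = \<mu> * \<bar>min a 1 - min b 1\<bar>"
      using \<mu> by (simp add: abs_mult flip: right_diff_distrib)
    also have "\<dots> \<le> \<mu> * \<bar>a - b\<bar>" using \<mu> by (intro mult_left_mono) auto
    finally show ?thesis by simp
  qed
  have mono: "h a \<le> h b" if "a \<le> b" for a b
    using that \<mu> by (auto simp: h_def intro!: mult_left_mono)
  show "\<bar>U j\<bar> \<le> (exp \<mu> * \<mu> * w + exp \<mu>) / real n" if j: "j \<in> {1..n}"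
  proof -
    have "\<bar>\<Sum>i\<in>{1..n}. \<Delta> i j\<bar> \<le> exp \<mu> * \<mu> * w + exp \<mu>"
    proof (rule sum_mean_abs[OF j])
      fix i assume "i \<noteq> j"
      hence "exp \<mu> * (\<mu> * \<bar>\<xi> i j\<bar>) \<le> exp \<mu> * (\<mu> * (w / real n))"
        using \<xi>_neq \<mu> by (intro mult_left_mono) auto
      thus "\<bar>\<Delta> i j\<bar> \<le> exp \<mu> * \<mu> * w / real n"
        using lip[of "y i + \<xi> i j" "y i"] by (simp add: \<Delta>_def mult_ac)
    next
      show "\<bar>\<Delta> j j\<bar> \<le> exp \<mu>" using h1[of "y j"] h1[of "y j + \<xi> j j"] by (simp add: \<Delta>_def)
    qed (use \<mu> w_ge in auto)
    thus ?thesis using n0 j by (simp add: U divide_right_mono)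
  qed
  have d: "wt j / real n \<le> w / real n" "0 \<le> wt j / real n" for j
    using wt_bounds[of j] n0 by (auto simp: divide_right_mono)
  have wn: "w / real n \<le> 1 / 2" using n n0 by (simp add: w_def)
  have low: "- (\<mu> * w / real n) * h z \<le> h (z - wt j / real n) - h z" for z j
  proof -
    have "exp (- (\<mu> * w / real n)) * h z \<le> h (z - wt j / real n)"
    proof -
      have "min z 1 - w / real n \<le> min (z - wt j / real n) 1" using d[of j] by linarith
      hence "\<mu> * (min z 1 - w / real n) \<le> \<mu> * min (z - wt j / real n) 1" using \<mu> by (intro mult_left_mono)
      thus ?thesis by (simp add: h_def algebra_simps flip: exp_add)
    qed
    moreover have "(1 - \<mu> * w / real n) * h z \<le> exp (- (\<mu> * w / real n)) * h z"
      using exp_ge_add_one_self[of "- (\<mu> * w / real n)"] h1 by (intro mult_right_mono) auto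
    ultimately show ?thesis by (simp add: algebra_simps)
  qed
  have elem: "- (\<mu> * w / real n) * h (y i)
      + (if i = j then (if j \<in> light then (exp (\<mu> / 2) - 1) * h (y j) else 0) else 0) \<le> \<Delta> i j"
    if "i \<in> {1..n}" "j \<in> {1..n}" for i j
  proof (cases "i = j \<and> j \<in> light")
    case True
    hence yj: "y j < 0" by (simp add: light_def y_def)
    have xi: "1 / 2 \<le> \<xi> j j" using d(1)[of j] wn w_ge True wt_light[of j] by (simp add: \<xi>_def del: divide_le_cancel)
    hence "\<mu> * (y j + 1 / 2) \<le> \<mu> * min (y j + \<xi> j j) 1" using \<mu> yj by (intro mult_left_mono) auto
    hence "exp (\<mu> / 2) * h (y j) \<le> h (y j + \<xi> j j)"
      using yj by (simp add: h_def algebra_simps flip: exp_add)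
    moreover have "0 \<le> \<mu> * w / real n * h (y j)" using \<mu> w_ge h1 by simp
    ultimately show ?thesis using True by (simp add: \<Delta>_def algebra_simps)
  next
    case False
    have "y i - wt j / real n \<le> y i + \<xi> i j" using wt_bounds[of j] by (simp add: \<xi>_def)
    from low[of "y i" j] mono[OF this] show ?thesis using False by (auto simp: \<Delta>_def)
  qed
  let ?T = "\<Sum>i\<in>{1..n}. h (y i)" and ?E = "exp (\<mu> / 2) - 1"
  let ?g = "\<lambda>j. if j \<in> light then ?E * h (y j) else 0"
  have col: "- (\<mu> * w / real n) * ?T + ?g j \<le> (\<Sum>i\<in>{1..n}. \<Delta> i j)" if j: "j \<in> {1..n}" for j
  proof -
    have "(\<Sum>i\<in>{1..n}. - (\<mu> * w / real n) * h (y i) + (if i = j then ?g j else 0)) \<le> (\<Sum>i\<in>{1..n}. \<Delta> i j)"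
      by (intro sum_mono elem j)
    thus ?thesis using j by (simp add: sum.distrib sum_subtractf sum_negf sum_distrib_left)
  qed
  have "real n * (\<Sum>j\<in>{1..n}. p j * U j) = (\<Sum>j\<in>{1..n}. p j * - (\<Sum>i\<in>{1..n}. \<Delta> i j))"
    by (subst sum_distrib_left, intro sum.cong) (use n0 in \<open>auto simp: U\<close>)
  also have "\<dots> \<le> (\<Sum>j\<in>{1..n}. p j * (\<mu> * w / real n * ?T - ?g j))"
  proof (intro sum_mono mult_left_mono p_nonneg)
    fix j assume "j \<in> {1..n}"
    from col[OF this] show "- (\<Sum>i\<in>{1..n}. \<Delta> i j) \<le> \<mu> * w / real n * ?T - ?g j" by linarith
  qed
  also have "\<dots> = \<mu> * w / real n * ?T - (\<Sum>j\<in>{1..n}. p j * ?g j)"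
    unfolding right_diff_distrib sum_subtractf sum_distrib_right[symmetric] p_sum by simp
  also have "(\<Sum>j\<in>{1..n}. p j * ?g j) = (\<Sum>j\<in>light. p j * (?E * h (y j)))"
    by (subst sum_split) (use heavy_light(2) in \<open>auto intro!: sum.neutral\<close>)
  also have "\<mu> * w / real n * ?T - (\<Sum>j\<in>light. p j * (?E * h (y j)))
      \<le> \<mu> * w / real n * ?T - (\<Sum>j\<in>light. (\<mu> * w + 1) / real n * h (y j))"
  proof (intro diff_left_mono sum_mono)
    fix j assume j: "j \<in> light"
    have E0: "0 \<le> ?E" using \<mu> by simp
    have "(\<mu> * w + 1) / real n \<le> k2 / real n * ?E" using divide_right_mono[OF \<mu>(2), of "real n"] by simp
    also have "\<dots> \<le> p j * ?E" using p_under[of j] j E0 by (intro mult_right_mono) (auto simp: light_def)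
    finally have "(\<mu> * w + 1) / real n * h (y j) \<le> p j * ?E * h (y j)" using h1 by (intro mult_right_mono)
    thus "(\<mu> * w + 1) / real n * h (y j) \<le> p j * (?E * h (y j))" by simp
  qed
  also have "\<dots> = \<mu> * w / real n * (\<Sum>j\<in>heavy. h (y j)) - (\<Sum>j\<in>light. h (y j)) / real n"
    unfolding sum_split sum_distrib_left[symmetric] by (simp add: add_divide_distrib algebra_simps)
  also have "(\<Sum>j\<in>heavy. h (y j)) \<le> real (card heavy) * exp \<mu>"
    using h1 by (intro sum_bounded_above) auto
  hence "\<mu> * w / real n * (\<Sum>j\<in>heavy. h (y j)) - (\<Sum>j\<in>light. h (y j)) / real n
      \<le> \<mu> * w / real n * (real (card heavy) * exp \<mu>) - (\<Sum>j\<in>light. h (y j)) / real n"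
    using \<mu> w_ge by (intro diff_right_mono mult_left_mono) auto
  also have "\<mu> * w / real n * (real (card heavy) * exp \<mu>) = \<mu> * w * exp \<mu> * \<delta>"
    by (simp add: \<delta>_def)
  also have "(\<Sum>j\<in>light. h (y j)) = (\<Sum>i\<in>light. exp (\<mu> * y i))"
    by (intro sum.cong) (auto simp: h_def light_def y_def)
  finally show "real n * (\<Sum>j\<in>{1..n}. p j * U j)
      \<le> \<mu> * w * exp \<mu> * \<delta> - (\<Sum>i\<in>light. exp (\<mu> * y i)) / real n" .
qed

lemma exp_light_sum:
  assumes "0 \<le> \<mu>" "0 < L" "D \<le> L * real n"
  shows "exp (- \<mu> * (4 * L + 1)) * (3 / 4 - \<delta>) \<le> (\<Sum>i\<in>light. exp (\<mu> * y i)) / real n"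
proof -
  let ?k = "exp (- \<mu> * (4 * L + 1))"
  have n0: "0 < real n" using n_pos by simp
  have "D / (4 * L) \<le> real n / 4" using assms(2,3) by (simp add: field_simps)
  hence "?k * ((1 - \<delta>) * real n - real n / 4) \<le> ?k * ((1 - \<delta>) * real n - D / (4 * L))"
    by (intro mult_left_mono) auto
  also have "\<dots> = (\<Sum>i\<in>light. ?k * (1 - (- y i) / (4 * L)))"
    unfolding sum_distrib_left[symmetric] sum_subtractf sum_divide_distrib[symmetric] D_under_sum
    by (simp add: card_light)
  also have "\<dots> \<le> (\<Sum>i\<in>light. exp (\<mu> * y i))"
  proof (rule sum_mono)
    fix i assume "i \<in> light"
    hence "0 \<le> - y i" by (simp add: light_def y_def)
    thus "?k * (1 - (- y i) / (4 * L)) \<le> exp (\<mu> * y i)"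
      using exp_neg_ge_affine[of \<mu> L "- y i" 0] assms by simp
  qed
  finally show ?thesis using n0 by (simp add: field_simps)
qed

lemma under_slack_bounds:
  assumes \<mu>: "0 \<le> \<mu>" "\<mu> * w + 1 \<le> k2 * (exp (\<mu> / 2) - 1)" and n: "2 * wm \<le> n" and L: "0 < L"
    and \<kappa>: "\<kappa> = exp (- \<mu> * (4 * L + 1))"
  obtains U where
    "\<And>j. j \<in> {1..n} \<Longrightarrow> under_slack \<mu> n (nx j) \<le> under_slack \<mu> n x + U j"
    "\<And>j. j \<in> {1..n} \<Longrightarrow> \<bar>U j\<bar> \<le> (exp \<mu> * \<mu> * w + exp \<mu>) / real n"
    "real n * (\<Sum>j\<in>{1..n}. p j * U j) \<le> \<kappa> / 2 + (\<mu> * w * exp \<mu> + 1) * \<delta>"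
    "D \<le> L * real n \<Longrightarrow> real n * (\<Sum>j\<in>{1..n}. p j * U j) \<le> - \<kappa> / 2 + (\<mu> * w * exp \<mu> + 1) * \<delta>"
proof
  let ?U = "\<lambda>j. under_slack \<mu> n (nx j) - under_slack \<mu> n x"
  show "under_slack \<mu> n (nx j) \<le> under_slack \<mu> n x + ?U j" for j by simp
  show "\<bar>?U j\<bar> \<le> (exp \<mu> * \<mu> * w + exp \<mu>) / real n" if "j \<in> {1..n}" for j
    by (rule under_slack_drift(1)[OF \<mu> n that])
  have k: "0 < \<kappa>" "\<kappa> \<le> 1" using \<mu> L by (auto simp: \<kappa> intro!: mult_nonneg_nonneg)
  note dr = under_slack_drift(2)[OF \<mu> n]
  have "0 \<le> (\<Sum>i\<in>light. exp (\<mu> * y i)) / real n" by (auto intro!: sum_nonneg divide_nonneg_nonneg)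
  thus "real n * (\<Sum>j\<in>{1..n}. p j * ?U j) \<le> \<kappa> / 2 + (\<mu> * w * exp \<mu> + 1) * \<delta>"
    using dr \<delta>_bounds k by (simp add: algebra_simps)
  show "real n * (\<Sum>j\<in>{1..n}. p j * ?U j) \<le> - \<kappa> / 2 + (\<mu> * w * exp \<mu> + 1) * \<delta>"
    if "D \<le> L * real n"
  proof -
    have "\<kappa> * \<delta> \<le> 1 * \<delta>" using k \<delta>_bounds by (intro mult_right_mono) auto
    moreover have "\<kappa> * (3 / 4 - \<delta>) \<le> (\<Sum>i\<in>light. exp (\<mu> * y i)) / real n"
      unfolding \<kappa> by (rule exp_light_sum[OF \<mu>(1) L that])
    ultimately show ?thesis using dr k unfolding right_diff_distrib[of \<kappa>] distrib_right by linarith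
  qed
qed

end

section \<open>The Lyapunov function\<close>

text \<open>Dividing the product by n gives all three summands the order n in a balanced
  configuration.\<close>

definition lyap :: "real \<Rightarrow> real \<Rightarrow> real \<Rightarrow> real \<Rightarrow> real \<Rightarrow> real \<Rightarrow> nat \<Rightarrow> nat \<Rightarrow> (nat \<Rightarrow> nat) \<Rightarrow> real" where
  "lyap \<alpha> \<beta> \<beta>' lam \<epsilon> \<mu> wm n x =
     pot \<alpha> 1 n x * pot \<alpha> (-1) n x / real n
     + pot \<alpha> 1 n x * exp (\<beta> * over_slack lam \<epsilon> wm n x)
     + pot \<alpha> (-1) n x * exp (\<beta>' * under_slack \<mu> n x)"

text \<open>exp(\<beta> U) is expanded to second order. Since |U| <= b/n for every choice, the mixed
  term with the relative increment \<open>a\<close> of the potential and the square term both stay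
  of order 1/n. For \<open>a\<close> of order \<alpha> and \<beta> of order \<alpha>^2 they are of
  order \<alpha>^3/n or smaller.\<close>

lemma (in alloc_step) tilt_drift:
  assumes X: "0 < X" and a: "0 \<le> a" "a \<le> 1" and b: "0 \<le> b" and \<beta>: "0 \<le> \<beta>" "\<beta> * b \<le> 1"
    and F: "\<And>j. j \<in> {1..n} \<Longrightarrow> \<bar>F j - X\<bar> \<le> a * X" "\<And>j. j \<in> {1..n} \<Longrightarrow> 0 \<le> F j"
    and G: "\<And>j. j \<in> {1..n} \<Longrightarrow> G j \<le> g + U j" "\<And>j. j \<in> {1..n} \<Longrightarrow> \<bar>U j\<bar> \<le> b / real n"
    and EF: "(\<Sum>j\<in>{1..n}. p j * F j) \<le> X + r * X / real n"
    and EU: "real n * (\<Sum>j\<in>{1..n}. p j * U j) \<le> s"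
  shows "(\<Sum>j\<in>{1..n}. p j * (F j * exp (\<beta> * G j)))
     \<le> X * exp (\<beta> * g) * (1 + (r + \<beta> * s + \<beta> * a * b + 2 * \<beta>\<^sup>2 * b\<^sup>2) / real n)"
proof -
  have n0: "0 < real n" and n1: "1 \<le> real n" using n_pos by auto
  let ?e = "(\<beta> * a * b + 2 * \<beta>\<^sup>2 * b\<^sup>2) / real n * X"
  have pt: "F j * exp (\<beta> * G j) \<le> exp (\<beta> * g) * (F j + \<beta> * X * U j + ?e)" if j: "j \<in> {1..n}" for j
  proof -
    have bn: "b / real n \<le> b" using b by (rule divide_n_le)
    have U: "\<bar>U j\<bar> \<le> b" using G(2)[OF j] bn by linarith
    have bU: "\<beta> * \<bar>U j\<bar> \<le> \<beta> * b / real n" using mult_left_mono[OF G(2)[OF j] \<beta>(1)] by simp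
    have "\<beta> * U j \<le> \<beta> * b" using U \<beta> by (intro mult_left_mono) auto
    hence "exp (\<beta> * U j) \<le> 1 + \<beta> * U j + (\<beta> * U j)\<^sup>2"
      using \<beta> by (intro exp_le_quadratic) linarith
    moreover have "exp (\<beta> * G j) \<le> exp (\<beta> * g) * exp (\<beta> * U j)"
      using mult_left_mono[OF G(1)[OF j] \<beta>(1)] by (simp add: distrib_left flip: exp_add)
    ultimately have "exp (\<beta> * G j) \<le> exp (\<beta> * g) * (1 + \<beta> * U j + (\<beta> * U j)\<^sup>2)"
      by (meson exp_ge_zero mult_left_mono order_trans)
    hence "F j * exp (\<beta> * G j) \<le> F j * (exp (\<beta> * g) * (1 + \<beta> * U j + (\<beta> * U j)\<^sup>2))"
      using F(2)[OF j] by (intro mult_left_mono)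
    also have "\<dots> = exp (\<beta> * g) * (F j + \<beta> * X * U j + (\<beta> * (F j - X) * U j + F j * (\<beta> * U j)\<^sup>2))"
      by (simp add: algebra_simps)
    also have "\<dots> \<le> exp (\<beta> * g) * (F j + \<beta> * X * U j + ?e)"
    proof (intro mult_left_mono add_left_mono)
      have "\<beta> * (F j - X) * U j \<le> \<bar>F j - X\<bar> * (\<beta> * \<bar>U j\<bar>)"
        using \<beta> by (metis abs_ge_self abs_mult abs_of_nonneg mult.assoc mult.left_commute)
      also have "\<dots> \<le> (a * X) * (\<beta> * b / real n)"
        using F(1)[OF j] bU \<beta> X a by (intro mult_mono) auto
      finally have 1: "\<beta> * (F j - X) * U j \<le> a * X * (\<beta> * b / real n)" .
      have "F j \<le> 2 * X" using F(1)[OF j] a mult_right_mono[of a 1 X] X by linarith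
      moreover have "(\<beta> * U j)\<^sup>2 \<le> \<beta>\<^sup>2 * b\<^sup>2 / real n"
      proof -
        have "(\<beta> * U j)\<^sup>2 = (\<beta> * \<bar>U j\<bar>)\<^sup>2" by (simp add: power_mult_distrib)
        also have "\<dots> \<le> (\<beta> * b / real n)\<^sup>2" using bU \<beta> by (intro power_mono) auto
        also have "\<dots> = (\<beta>\<^sup>2 * b\<^sup>2 / real n) / real n" by (simp add: power2_eq_square)
        also have "\<dots> \<le> \<beta>\<^sup>2 * b\<^sup>2 / real n" by (rule divide_n_le) simp
        finally show ?thesis .
      qed
      ultimately have 2: "F j * (\<beta> * U j)\<^sup>2 \<le> (2 * X) * (\<beta>\<^sup>2 * b\<^sup>2 / real n)"
        using X by (intro mult_mono) auto
      show "\<beta> * (F j - X) * U j + F j * (\<beta> * U j)\<^sup>2 \<le> ?e"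
        using 1 2 by (simp add: add_divide_distrib algebra_simps)
    qed simp
    finally show ?thesis .
  qed
  have "(\<Sum>j\<in>{1..n}. p j * (F j * exp (\<beta> * G j)))
     \<le> (\<Sum>j\<in>{1..n}. p j * (exp (\<beta> * g) * (F j + \<beta> * X * U j + ?e)))"
    by (intro sum_mono mult_left_mono pt p_nonneg)
  also have "\<dots> = exp (\<beta> * g) * ((\<Sum>j\<in>{1..n}. p j * F j) + \<beta> * X * (\<Sum>j\<in>{1..n}. p j * U j)
      + (\<Sum>j\<in>{1..n}. p j) * ?e)"
    by (simp only: sum_distrib_left sum_distrib_right sum.distrib distrib_left mult_ac)
  also have "\<dots> \<le> exp (\<beta> * g) * ((X + r * X / real n) + \<beta> * X * (s / real n) + ?e)"
    using EF EU \<beta> X n0 p_sum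
    by (intro mult_left_mono add_mono) (auto simp: field_simps)
  also have "\<dots> = X * exp (\<beta> * g) * (1 + (r + \<beta> * s + \<beta> * a * b + 2 * \<beta>\<^sup>2 * b\<^sup>2) / real n)"
    by (simp add: add_divide_distrib algebra_simps)
  finally show ?thesis .
qed

text \<open>Discrete product rule: the two single drifts give the linear terms, and
  \<open>pot_cross_bound\<close> the product of the increments.\<close>

lemma (in alloc_step) prod_drift:
  assumes a: "0 \<le> \<alpha>" "\<alpha> * w \<le> 1"
  defines "X \<equiv> pot \<alpha> 1 n x" and "Y \<equiv> pot \<alpha> (-1) n x" and "C \<equiv> 8 * w\<^sup>2 * (real k1 + 2)"
  shows "(\<Sum>j\<in>{1..n}. p j * (pot \<alpha> 1 n (nx j) * pot \<alpha> (-1) n (nx j) / real n))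
    \<le> X * Y / real n * (1 + (- c * \<alpha> * (1 - \<delta>) * (S \<alpha> 1 / X) - c * \<alpha> * \<delta> * (S \<alpha> (-1) / Y)
         + (2 * C + 52 * w\<^sup>2) * \<alpha>\<^sup>2) / real n)"
proof -
  let ?F = "\<lambda>j. pot \<alpha> 1 n (nx j)" and ?G = "\<lambda>j. pot \<alpha> (-1) n (nx j)"
  have n0: "0 < real n" using n_pos by simp
  have XY: "0 < X" "0 < Y" using n0 pot_ge[of n \<alpha> _ x] unfolding X_def Y_def by (meson less_le_trans)+
  have "(\<Sum>j\<in>{1..n}. p j * (?F j * ?G j)) \<le> (\<Sum>j\<in>{1..n}. p j * (X * ?G j + Y * ?F j - X * Y
      + 52 * w\<^sup>2 * \<alpha>\<^sup>2 * X * Y / real n))"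
  proof (intro sum_mono mult_left_mono p_nonneg)
    fix j assume j: "j \<in> {1..n}"
    have "(?F j - X) * (?G j - Y) \<le> 52 * w\<^sup>2 * \<alpha>\<^sup>2 * X * Y / real n"
      unfolding X_def Y_def by (rule pot_cross_bound[OF a j])
    moreover have "(?F j - X) * (?G j - Y) = ?F j * ?G j - X * ?G j - Y * ?F j + X * Y"
      by (simp add: algebra_simps)
    ultimately show "?F j * ?G j \<le> X * ?G j + Y * ?F j - X * Y + 52 * w\<^sup>2 * \<alpha>\<^sup>2 * X * Y / real n"
      by linarith
  qed
  also have "\<dots> = X * (\<Sum>j\<in>{1..n}. p j * ?G j) + Y * (\<Sum>j\<in>{1..n}. p j * ?F j)
      + (\<Sum>j\<in>{1..n}. p j) * (52 * w\<^sup>2 * \<alpha>\<^sup>2 * X * Y / real n - X * Y)"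
    unfolding sum_distrib_left sum_distrib_right sum.distrib[symmetric]
    by (intro sum.cong) (auto simp: algebra_simps)
  also have "\<dots> \<le> X * (Y - c * \<alpha> * \<delta> / real n * S \<alpha> (-1) + C * \<alpha>\<^sup>2 * Y / real n)
      + Y * (X - c * \<alpha> * (1 - \<delta>) / real n * S \<alpha> 1 + C * \<alpha>\<^sup>2 * X / real n)
      + (\<Sum>j\<in>{1..n}. p j) * (52 * w\<^sup>2 * \<alpha>\<^sup>2 * X * Y / real n - X * Y)"
    unfolding X_def Y_def C_def using XY[unfolded X_def Y_def]
    by (intro add_right_mono add_mono mult_left_mono over_pot_drift[OF a] under_pot_drift[OF a]) auto
  also have "\<dots> = X * Y * (1 + (- c * \<alpha> * (1 - \<delta>) * (S \<alpha> 1 / X) - c * \<alpha> * \<delta> * (S \<alpha> (-1) / Y)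
         + (2 * C + 52 * w\<^sup>2) * \<alpha>\<^sup>2) / real n)"
    using XY n0 by (simp add: p_sum field_simps)
  finally have "(\<Sum>j\<in>{1..n}. p j * (?F j * ?G j)) / real n
      \<le> X * Y * (1 + (- c * \<alpha> * (1 - \<delta>) * (S \<alpha> 1 / X) - c * \<alpha> * \<delta> * (S \<alpha> (-1) / Y)
         + (2 * C + 52 * w\<^sup>2) * \<alpha>\<^sup>2) / real n) / real n"
    by (rule divide_right_mono) simp
  thus ?thesis by (simp add: sum_divide_distrib)
qed

text \<open>\<theta> is the fraction that makes the potential drop (1 - \<delta> for overloads,
  \<delta> for underloads), and E \<theta> is the harm it does to the slack. If X >= 2 n, the drop
  of order \<alpha> \<theta> outweighs the harm of order \<alpha>^2 \<theta>; otherwise V is at most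
  4 n and the harm becomes an additive constant. \<sigma> is -1 while D <= L n and 1
  otherwise.\<close>

lemma tilt_rate:
  fixes n X S V V' :: real
  assumes n: "1 \<le> n" and X: "n \<le> X" "X \<le> n + S" and \<theta>: "0 \<le> \<theta>" "\<theta> \<le> 1"
    and c: "0 < c" "0 < \<alpha>" "0 \<le> B" "0 \<le> k" "0 \<le> E" "\<alpha> * (B * E) \<le> c / 2"
    and V: "0 \<le> V" "V \<le> 2 * X" and \<sigma>: "\<bar>\<sigma>\<bar> \<le> 1"
    and V': "V' \<le> V * (1 + (- c * \<alpha> * \<theta> * (S / X) + C * \<alpha>\<^sup>2 + B * \<alpha>\<^sup>2 * s) / n)"
    and s: "s \<le> \<sigma> * k + E * \<theta>"
  shows "V' \<le> V * (1 + (C + \<sigma> * (B * k)) * \<alpha>\<^sup>2 / n) + 4 * \<alpha>\<^sup>2 * B * (2 * k + E)"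
proof -
  define \<rho> where "\<rho> = (C + \<sigma> * (B * k)) * \<alpha>\<^sup>2"
  have S: "0 \<le> S" using X by linarith
  have X0: "0 < X" using n X by linarith
  have "B * \<alpha>\<^sup>2 * s \<le> B * \<alpha>\<^sup>2 * (\<sigma> * k + E * \<theta>)" using c by (intro mult_left_mono s) auto
  hence rate: "- c * \<alpha> * \<theta> * (S / X) + C * \<alpha>\<^sup>2 + B * \<alpha>\<^sup>2 * s
      \<le> \<rho> - c * \<alpha> * \<theta> * (S / X) + B * \<alpha>\<^sup>2 * E * \<theta>"
    by (simp add: \<rho>_def algebra_simps)
  have V1: "V' \<le> V * (1 + (\<rho> + z) / n)"
    if "- c * \<alpha> * \<theta> * (S / X) + B * \<alpha>\<^sup>2 * E * \<theta> \<le> z" for z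
  proof -
    have "- c * \<alpha> * \<theta> * (S / X) + C * \<alpha>\<^sup>2 + B * \<alpha>\<^sup>2 * s \<le> \<rho> + z" using rate that by linarith
    hence "V * (1 + (- c * \<alpha> * \<theta> * (S / X) + C * \<alpha>\<^sup>2 + B * \<alpha>\<^sup>2 * s) / n) \<le> V * (1 + (\<rho> + z) / n)"
      using V n by (intro mult_left_mono add_left_mono divide_right_mono) auto
    thus ?thesis using V' by linarith
  qed
  have K: "0 \<le> 4 * \<alpha>\<^sup>2 * B * (2 * k + E)" using c by simp
  show ?thesis
  proof (cases "2 * n \<le> X")
    case True
    have "1 / 2 \<le> S / X" using True X X0 by (simp add: field_simps)
    hence "c * \<alpha> * \<theta> * (1 / 2) \<le> c * \<alpha> * \<theta> * (S / X)" using c \<theta> by (intro mult_left_mono) auto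
    moreover have "\<alpha> * \<theta> * (\<alpha> * (B * E)) \<le> \<alpha> * \<theta> * (c / 2)" using c \<theta> by (intro mult_left_mono) auto
    moreover have "\<alpha> * \<theta> * (\<alpha> * (B * E)) = B * \<alpha>\<^sup>2 * E * \<theta>" "\<alpha> * \<theta> * (c / 2) = c * \<alpha> * \<theta> * (1 / 2)"
      by (simp_all add: power2_eq_square)
    ultimately have "- c * \<alpha> * \<theta> * (S / X) + B * \<alpha>\<^sup>2 * E * \<theta> \<le> 0" by linarith
    from V1[OF this] K show ?thesis unfolding \<rho>_def add_0_right by linarith
  next
    case False
    have "0 \<le> c * \<alpha> * \<theta> * (S / X)" using c \<theta> S X0 by simp
    moreover have "B * \<alpha>\<^sup>2 * E * \<theta> \<le> B * \<alpha>\<^sup>2 * E * 1" using c \<theta> by (intro mult_left_mono) auto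
    ultimately have "- c * \<alpha> * \<theta> * (S / X) + B * \<alpha>\<^sup>2 * E * \<theta> \<le> B * \<alpha>\<^sup>2 * E" by linarith
    from V1[OF this] have "V' \<le> V * (1 + \<rho> / n) + V / n * (B * \<alpha>\<^sup>2 * E)"
      by (simp add: add_divide_distrib algebra_simps)
    also have "V / n * (B * \<alpha>\<^sup>2 * E) \<le> 4 * (B * \<alpha>\<^sup>2 * E)"
      using V False n c by (intro mult_right_mono) (auto simp: field_simps)
    also have "\<dots> \<le> 4 * \<alpha>\<^sup>2 * B * (2 * k + E)" using c by (simp add: algebra_simps)
    finally show ?thesis by (simp add: \<rho>_def)
  qed
qed

text \<open>S/X >= S/(n + S), and u/(1 + u) >= u/2 for u = \<alpha> L in [0,1].\<close>

lemma S_over_X_ge: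
  fixes n X S :: real
  assumes "0 < n" "0 < X" "X \<le> n + S" "\<alpha> * L * n \<le> S" "0 \<le> \<alpha> * L" "\<alpha> * L \<le> 1"
  shows "\<alpha> * L / 2 \<le> S / X"
proof -
  let ?q = "\<alpha> * L"
  have S: "0 \<le> S" using assms by (meson mult_nonneg_nonneg less_imp_le order_trans)
  have "?q * X \<le> ?q * (n + S)" using assms by (intro mult_left_mono) auto
  also have "\<dots> \<le> 2 * S" using assms mult_right_mono[OF assms(6) S] by (simp add: distrib_left)
  finally show ?thesis using assms by (simp add: field_simps)
qed

lemma one_minus_distrib:
  "(1 - h) * (u + v + z) = u - u * h + (v - v * h) + (z - z * h)" for h :: real
  by (simp add: algebra_simps)

text \<open>
  In the next two lemmas \<open>Sx\<close>, \<open>Sy\<close> are the unsmoothed potentials, a prime marks the conditional expectation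
  after one step, and the case split is on whether \<open>D\<close> exceeds \<open>L n\<close>.
\<close>

lemma lyapunov_far:
  fixes n X Y :: real
  assumes n: "1 \<le> n" and X: "n \<le> X" "X \<le> n + Sx" and Y: "n \<le> Y" "Y \<le> n + Sy"
    and S: "\<alpha> * L * n \<le> Sx" "\<alpha> * L * n \<le> Sy" and \<alpha>: "0 < \<alpha>" "0 \<le> L" "\<alpha> * L \<le> 1"
    and \<delta>: "0 \<le> \<delta>" "\<delta> \<le> 1" and c: "0 < c" "0 \<le> \<rho>"
    and L: "c * L / 4 = C + 1 + 4 * (\<rho> + 1)"
    and V1: "0 \<le> V1" "V1 \<le> 2 * X" and V2: "0 \<le> V2" "V2 \<le> 2 * Y"
    and V3': "V3' \<le> X * Y / n * (1 + (- c * \<alpha> * (1 - \<delta>) * (Sx / X) - c * \<alpha> * \<delta> * (Sy / Y) + C * \<alpha>\<^sup>2) / n)"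
    and V1': "V1' \<le> V1 * (1 + \<rho> * \<alpha>\<^sup>2 / n) + K1" and V2': "V2' \<le> V2 * (1 + \<rho> * \<alpha>\<^sup>2 / n) + K2"
  shows "V3' + V1' + V2' \<le> (1 - \<alpha>\<^sup>2 / n) * (X * Y / n + V1 + V2) + (K1 + K2)"
proof -
  let ?V3 = "X * Y / n"
  have pos: "0 < n" "0 < X" "0 < Y" "0 \<le> \<alpha> * L" using n X Y \<alpha> by auto
  have x: "\<alpha> * L / 2 \<le> Sx / X" and y: "\<alpha> * L / 2 \<le> Sy / Y"
    using S_over_X_ge pos X Y S \<alpha> by auto
  \<comment> \<open>Both ratios are at least \<alpha> L/2, so their mean with weights 1 - \<delta>
    and \<delta> is too, whatever \<delta> is.\<close>
  have "(1 - \<delta>) * (\<alpha> * L / 2) + \<delta> * (\<alpha> * L / 2) \<le> (1 - \<delta>) * (Sx / X) + \<delta> * (Sy / Y)"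
    using x y \<delta> by (intro add_mono mult_left_mono) auto
  moreover have "(1 - \<delta>) * (\<alpha> * L / 2) + \<delta> * (\<alpha> * L / 2) = \<alpha> * L / 2"
    by (simp only: distrib_right[symmetric]) simp
  ultimately have "\<alpha> * L / 4 \<le> (1 - \<delta>) * (Sx / X) + \<delta> * (Sy / Y)" using pos(4) by linarith
  hence "c * \<alpha> * (\<alpha> * L / 4) \<le> c * \<alpha> * ((1 - \<delta>) * (Sx / X) + \<delta> * (Sy / Y))"
    using c \<alpha> by (intro mult_left_mono) auto
  also have "c * \<alpha> * (\<alpha> * L / 4) = (C + 1 + 4 * (\<rho> + 1)) * \<alpha>\<^sup>2"
    unfolding L[symmetric] by (simp add: power2_eq_square)
  finally have r: "(C + 1 + 4 * (\<rho> + 1)) * \<alpha>\<^sup>2 \<le> c * \<alpha> * ((1 - \<delta>) * (Sx / X) + \<delta> * (Sy / Y))" .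
  have rate: "- c * \<alpha> * (1 - \<delta>) * (Sx / X) - c * \<alpha> * \<delta> * (Sy / Y) + C * \<alpha>\<^sup>2
      \<le> - (1 + 4 * (\<rho> + 1)) * \<alpha>\<^sup>2"
  proof -
    note r
    moreover have "c * \<alpha> * ((1 - \<delta>) * (Sx / X) + \<delta> * (Sy / Y))
        = c * \<alpha> * (1 - \<delta>) * (Sx / X) + c * \<alpha> * \<delta> * (Sy / Y)" by (simp only: distrib_left mult.assoc)
    moreover have "(C + 1 + 4 * (\<rho> + 1)) * \<alpha>\<^sup>2 = C * \<alpha>\<^sup>2 + (1 + 4 * (\<rho> + 1)) * \<alpha>\<^sup>2"
      by (simp add: algebra_simps)
    ultimately show ?thesis by linarith
  qed
  have V30: "0 \<le> ?V3" using pos by simp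
  \<comment> \<open>As X and Y are at least n, the product over n dominates both; with the factor 2
    of each tilt it bounds V1 + V2 up to the factor 4. This is the 4 in the choice of L: the extra
    drop of the product pays for the growth \<rho> of the tilted potentials.\<close>
  have "X * n \<le> X * Y" "n * Y \<le> X * Y" using X Y pos by (auto intro: mult_left_mono mult_right_mono)
  hence "X \<le> ?V3" "Y \<le> ?V3" using pos by (simp_all add: field_simps)
  hence "V1 + V2 \<le> 4 * ?V3" using V1 V2 by linarith
  hence "(V1 + V2) * ((\<rho> + 1) * \<alpha>\<^sup>2 / n) \<le> 4 * ?V3 * ((\<rho> + 1) * \<alpha>\<^sup>2 / n)"
    using c pos by (intro mult_right_mono) auto
  moreover have "V3' \<le> ?V3 * (1 + - (1 + 4 * (\<rho> + 1)) * \<alpha>\<^sup>2 / n)"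
    using rate V30 pos V3'
    by (meson add_left_mono divide_right_mono less_imp_le mult_left_mono order_trans)
  moreover have "?V3 * (1 + - (1 + 4 * (\<rho> + 1)) * \<alpha>\<^sup>2 / n)
      = ?V3 - ?V3 * (\<alpha>\<^sup>2 / n) - 4 * ?V3 * ((\<rho> + 1) * \<alpha>\<^sup>2 / n)"
    by (simp add: add_divide_distrib diff_divide_distrib algebra_simps)
  moreover have "(V1 + V2) * ((\<rho> + 1) * \<alpha>\<^sup>2 / n)
      = V1 * (\<rho> * \<alpha>\<^sup>2 / n) + V1 * (\<alpha>\<^sup>2 / n) + V2 * (\<rho> * \<alpha>\<^sup>2 / n) + V2 * (\<alpha>\<^sup>2 / n)"
    by (simp add: add_divide_distrib algebra_simps)
  moreover have "(1 - \<alpha>\<^sup>2 / n) * (?V3 + V1 + V2)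
      = ?V3 - ?V3 * (\<alpha>\<^sup>2 / n) + (V1 - V1 * (\<alpha>\<^sup>2 / n)) + (V2 - V2 * (\<alpha>\<^sup>2 / n))"
    by (rule one_minus_distrib)
  ultimately show ?thesis using V1' V2' unfolding distrib_left mult_1_right by linarith
qed

lemma lyapunov_near:
  fixes n X Y :: real
  assumes n: "1 \<le> n" and X: "n \<le> X" "X \<le> n + Sx" and Y: "n \<le> Y" "Y \<le> n + Sy"
    and \<alpha>: "0 < \<alpha>" "\<alpha> * (C + 1) \<le> c / 2" "0 \<le> C"
    and \<delta>: "0 \<le> \<delta>" "\<delta> \<le> 1" and c: "0 < c" and \<rho>: "\<rho> = - (4 * C + 5)"
    and V1: "0 \<le> V1" "X \<le> 2 * V1" and V2: "0 \<le> V2" "Y \<le> 2 * V2"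
    and V3': "V3' \<le> X * Y / n * (1 + (- c * \<alpha> * (1 - \<delta>) * (Sx / X) - c * \<alpha> * \<delta> * (Sy / Y) + C * \<alpha>\<^sup>2) / n)"
    and V1': "V1' \<le> V1 * (1 + \<rho> * \<alpha>\<^sup>2 / n) + K1" and V2': "V2' \<le> V2 * (1 + \<rho> * \<alpha>\<^sup>2 / n) + K2"
  shows "V3' + V1' + V2' \<le> (1 - \<alpha>\<^sup>2 / n) * (X * Y / n + V1 + V2) + (K1 + K2)"
proof -
  let ?V3 = "X * Y / n" and ?h = "\<alpha>\<^sup>2 / n"
  let ?r = "- c * \<alpha> * (1 - \<delta>) * (Sx / X) - c * \<alpha> * \<delta> * (Sy / Y)"
  have pos: "0 < n" "0 < X" "0 < Y" "0 \<le> Sx" "0 \<le> Sy" using n X Y by auto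
  have V30: "0 \<le> ?V3" using pos by simp
  have h0: "0 \<le> ?h" using pos by simp
  have V3r: "V3' \<le> ?V3 + ?V3 * (z / n)" if "?r + C * \<alpha>\<^sup>2 \<le> z" for z
  proof -
    have "?V3 * (1 + (?r + C * \<alpha>\<^sup>2) / n) \<le> ?V3 * (1 + z / n)"
      using that V30 pos by (intro mult_left_mono add_left_mono divide_right_mono) auto
    thus ?thesis using V3' by (simp add: distrib_left)
  qed
  have V1h: "V1' \<le> V1 - (4 * C + 5) * (V1 * ?h) + K1" and V2h: "V2' \<le> V2 - (4 * C + 5) * (V2 * ?h) + K2"
  proof -
    have "v * (1 + \<rho> * \<alpha>\<^sup>2 / n) = v - (4 * C + 5) * (v * ?h)" for v
      by (simp add: \<rho> add_divide_distrib diff_divide_distrib algebra_simps)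
    thus "V1' \<le> V1 - (4 * C + 5) * (V1 * ?h) + K1" "V2' \<le> V2 - (4 * C + 5) * (V2 * ?h) + K2"
      using V1' V2' by simp_all
  qed
  have C0: "0 \<le> C * (V1 * ?h)" "0 \<le> C * (V2 * ?h)" "0 \<le> V1 * ?h" "0 \<le> V2 * ?h" using \<alpha>(3) V1(1) V2(1) h0 by (simp_all only: mult_nonneg_nonneg)
  have goal: "(1 - \<alpha>\<^sup>2 / n) * (?V3 + V1 + V2) = ?V3 - ?V3 * ?h + (V1 - V1 * ?h) + (V2 - V2 * ?h)"
    by (rule one_minus_distrib)
  have r0: "?r \<le> 0"
  proof -
    have "0 \<le> c * \<alpha> * (1 - \<delta>) * (Sx / X)" "0 \<le> c * \<alpha> * \<delta> * (Sy / Y)" using c \<alpha> \<delta> pos by auto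
    thus ?thesis by linarith
  qed
  have split: "(4 * C + 5) * t = 4 * (C * t) + 5 * t" for t by (simp add: algebra_simps)
  \<comment> \<open>If both potentials are large, the product drops by itself. If one is at most 2
    n, the product is at most 4 times the tilted version of the other, whose rate 4 C + 5 = 4 (C +
    1) + 1 pays for the product and for its own decay.\<close>
  consider "2 * n \<le> X" "2 * n \<le> Y" | "X \<le> 2 * n" | "Y \<le> 2 * n" by linarith
  thus ?thesis
  proof cases
    case 1
    have "1 / 2 \<le> Sx / X" "1 / 2 \<le> Sy / Y" using 1 X Y pos by (simp_all add: field_simps)
    hence "(1 - \<delta>) * (1 / 2) + \<delta> * (1 / 2) \<le> (1 - \<delta>) * (Sx / X) + \<delta> * (Sy / Y)"
      using \<delta> by (intro add_mono mult_left_mono) auto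
    moreover have "(1 - \<delta>) * (1 / 2) + \<delta> * (1 / 2) = (1 / 2 :: real)" by (simp only: distrib_right[symmetric]) simp
    ultimately have "1 / 2 \<le> (1 - \<delta>) * (Sx / X) + \<delta> * (Sy / Y)" by linarith
    hence "c * \<alpha> * (1 / 2) \<le> c * \<alpha> * ((1 - \<delta>) * (Sx / X) + \<delta> * (Sy / Y))"
      using c \<alpha> by (intro mult_left_mono) auto
    moreover have "\<alpha> * (\<alpha> * (C + 1)) \<le> \<alpha> * (c / 2)" using \<alpha> by (intro mult_left_mono) auto
    moreover have "c * \<alpha> * ((1 - \<delta>) * (Sx / X) + \<delta> * (Sy / Y))
        = c * \<alpha> * (1 - \<delta>) * (Sx / X) + c * \<alpha> * \<delta> * (Sy / Y)" by (simp only: distrib_left mult.assoc)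
    moreover have "\<alpha> * (\<alpha> * (C + 1)) = C * \<alpha>\<^sup>2 + \<alpha>\<^sup>2" "\<alpha> * (c / 2) = c * \<alpha> * (1 / 2)"
      by (simp_all add: algebra_simps power2_eq_square)
    ultimately have "?r + C * \<alpha>\<^sup>2 \<le> - \<alpha>\<^sup>2" by linarith
    from V3r[OF this] V1h V2h C0 goal show ?thesis unfolding split by simp
  next
    case 2
    have "?r + C * \<alpha>\<^sup>2 \<le> C * \<alpha>\<^sup>2" using r0 by simp
    from V3r[OF this] have "V3' \<le> ?V3 - ?V3 * ?h + (C + 1) * (?V3 * ?h)"
      unfolding distrib_right mult_1_left by (simp add: mult_ac)
    moreover have "?V3 \<le> 2 * Y" using 2 pos by (simp add: field_simps)
    hence "?V3 \<le> 4 * V2" using V2 by linarith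
    hence "(C + 1) * (?V3 * ?h) \<le> (C + 1) * (4 * V2 * ?h)"
      using \<alpha> h0 by (intro mult_left_mono mult_right_mono) auto
    moreover have "(C + 1) * (4 * V2 * ?h) = 4 * (C * (V2 * ?h)) + 4 * (V2 * ?h)" unfolding distrib_right by (simp add: mult_ac)
    ultimately show ?thesis using V1h V2h C0 goal unfolding split by argo
  next
    case 3
    have "?r + C * \<alpha>\<^sup>2 \<le> C * \<alpha>\<^sup>2" using r0 by simp
    from V3r[OF this] have "V3' \<le> ?V3 - ?V3 * ?h + (C + 1) * (?V3 * ?h)"
      unfolding distrib_right mult_1_left by (simp add: mult_ac)
    moreover have "?V3 \<le> 2 * X" using 3 pos by (simp add: field_simps)
    hence "?V3 \<le> 4 * V1" using V1 by linarith
    hence "(C + 1) * (?V3 * ?h) \<le> (C + 1) * (4 * V1 * ?h)"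
      using \<alpha> h0 by (intro mult_left_mono mult_right_mono) auto
    moreover have "(C + 1) * (4 * V1 * ?h) = 4 * (C * (V1 * ?h)) + 4 * (V1 * ?h)" unfolding distrib_right by (simp add: mult_ac)
    ultimately show ?thesis using V1h V2h C0 goal unfolding split by argo
  qed
qed

lemma exp_half_bounds:
  fixes z :: real
  assumes "\<bar>z\<bar> \<le> 1 / 2"
  shows "exp z \<le> 2" "1 / 2 \<le> exp z"
proof -
  have "exp z \<le> 1 + z + z\<^sup>2" using assms by (intro exp_le_quadratic) auto
  also have "z\<^sup>2 \<le> (1/2)\<^sup>2" using assms by (subst power2_abs[symmetric]) (intro power_mono, auto)
  finally show "exp z \<le> 2" using assms by (simp add: power2_eq_square)
  show "1 / 2 \<le> exp z" using exp_ge_add_one_self[of z] assms by linarith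
qed

lemma (in alloc_step) tilted_pot_drift:
  assumes s: "s = 1 \<or> s = -1" and a: "0 < \<alpha>" "\<alpha> \<le> 1" "8 * w * \<alpha> \<le> 1"
    and \<theta>: "0 \<le> \<theta>" "\<theta> \<le> 1" "0 \<le> C"
    and EX: "(\<Sum>j\<in>{1..n}. p j * pot \<alpha> s n (nx j)) \<le> pot \<alpha> s n x
      - c * \<alpha> * \<theta> / real n * S \<alpha> s + C * \<alpha>\<^sup>2 * pot \<alpha> s n x / real n"
    and B: "0 \<le> B" "0 \<le> b" "0 \<le> k" "0 \<le> E" "\<alpha> * (B * E) \<le> c / 2" "\<alpha> * (8 * w * (B * b)) \<le> 1 / 2"
      "\<bar>B * \<alpha>\<^sup>2 * g\<bar> \<le> 1 / 2"
    and G: "\<And>j. j \<in> {1..n} \<Longrightarrow> G j \<le> g + U j" "\<And>j. j \<in> {1..n} \<Longrightarrow> \<bar>U j\<bar> \<le> b / real n"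
    and EU: "real n * (\<Sum>j\<in>{1..n}. p j * U j) \<le> \<sigma> * k + E * \<theta>" and \<sigma>: "\<bar>\<sigma>\<bar> \<le> 1"
  shows "(\<Sum>j\<in>{1..n}. p j * (pot \<alpha> s n (nx j) * exp (B * \<alpha>\<^sup>2 * G j)))
    \<le> pot \<alpha> s n x * exp (B * \<alpha>\<^sup>2 * g) * (1 + (C + 1 + \<sigma> * (B * k)) * \<alpha>\<^sup>2 / real n)
      + 4 * \<alpha>\<^sup>2 * B * (2 * k + E)"
proof -
  let ?X = "pot \<alpha> s n x" and ?\<beta> = "B * \<alpha>\<^sup>2" and ?s = "\<sigma> * k + E * \<theta>"
  let ?r = "- c * \<alpha> * \<theta> * (S \<alpha> s / ?X) + C * \<alpha>\<^sup>2"
  have n1: "1 \<le> real n" using n_pos by simp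
  have Xn: "real n \<le> ?X" by (rule pot_ge)
  hence X0: "0 < ?X" using n1 by linarith
  have aw: "\<alpha> * w \<le> 1" using a w_ge by (simp add: mult.commute)
  have abs_s: "\<bar>s\<bar> = 1" using s by auto
  have "1 * (B * b) \<le> 8 * w * (B * b)" using B w_ge by (intro mult_right_mono) auto
  hence "\<alpha> * (B * b) \<le> \<alpha> * (8 * w * (B * b))" using a by (intro mult_left_mono) auto
  hence aBb: "\<alpha> * (B * b) \<le> 1 / 2" using B by linarith
  have \<beta>b: "?\<beta> * b = \<alpha> * (\<alpha> * (B * b))" by (simp add: power2_eq_square)
  have "\<alpha> * (\<alpha> * (B * b)) \<le> 1 * (1 / 2)" using a aBb B by (intro mult_mono) auto
  hence \<beta>1: "?\<beta> * b \<le> 1" using \<beta>b by linarith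
  \<comment> \<open>The errors of the tilt are of order \<alpha>^3 or smaller; for small \<alpha>
    they fit into one \<alpha>^2, the 1 added to C.\<close>
  have err: "?\<beta> * (8 * w * \<alpha>) * b + 2 * ?\<beta>\<^sup>2 * b\<^sup>2 \<le> \<alpha>\<^sup>2"
  proof -
    have "?\<beta> * (8 * w * \<alpha>) * b = \<alpha>\<^sup>2 * (\<alpha> * (8 * w * (B * b)))" by simp
    also have "\<dots> \<le> \<alpha>\<^sup>2 * (1 / 2)" using B by (intro mult_left_mono) auto
    finally have 1: "?\<beta> * (8 * w * \<alpha>) * b \<le> \<alpha>\<^sup>2 * (1 / 2)" .
    have "(\<alpha> * (B * b))\<^sup>2 \<le> (1 / 2)\<^sup>2" using aBb a B by (intro power_mono) auto
    hence "\<alpha>\<^sup>2 * (\<alpha> * (B * b))\<^sup>2 \<le> \<alpha>\<^sup>2 * (1 / 4)"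
      by (intro mult_left_mono) (auto simp: power2_eq_square)
    moreover have "?\<beta>\<^sup>2 * b\<^sup>2 = \<alpha>\<^sup>2 * (\<alpha> * (B * b))\<^sup>2" by (simp add: power2_eq_square)
    ultimately show ?thesis using 1 by linarith
  qed
  have "(\<Sum>j\<in>{1..n}. p j * (pot \<alpha> s n (nx j) * exp (?\<beta> * G j)))
     \<le> ?X * exp (?\<beta> * g) * (1 + (?r + ?\<beta> * ?s + ?\<beta> * (8 * w * \<alpha>) * b + 2 * ?\<beta>\<^sup>2 * b\<^sup>2) / real n)"
  proof (rule tilt_drift[OF X0 _ _ _ _ _ _ _ G _ EU])
    show "\<bar>pot \<alpha> s n (nx j) - ?X\<bar> \<le> 8 * w * \<alpha> * ?X" if "j \<in> {1..n}" for j
      using pot_diff_bound[OF _ aw abs_s that] a by (simp add: mult_ac)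
    show "0 \<le> pot \<alpha> s n (nx j)" for j using pot_ge[of n \<alpha> s "nx j"] n1 by linarith
    show "(\<Sum>j\<in>{1..n}. p j * pot \<alpha> s n (nx j)) \<le> ?X + ?r * ?X / real n"
    proof -
      have "?r * ?X = - c * \<alpha> * \<theta> * S \<alpha> s + C * \<alpha>\<^sup>2 * ?X" using X0 by (simp add: left_diff_distrib)
      thus ?thesis using EX by (simp add: add_divide_distrib diff_divide_distrib)
    qed
  qed (use a w_ge B \<beta>1 in auto)
  also have "\<dots> \<le> ?X * exp (?\<beta> * g) * (1 + (- c * \<alpha> * \<theta> * (S \<alpha> s / ?X) + (C + 1) * \<alpha>\<^sup>2 + ?\<beta> * ?s) / real n)"
    using X0 n1 err by (intro mult_left_mono add_left_mono divide_right_mono) (auto simp: distrib_right)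
  finally have V': "(\<Sum>j\<in>{1..n}. p j * (pot \<alpha> s n (nx j) * exp (?\<beta> * G j)))
    \<le> ?X * exp (?\<beta> * g) * (1 + (- c * \<alpha> * \<theta> * (S \<alpha> s / ?X) + (C + 1) * \<alpha>\<^sup>2 + ?\<beta> * ?s) / real n)" .
  have XS: "?X \<le> real n + S \<alpha> s"
  proof -
    have "0 \<le> \<alpha> * D" using a by (auto simp: D_def intro!: mult_nonneg_nonneg sum_nonneg)
    thus ?thesis using pot_S[OF s] by simp
  qed
  show ?thesis
    by (rule tilt_rate[OF n1 Xn XS \<theta>(1,2) c_pos a(1) B(1,3,4,5) _ _ \<sigma> V' order_refl])
      (use X0 exp_half_bounds(1)[OF B(7)] in auto)
qed

theorem lyap_drift:
  fixes wp wm k1 :: nat and k2 c :: real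
  assumes wm: "1 \<le> wm" and k2: "0 < k2" "k2 \<le> 1" and c: "0 < c" "c \<le> 1"
  obtains \<alpha> \<beta> \<beta>' lam \<epsilon> \<mu> K N where "0 < \<alpha>" "\<alpha> \<le> 1" "0 \<le> K"
    "\<And>n x. 1 \<le> n \<Longrightarrow> \<bar>\<beta> * over_slack lam \<epsilon> wm n x\<bar> \<le> 1 / 2"
    "\<And>n x. 1 \<le> n \<Longrightarrow> \<bar>\<beta>' * under_slack \<mu> n x\<bar> \<le> 1 / 2"
    "\<And>n x p. N \<le> n \<Longrightarrow> alloc_step n x p wp wm k1 k2 c \<Longrightarrow>
      (\<Sum>j\<in>{1..n}. p j * lyap \<alpha> \<beta> \<beta>' lam \<epsilon> \<mu> wm n (allocate n wp wm x j))
        \<le> (1 - \<alpha>\<^sup>2 / real n) * lyap \<alpha> \<beta> \<beta>' lam \<epsilon> \<mu> wm n x + K"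
proof -
  define v where "v = real wm"
  define C1 where "C1 = 8 * v\<^sup>2 * (real k1 + 2)"
  define C7 where "C7 = 2 * C1 + 52 * v\<^sup>2"
  \<comment> \<open>\<open>Q\<close> is the decay of the tilted potentials that the case D <= L n
    demands, and \<rho> their growth that must then be tolerated when D > L n. There is no circle:
    \<open>B\<close> is normalized so that \<open>B\<close> \<kappa>/2 = C1 + 1 + Q, hence \<rho> is
    free of \<kappa>, \<open>L\<close> is determined by \<rho>, and only then \<kappa> and
    \<open>B\<close> by \<open>L\<close>.\<close>
  define Q where "Q = 4 * C7 + 5"
  define \<rho> where "\<rho> = 2 * (C1 + 1) + Q"
  define L where "L = 4 / c * (C7 + 1 + 4 * (\<rho> + 1))"
  define lam where "lam = 2 * real k1 + 2"
  \<comment> \<open>Chosen with k2 \<mu>/8 = v + 1: since exp(\<mu>/2) - 1 >= \<mu>^2/8, this gives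
    k2 (exp(\<mu>/2) - 1) >= \<mu> (v + 1).\<close>
  define \<mu> where "\<mu> = 8 * (v + 1) / k2"
  define \<kappa> where "\<kappa> = exp (- lam * (4 * L + 1))"
  define \<kappa>' where "\<kappa>' = exp (- \<mu> * (4 * L + 1))"
  define \<epsilon> where "\<epsilon> = \<kappa> / (8 * v)"
  define B where "B = (C1 + 1 + Q) / (\<kappa> / 2)"
  define B' where "B' = (C1 + 1 + Q) / (\<kappa>' / 2)"
  define E where "E = 1 + 1 / \<epsilon>"
  define E' where "E' = \<mu> * v * exp \<mu> + 1"
  define b where "b = lam * v + 2 + v"
  define b' where "b' = exp \<mu> * \<mu> * v + exp \<mu>"
  \<comment> \<open>The sum of all quantities t for which \<alpha> t <= c/2 is required.\<close>
  define M where "M = 1 + 8 * v + 8 * v * (B * b) + 8 * v * (B' * b') + B * 2 + B' * exp \<mu>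
    + B * E + B' * E' + L + (C7 + 1)"
  define \<alpha> where "\<alpha> = c / (2 * M)"
  define K where "K = 4 * \<alpha>\<^sup>2 * B * (2 * (\<kappa> / 2) + E) + 4 * \<alpha>\<^sup>2 * B' * (2 * (\<kappa>' / 2) + E')"
  define N where "N = max (2 * k1) (max (2 * wm) (nat \<lceil>lam / \<epsilon>\<rceil>))"
  have v: "1 \<le> v" using wm by (simp add: v_def)
  have C: "0 \<le> C1" "0 \<le> C7" "0 \<le> Q" "0 \<le> \<rho>" by (auto simp: C1_def C7_def Q_def \<rho>_def)
  have L: "0 < L" using c C by (auto simp: L_def intro!: mult_pos_pos divide_pos_pos)
  have lam: "0 < lam" by (simp add: lam_def add_nonneg_pos)
  have \<mu>: "8 \<le> \<mu>" using v k2 by (simp add: \<mu>_def field_simps)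
  have \<kappa>: "0 < \<kappa>" "0 < \<kappa>'" by (simp_all add: \<kappa>_def \<kappa>'_def)
  have \<epsilon>: "0 < \<epsilon>" using \<kappa> v by (simp add: \<epsilon>_def)
  have B: "0 \<le> B" "0 \<le> B'" using C \<kappa> by (simp_all add: B_def B'_def)
  have E: "0 \<le> E" "0 \<le> E'" using \<epsilon> \<mu> v by (simp_all add: E_def E'_def)
  have b: "0 \<le> b" "0 \<le> b'" using lam v \<mu> by (simp_all add: b_def b'_def)
  have Bk: "B * (\<kappa> / 2) = C1 + 1 + Q" "B' * (\<kappa>' / 2) = C1 + 1 + Q"
    using \<kappa> by (simp_all add: B_def B'_def)
  have nn: "0 \<le> 8 * v" "0 \<le> 8 * v * (B * b)" "0 \<le> 8 * v * (B' * b')" "0 \<le> B * 2" "0 \<le> B' * exp \<mu>"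
    "0 \<le> B * E" "0 \<le> B' * E'" "0 \<le> L" "0 \<le> C7 + 1"
    using v B E b L C by auto
  have M: "1 \<le> M" using nn unfolding M_def by linarith
  have \<alpha>0: "0 < \<alpha>" using c M by (simp add: \<alpha>_def)
  have \<alpha>M: "\<alpha> * t \<le> c / 2" if "t \<le> M" for t
  proof -
    have "\<alpha> * t \<le> \<alpha> * M" using that \<alpha>0 by (intro mult_left_mono) auto
    also have "\<dots> = c / 2" using M by (simp add: \<alpha>_def)
    finally show ?thesis .
  qed
  have \<alpha>: "\<alpha> * 1 \<le> c / 2" "\<alpha> * (8 * v) \<le> c / 2" "\<alpha> * (8 * v * (B * b)) \<le> c / 2"
    "\<alpha> * (8 * v * (B' * b')) \<le> c / 2" "\<alpha> * (B * 2) \<le> c / 2" "\<alpha> * (B' * exp \<mu>) \<le> c / 2"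
    "\<alpha> * (B * E) \<le> c / 2" "\<alpha> * (B' * E') \<le> c / 2" "\<alpha> * L \<le> c / 2" "\<alpha> * (C7 + 1) \<le> c / 2"
    using nn unfolding M_def by (intro \<alpha>M[unfolded M_def], linarith)+
  have \<alpha>1: "\<alpha> \<le> 1" using \<alpha> c by linarith
  have K0: "0 \<le> K" using B E \<kappa> by (simp add: K_def)
  have \<alpha>2: "\<alpha>\<^sup>2 * t \<le> 1 / 2" if "0 \<le> t" "\<alpha> * t \<le> c / 2" for t
  proof -
    have "\<alpha> * (\<alpha> * t) \<le> 1 * (1 / 2)" using that \<alpha>0 \<alpha>1 c by (intro mult_mono) auto
    thus ?thesis by (simp add: power2_eq_square)
  qed
  have slack: "\<bar>B * \<alpha>\<^sup>2 * over_slack lam \<epsilon> wm n x\<bar> \<le> 1 / 2" if "1 \<le> n" for n x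
  proof -
    have "\<kappa> \<le> 1" using lam L by (simp add: \<kappa>_def)
    hence "\<epsilon> \<le> 1" using v by (simp add: \<epsilon>_def)
    hence "\<bar>over_slack lam \<epsilon> wm n x\<bar> \<le> 2" using that lam \<epsilon> by (intro abs_over_slack_le) auto
    hence "B * \<alpha>\<^sup>2 * \<bar>over_slack lam \<epsilon> wm n x\<bar> \<le> B * \<alpha>\<^sup>2 * 2" using B by (intro mult_left_mono) auto
    also have "\<dots> = \<alpha>\<^sup>2 * (B * 2)" by simp
    also have "\<dots> \<le> 1 / 2" using nn \<alpha> by (intro \<alpha>2)
    finally show ?thesis using B by (simp add: abs_mult)
  qed
  have slack': "\<bar>B' * \<alpha>\<^sup>2 * under_slack \<mu> n x\<bar> \<le> 1 / 2" if "1 \<le> n" for n x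
  proof -
    have "\<bar>under_slack \<mu> n x\<bar> \<le> exp \<mu>" using that \<mu> by (intro abs_under_slack_le) auto
    hence "B' * \<alpha>\<^sup>2 * \<bar>under_slack \<mu> n x\<bar> \<le> B' * \<alpha>\<^sup>2 * exp \<mu>" using B by (intro mult_left_mono) auto
    also have "\<dots> = \<alpha>\<^sup>2 * (B' * exp \<mu>)" by simp
    also have "\<dots> \<le> 1 / 2" using nn \<alpha> by (intro \<alpha>2)
    finally show ?thesis using B by (simp add: abs_mult)
  qed
  have \<mu>k: "\<mu> * v + 1 \<le> k2 * (exp (\<mu> / 2) - 1)"
  proof -
    have "1 + \<mu> / 2 + (\<mu> / 2)\<^sup>2 / 2 \<le> exp (\<mu> / 2)" using \<mu> by (intro exp_lower_Taylor_quadratic) auto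
    hence "\<mu> * \<mu> / 8 \<le> exp (\<mu> / 2) - 1" using \<mu> by (simp add: power2_eq_square)
    hence "k2 * (\<mu> * \<mu> / 8) \<le> k2 * (exp (\<mu> / 2) - 1)" using k2 by (intro mult_left_mono) auto
    moreover have "k2 * (\<mu> * \<mu> / 8) = \<mu> * (v + 1)" using k2 by (simp add: \<mu>_def field_simps)
    ultimately show ?thesis using \<mu> unfolding distrib_left mult_1_right by linarith
  qed
  have main: "(\<Sum>j\<in>{1..n}. p j * lyap \<alpha> (B * \<alpha>\<^sup>2) (B' * \<alpha>\<^sup>2) lam \<epsilon> \<mu> wm n (allocate n wp wm x j))
        \<le> (1 - \<alpha>\<^sup>2 / real n) * lyap \<alpha> (B * \<alpha>\<^sup>2) (B' * \<alpha>\<^sup>2) lam \<epsilon> \<mu> wm n x + K"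
    if N: "N \<le> n" and st: "alloc_step n x p wp wm k1 k2 c" for n x p
  proof -
    interpret alloc_step n x p wp wm k1 k2 c by (rule st)
    have ww: "w = v" by (simp add: w_def v_def)
    have n: "2 * k1 \<le> n" "2 * wm \<le> n" "wm \<le> n" using N by (auto simp: N_def)
    have "lam / \<epsilon> \<le> real n" using N by (simp add: N_def nat_le_iff ceiling_le_iff)
    hence n\<epsilon>: "lam \<le> \<epsilon> * real n" using \<epsilon> by (simp add: field_simps)
    have n1: "1 \<le> real n" using n_pos by simp
    have aw: "\<alpha> * v \<le> 1"
    proof -
      have "\<alpha> * v \<le> \<alpha> * (8 * v)" using \<alpha>0 v by (intro mult_left_mono) auto
      thus ?thesis using \<alpha> c by linarith
    qed
    have aw8: "8 * v * \<alpha> \<le> 1" using \<alpha> c by (simp add: mult.commute)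
    have half: "c / 2 \<le> 1 / 2" using c by simp
    let ?X = "pot \<alpha> 1 n x" and ?Y = "pot \<alpha> (-1) n x"
    define V1 where "V1 = ?X * exp (B * \<alpha>\<^sup>2 * over_slack lam \<epsilon> wm n x)"
    define V2 where "V2 = ?Y * exp (B' * \<alpha>\<^sup>2 * under_slack \<mu> n x)"
    define V1' where "V1' = (\<Sum>j\<in>{1..n}. p j * (pot \<alpha> 1 n (nx j) * exp (B * \<alpha>\<^sup>2 * over_slack lam \<epsilon> wm n (nx j))))"
    define V2' where "V2' = (\<Sum>j\<in>{1..n}. p j * (pot \<alpha> (-1) n (nx j) * exp (B' * \<alpha>\<^sup>2 * under_slack \<mu> n (nx j))))"
    define V3' where "V3' = (\<Sum>j\<in>{1..n}. p j * (pot \<alpha> 1 n (nx j) * pot \<alpha> (-1) n (nx j) / real n))"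
    define K1 where "K1 = 4 * \<alpha>\<^sup>2 * B * (2 * (\<kappa> / 2) + E)"
    define K2 where "K2 = 4 * \<alpha>\<^sup>2 * B' * (2 * (\<kappa>' / 2) + E')"
    have X: "real n \<le> ?X" "real n \<le> ?Y" by (rule pot_ge)+
    have D0: "0 \<le> \<alpha> * D" using \<alpha>0 by (auto simp: D_def intro!: mult_nonneg_nonneg sum_nonneg)
    have XS: "?X \<le> real n + S \<alpha> 1" "?Y \<le> real n + S \<alpha> (-1)"
      using pot_S[of 1 \<alpha>] pot_S[of "-1" \<alpha>] D0 by simp_all
    have Vb: "0 \<le> V1" "V1 \<le> 2 * ?X" "?X \<le> 2 * V1" "0 \<le> V2" "V2 \<le> 2 * ?Y" "?Y \<le> 2 * V2"
    proof -
      note e = exp_half_bounds[OF slack[OF n_pos, of x]] exp_half_bounds[OF slack'[OF n_pos, of x]]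
      have X0: "0 \<le> ?X" "0 \<le> ?Y" using X n1 by linarith+
      show "0 \<le> V1" "0 \<le> V2" using X0 by (simp_all add: V1_def V2_def)
      show "V1 \<le> 2 * ?X" "V2 \<le> 2 * ?Y"
        using mult_left_mono[OF e(1) X0(1)] mult_left_mono[OF e(3) X0(2)] by (simp_all add: V1_def V2_def mult.commute)
      show "?X \<le> 2 * V1" "?Y \<le> 2 * V2"
        using mult_left_mono[OF e(2) X0(1)] mult_left_mono[OF e(4) X0(2)] by (simp_all add: V1_def V2_def)
    qed
    have V3: "V3' \<le> ?X * ?Y / real n * (1 + (- c * \<alpha> * (1 - \<delta>) * (S \<alpha> 1 / ?X) - c * \<alpha> * \<delta> * (S \<alpha> (-1) / ?Y)
         + C7 * \<alpha>\<^sup>2) / real n)"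
      using prod_drift[of \<alpha>] \<alpha>0 aw unfolding V3'_def C7_def C1_def ww by simp
    obtain U where U:
      "\<And>j. j \<in> {1..n} \<Longrightarrow> over_slack lam \<epsilon> wm n (nx j) \<le> over_slack lam \<epsilon> wm n x + U j"
      "\<And>j. j \<in> {1..n} \<Longrightarrow> \<bar>U j\<bar> \<le> b / real n"
      "real n * (\<Sum>j\<in>{1..n}. p j * U j) \<le> \<kappa> / 2 + E * (1 - \<delta>)"
      "D \<le> L * real n \<Longrightarrow> real n * (\<Sum>j\<in>{1..n}. p j * U j) \<le> - \<kappa> / 2 + E * (1 - \<delta>)"
      using over_slack_bounds[OF lam_def L \<kappa>_def, of \<epsilon>] n n\<epsilon> unfolding ww \<epsilon>_def b_def E_def by blast
    obtain U' where U':
      "\<And>j. j \<in> {1..n} \<Longrightarrow> under_slack \<mu> n (nx j) \<le> under_slack \<mu> n x + U' j"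
      "\<And>j. j \<in> {1..n} \<Longrightarrow> \<bar>U' j\<bar> \<le> b' / real n"
      "real n * (\<Sum>j\<in>{1..n}. p j * U' j) \<le> \<kappa>' / 2 + E' * \<delta>"
      "D \<le> L * real n \<Longrightarrow> real n * (\<Sum>j\<in>{1..n}. p j * U' j) \<le> - \<kappa>' / 2 + E' * \<delta>"
      using under_slack_bounds[OF _ _ n(2) L \<kappa>'_def] \<mu> \<mu>k unfolding ww b'_def E'_def by auto
    have T1: "V1' \<le> V1 * (1 + (C1 + 1 + \<sigma> * (B * (\<kappa> / 2))) * \<alpha>\<^sup>2 / real n) + K1"
      if "real n * (\<Sum>j\<in>{1..n}. p j * U j) \<le> \<sigma> * (\<kappa> / 2) + E * (1 - \<delta>)" "\<bar>\<sigma>\<bar> \<le> 1" for \<sigma>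
      unfolding V1'_def V1_def K1_def
      by (rule tilted_pot_drift[OF _ \<alpha>0 \<alpha>1 _ _ _ C(1) _ B(1) b(1) _ E(1) \<alpha>(7) _ slack[OF n_pos] U(1,2) that])
        (use \<alpha>0 aw8 \<delta>_bounds \<kappa> \<alpha>(3) half aw over_pot_drift[of \<alpha>] in \<open>auto simp: ww C1_def\<close>)
    have T2: "V2' \<le> V2 * (1 + (C1 + 1 + \<sigma> * (B' * (\<kappa>' / 2))) * \<alpha>\<^sup>2 / real n) + K2"
      if "real n * (\<Sum>j\<in>{1..n}. p j * U' j) \<le> \<sigma> * (\<kappa>' / 2) + E' * \<delta>" "\<bar>\<sigma>\<bar> \<le> 1" for \<sigma>
      unfolding V2'_def V2_def K2_def
      by (rule tilted_pot_drift[OF _ \<alpha>0 \<alpha>1 _ _ _ C(1) _ B(2) b(2) _ E(2) \<alpha>(8) _ slack'[OF n_pos] U'(1,2) that])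
        (use \<alpha>0 aw8 \<delta>_bounds \<kappa> \<alpha>(4) half aw under_pot_drift[of \<alpha>] in \<open>auto simp: ww C1_def\<close>)
    have e1: "C1 + 1 + - 1 * (B * (\<kappa> / 2)) = - (4 * C7 + 5)" "C1 + 1 + - 1 * (B' * (\<kappa>' / 2)) = - (4 * C7 + 5)"
      unfolding Bk by (simp_all add: Q_def)
    have e2: "C1 + 1 + 1 * (B * (\<kappa> / 2)) = \<rho>" "C1 + 1 + 1 * (B' * (\<kappa>' / 2)) = \<rho>"
      unfolding Bk by (simp_all add: \<rho>_def)
    have "V3' + V1' + V2' \<le> (1 - \<alpha>\<^sup>2 / real n) * (?X * ?Y / real n + V1 + V2) + (K1 + K2)"
    proof (cases "D \<le> L * real n")
      case True
      have "V1' \<le> V1 * (1 + - (4 * C7 + 5) * \<alpha>\<^sup>2 / real n) + K1"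
        using T1[of "-1", unfolded e1] U(4)[OF True] by simp
      moreover have "V2' \<le> V2 * (1 + - (4 * C7 + 5) * \<alpha>\<^sup>2 / real n) + K2"
        using T2[of "-1", unfolded e1] U'(4)[OF True] by simp
      ultimately show ?thesis
        by (intro lyapunov_near[OF n1 X(1) XS(1) X(2) XS(2) \<alpha>0 \<alpha>(10) C(2) \<delta>_bounds c(1) refl Vb(1,3,4,6) V3])
    next
      case False
      have SL: "\<alpha> * L * real n \<le> S \<alpha> s" if "s = 1 \<or> s = -1" for s
      proof -
        have "\<alpha> * (L * real n) \<le> \<alpha> * D" using False \<alpha>0 by (intro mult_left_mono) auto
        thus ?thesis using S_ge[OF that, of \<alpha>] by (simp add: mult.assoc)
      qed
      have "V1' \<le> V1 * (1 + \<rho> * \<alpha>\<^sup>2 / real n) + K1"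
        using T1[of 1, unfolded e2] U(3) by simp
      moreover have "V2' \<le> V2 * (1 + \<rho> * \<alpha>\<^sup>2 / real n) + K2"
        using T2[of 1, unfolded e2] U'(3) by simp
      moreover have "c * L / 4 = C7 + 1 + 4 * (\<rho> + 1)" using c by (simp add: L_def)
      moreover have "\<alpha> * L \<le> 1" using \<alpha> c by linarith
      ultimately show ?thesis
        using SL L by (intro lyapunov_far[OF n1 X(1) XS(1) X(2) XS(2) _ _ \<alpha>0 _ _ \<delta>_bounds c(1) C(4) _ Vb(1,2,4,5) V3]) auto
    qed
    moreover have "(\<Sum>j\<in>{1..n}. p j * lyap \<alpha> (B * \<alpha>\<^sup>2) (B' * \<alpha>\<^sup>2) lam \<epsilon> \<mu> wm n (allocate n wp wm x j)) = V3' + V1' + V2'"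
      unfolding V1'_def V2'_def V3'_def by (simp only: lyap_def nx_def distrib_left sum.distrib)
    moreover have "lyap \<alpha> (B * \<alpha>\<^sup>2) (B' * \<alpha>\<^sup>2) lam \<epsilon> \<mu> wm n x = ?X * ?Y / real n + V1 + V2"
      by (simp add: lyap_def V1_def V2_def)
    moreover have "K = K1 + K2" by (simp add: K_def K1_def K2_def)
    ultimately show ?thesis by simp
  qed
  show thesis by (rule that[OF \<alpha>0 \<alpha>1 K0 slack slack' main])
qed

section \<open>From the conditions to one allocation step\<close>

text \<open>Summation by parts. The induction keeps the k-th partial sum times \<open>a k\<close> as
  a lower bound; passing to the smaller weight \<open>a (Suc k)\<close> only decreases it because
  the partial sum is nonnegative.\<close>

lemma abel_sum_nonneg:
  fixes a b :: "nat \<Rightarrow> real"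
  assumes "\<And>k. k \<le> m \<Longrightarrow> 0 \<le> (\<Sum>j\<in>{1..k}. b j)"
    and "\<And>i j. 1 \<le> i \<Longrightarrow> i \<le> j \<Longrightarrow> j \<le> m \<Longrightarrow> a j \<le> a i" and "\<And>j. 0 \<le> a j"
  shows "0 \<le> (\<Sum>j\<in>{1..m}. a j * b j)"
proof -
  have "k \<le> m \<Longrightarrow> a k * (\<Sum>j\<in>{1..k}. b j) \<le> (\<Sum>j\<in>{1..k}. a j * b j)" for k
  proof (induction k)
    case (Suc k)
    \<comment> \<open>The case k = 0 is separate because the monotonicity of \<open>a\<close> starts
      at index 1.\<close>
    show ?case
    proof (cases "k = 0")
      case False
      have "a (Suc k) * (\<Sum>j\<in>{1..k}. b j) \<le> a k * (\<Sum>j\<in>{1..k}. b j)"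
        using Suc.prems False assms by (intro mult_right_mono) auto
      thus ?thesis using Suc by (simp add: distrib_left)
    qed (simp add: One_nat_def)
  qed simp
  from this[of m] show ?thesis
    using assms(1)[of m] assms(3)[of m] by (meson mult_nonneg_nonneg order_refl order_trans)
qed

lemma sum_mult_diff:
  fixes f g :: "nat \<Rightarrow> real"
  shows "(\<Sum>j\<in>J. f j * (q - g j)) = q * (\<Sum>j\<in>J. f j) - (\<Sum>j\<in>J. f j * g j)"
    and "(\<Sum>j\<in>J. f j * (g j - q)) = (\<Sum>j\<in>J. f j * g j) - q * (\<Sum>j\<in>J. f j)"
  by (simp_all add: sum_distrib_left right_diff_distrib sum_subtractf mult.commute)

lemma sum_rev_shift:
  fixes f :: "nat \<Rightarrow> real"
  shows "k \<le> n \<Longrightarrow> (\<Sum>j\<in>{1..k}. f (Suc n - j)) = (\<Sum>j\<in>{Suc (n - k)..n}. f j)"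
  by (rule sum.reindex_bij_witness[of _ "\<lambda>j. Suc n - j" "\<lambda>j. Suc n - j"]) auto

lemma sum_list_take_replicate: "k \<le> m \<Longrightarrow> sum_list (take k (replicate m q)) = real k * q"
  by (simp add: sum_list_replicate)

lemma sum_list_take_upt:
  fixes p :: "nat \<Rightarrow> real"
  assumes "k \<le> m"
  shows "sum_list (take k (map p [1..<Suc m])) = (\<Sum>j\<in>{1..k}. p j)"
proof -
  have "take k [1..<Suc m] = [1..<Suc k]" using assms by (simp add: take_upt One_nat_def del: upt_Suc)
  thus ?thesis
    by (simp only: take_map interv_sum_list_conv_sum_set_nat set_upt atLeastLessThanSuc_atLeastAtMost)
qed

lemma sum_list_take_rev_upt:
  fixes p :: "nat \<Rightarrow> real"
  assumes "k \<le> n - m"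
  shows "sum_list (take k (map p (rev [Suc m..<Suc n]))) = (\<Sum>j\<in>{Suc (n - k)..n}. p j)"
proof -
  have "take k (rev [Suc m..<Suc n]) = rev [Suc (n - k)..<Suc n]"
  proof (cases "m \<le> n")
    case True
    hence "m + (n - (m + k)) = n - k" using assms by linarith
    thus ?thesis using assms True by (simp add: take_rev drop_upt del: upt_Suc)
  qed (use assms in simp)
  hence "take k (map p (rev [Suc m..<Suc n])) = rev (map p [Suc (n - k)..<Suc n])"
    by (simp only: take_map rev_map)
  thus ?thesis
    by (simp only: sum_list_rev interv_sum_list_conv_sum_set_nat set_upt atLeastLessThanSuc_atLeastAtMost)
qed

lemma dominates_overD:
  assumes "dominates (replicate m q) (map p [1..<Suc m])" "k \<le> m"
  shows "(\<Sum>j\<in>{1..k}. p j) \<le> real k * q"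
  using assms unfolding dominates_def
  by (metis length_replicate sum_list_take_replicate sum_list_take_upt)

lemma dominates_underD:
  assumes "dominates (map p (rev [Suc m..<Suc n])) (replicate u q)" "k \<le> n - m" "u = n - m"
  shows "real k * q \<le> (\<Sum>j\<in>{Suc (n - k)..n}. p j)"
  using assms unfolding dominates_def
  by (metis length_replicate sum_list_take_replicate sum_list_take_rev_upt)

text \<open>\<open>qo\<close> and \<open>qu\<close> are the constant entries of the comparison
  vectors and W is the mean number of balls per allocation, so \<open>rates\<close> is a scalar
  condition that summation by parts extends to monotone weights. The guard m < n matters because
  \<open>qu\<close> may be a quotient by n - m.\<close>

lemma alloc_stepI:
  fixes n m :: nat and x :: "nat \<Rightarrow> nat"
  assumes n: "1 \<le> n" and p: "\<And>j. j \<in> {1..n} \<Longrightarrow> 0 \<le> p j" "(\<Sum>j\<in>{1..n}. p j) = 1"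
    and w: "1 \<le> wp" "wp \<le> wm" and c: "0 < c" "c \<le> 1" "0 < k2"
    and x: "\<And>i j. i \<in> {1..n} \<Longrightarrow> j \<in> {1..n} \<Longrightarrow> i \<le> j \<Longrightarrow> x j \<le> x i"
    and m: "{j\<in>{1..n}. 0 \<le> dev n x j} = {1..m}" "m \<le> n"
    and po: "\<And>j. j \<in> {1..m} \<Longrightarrow> p j \<le> real k1 / real n"
    and pu: "\<And>j. j \<in> {Suc m..n} \<Longrightarrow> k2 / real n \<le> p j"
    and qo: "\<And>k. k \<le> m \<Longrightarrow> (\<Sum>j\<in>{1..k}. p j) \<le> real k * qo"
    and qu: "\<And>k. k \<le> n - m \<Longrightarrow> real k * qu \<le> (\<Sum>j\<in>{Suc (n - k)..n}. p j)"
    and rates: "\<And>W. W = real wp + (real wm - real wp) * (\<Sum>j\<in>{Suc m..n}. p j) \<Longrightarrow>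
      real wp * qo \<le> (W - c * (1 - real m / real n)) / real n \<and>
      (m < n \<longrightarrow> (W + c * (real m / real n)) / real n \<le> real wm * qu)"
  shows "alloc_step n x p wp wm k1 k2 c"
proof -
  let ?W = "\<Sum>j\<in>{1..n}. p j * real (weight n wp wm x j)"
  have dev: "0 \<le> dev n x j \<longleftrightarrow> j \<le> m" if "j \<in> {1..n}" for j
    using that m(1) by (auto simp: set_eq_iff)
  have light: "{j\<in>{1..n}. dev n x j < 0} = {Suc m..n}"
  proof -
    have "dev n x j < 0 \<longleftrightarrow> m < j" if "j \<in> {1..n}" for j using dev[OF that] by linarith
    thus ?thesis by auto
  qed
  have split: "(\<Sum>j\<in>{1..n}. f j) = (\<Sum>j\<in>{1..m}. f j) + (\<Sum>j\<in>{Suc m..n}. f j)" for f :: "nat \<Rightarrow> real"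
    using m(2) sum.ub_add_nat[of 1 m f "n - m"] unfolding Suc_eq_plus1 by simp
  have W: "?W = real wp + (real wm - real wp) * (\<Sum>j\<in>{Suc m..n}. p j)"
  proof -
    have "(\<Sum>j\<in>{1..m}. p j * real (weight n wp wm x j)) = (\<Sum>j\<in>{1..m}. p j * real wp)"
      using dev m(2) by (intro sum.cong) (auto simp: weight_def not_less[symmetric])
    moreover have "(\<Sum>j\<in>{Suc m..n}. p j * real (weight n wp wm x j)) = (\<Sum>j\<in>{Suc m..n}. p j * real wm)"
      using light by (intro sum.cong) (auto simp: weight_def set_eq_iff)
    moreover have "(\<Sum>j\<in>{1..m}. p j) = 1 - (\<Sum>j\<in>{Suc m..n}. p j)" using split[of p] p(2) by simp
    ultimately show ?thesis
      unfolding sum_distrib_right[symmetric] split[of "\<lambda>j. p j * real (weight n wp wm x j)"]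
      by (simp add: algebra_simps)
  qed
  note r = rates[OF W]
  show ?thesis
  proof
    fix \<phi> :: "real \<Rightarrow> real" assume \<phi>: "mono \<phi>" "\<And>z. 0 \<le> \<phi> z"
    have "0 \<le> (\<Sum>j\<in>{1..m}. \<phi> (dev n x j) * (qo - p j))"
    proof (rule abel_sum_nonneg)
      show "0 \<le> (\<Sum>j\<in>{1..k}. qo - p j)" if "k \<le> m" for k using qo[OF that] by (simp add: sum_subtractf)
      show "\<phi> (dev n x j) \<le> \<phi> (dev n x i)" if "1 \<le> i" "i \<le> j" "j \<le> m" for i j
        using that m(2) x[of i j] by (intro monoD[OF \<phi>(1)]) (auto simp: dev_def)
    qed (rule \<phi>(2))
    hence "(\<Sum>j\<in>{1..m}. \<phi> (dev n x j) * p j) \<le> qo * (\<Sum>j\<in>{1..m}. \<phi> (dev n x j))"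
      by (simp add: sum_mult_diff)
    hence "real wp * (\<Sum>j\<in>{1..m}. \<phi> (dev n x j) * p j) \<le> real wp * qo * (\<Sum>j\<in>{1..m}. \<phi> (dev n x j))"
      by (simp add: mult_left_mono mult.assoc)
    also have "\<dots> \<le> (?W - c * (1 - real m / real n)) / real n * (\<Sum>j\<in>{1..m}. \<phi> (dev n x j))"
      using r \<phi>(2) by (intro mult_right_mono sum_nonneg) auto
    finally show "real wp * (\<Sum>j\<in>{j\<in>{1..n}. 0 \<le> dev n x j}. \<phi> (dev n x j) * p j)
       \<le> (?W - c * (1 - real (card {j\<in>{1..n}. 0 \<le> dev n x j}) / real n)) / real n
          * (\<Sum>j\<in>{j\<in>{1..n}. 0 \<le> dev n x j}. \<phi> (dev n x j))" by (simp only: m(1) card_atLeastAtMost) simp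
  next
    fix \<phi> :: "real \<Rightarrow> real" assume \<phi>: "antimono \<phi>" "\<And>z. 0 \<le> \<phi> z"
    have "0 \<le> (\<Sum>j\<in>{1..n - m}. \<phi> (dev n x (Suc n - j)) * (p (Suc n - j) - qu))"
    proof (rule abel_sum_nonneg)
      show "0 \<le> (\<Sum>j\<in>{1..k}. p (Suc n - j) - qu)" if "k \<le> n - m" for k
        using qu[OF that] sum_rev_shift[of k n p] that by (simp add: sum_subtractf)
      show "\<phi> (dev n x (Suc n - j)) \<le> \<phi> (dev n x (Suc n - i))" if "1 \<le> i" "i \<le> j" "j \<le> n - m" for i j
        using that m(2) x[of "Suc n - j" "Suc n - i"]
        by (intro antimonoD[OF \<phi>(1)]) (auto simp: dev_def)
    qed (rule \<phi>(2))
    also have "\<dots> = (\<Sum>j\<in>{Suc m..n}. \<phi> (dev n x j) * (p j - qu))"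
      using sum_rev_shift[of "n - m" n "\<lambda>j. \<phi> (dev n x j) * (p j - qu)"] m(2) by simp
    finally have "qu * (\<Sum>j\<in>{Suc m..n}. \<phi> (dev n x j)) \<le> (\<Sum>j\<in>{Suc m..n}. \<phi> (dev n x j) * p j)"
      by (simp add: sum_mult_diff)
    hence "real wm * qu * (\<Sum>j\<in>{Suc m..n}. \<phi> (dev n x j)) \<le> real wm * (\<Sum>j\<in>{Suc m..n}. \<phi> (dev n x j) * p j)"
      by (simp add: mult_left_mono mult.assoc)
    moreover have "(?W + c * (real m / real n)) / real n * (\<Sum>j\<in>{Suc m..n}. \<phi> (dev n x j))
        \<le> real wm * qu * (\<Sum>j\<in>{Suc m..n}. \<phi> (dev n x j))"
    proof (cases "m < n")
      case True
      thus ?thesis using r \<phi>(2) by (intro mult_right_mono sum_nonneg) auto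
    qed simp
    ultimately show "(?W + c * (real (card {j\<in>{1..n}. 0 \<le> dev n x j}) / real n)) / real n
          * (\<Sum>j\<in>{j\<in>{1..n}. dev n x j < 0}. \<phi> (dev n x j))
       \<le> real wm * (\<Sum>j\<in>{j\<in>{1..n}. dev n x j < 0}. \<phi> (dev n x j) * p j)"
      by (simp only: m(1) light card_atLeastAtMost) simp
  next
    fix j assume j: "j \<in> {1..n}"
    show "p j \<le> real k1 / real n" if "0 \<le> dev n x j" using po[of j] dev[OF j] that j by simp
    show "k2 / real n \<le> p j" if "dev n x j < 0" using pu[of j] dev[OF j] that j by simp
  qed (use n p w c in auto)
qed

text \<open>wp <= W <= wm gives both rate inequalities without surplus. The surplus comes from k3
  and k4, which appear multiplied by weights of at least 1.\<close>

lemma alloc_step_P2_W1: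
  fixes n m :: nat and x :: "nat \<Rightarrow> nat"
  assumes n: "1 \<le> n" and p: "\<And>j. j \<in> {1..n} \<Longrightarrow> 0 \<le> p j" "(\<Sum>j\<in>{1..n}. p j) = 1"
    and w: "1 \<le> wp" "wp \<le> wm" and k: "0 < k2" "0 < k3" "k3 \<le> 1" "0 < k4" "k4 \<le> 1"
    and x: "\<And>i j. i \<in> {1..n} \<Longrightarrow> j \<in> {1..n} \<Longrightarrow> i \<le> j \<Longrightarrow> x j \<le> x i"
    and m: "{j\<in>{1..n}. 0 \<le> dev n x j} = {1..m}" "m \<le> n"
    and po: "\<And>j. j \<in> {1..m} \<Longrightarrow> p j \<le> real k1 / real n"
    and pu: "\<And>j. j \<in> {Suc m..n} \<Longrightarrow> k2 / real n \<le> p j"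
    and qo: "\<And>k. k \<le> m \<Longrightarrow> (\<Sum>j\<in>{1..k}. p j) \<le> real k * (1 / real n - k3 * (1 - real m / real n) / real n)"
    and qu: "\<And>k. k \<le> n - m \<Longrightarrow>
      real k * (1 / real n + k4 * (real m / real n) / real n) \<le> (\<Sum>j\<in>{Suc (n - k)..n}. p j)"
  shows "alloc_step n x p wp wm k1 k2 (min k3 k4)"
proof (rule alloc_stepI[OF n p w _ _ k(1) x m po pu qo qu])
  fix W :: real
  assume W: "W = real wp + (real wm - real wp) * (\<Sum>j\<in>{Suc m..n}. p j)"
  define d where "d = real m / real n"
  have n0: "0 < real n" using n by simp
  have d: "0 \<le> d" "d \<le> 1" using m(2) n0 by (auto simp: d_def)
  have P: "0 \<le> (\<Sum>j\<in>{Suc m..n}. p j)" "(\<Sum>j\<in>{Suc m..n}. p j) \<le> 1"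
  proof -
    show "0 \<le> (\<Sum>j\<in>{Suc m..n}. p j)" using p(1) by (intro sum_nonneg) auto
    have "(\<Sum>j\<in>{Suc m..n}. p j) \<le> (\<Sum>j\<in>{1..n}. p j)" using p(1) by (intro sum_mono2) auto
    thus "(\<Sum>j\<in>{Suc m..n}. p j) \<le> 1" using p(2) by simp
  qed
  have w': "1 \<le> real wp" "real wp \<le> real wm" using w by auto
  have W1: "real wp \<le> W" using w' P by (simp add: W)
  have "(real wm - real wp) * (\<Sum>j\<in>{Suc m..n}. p j) \<le> (real wm - real wp) * 1"
    using w' P by (intro mult_left_mono) auto
  hence W2: "W \<le> real wm" by (simp add: W)
  have "min k3 k4 * (1 - d) \<le> real wp * k3 * (1 - d)"
  proof (rule mult_right_mono)
    have "1 * k3 \<le> real wp * k3" using w' k by (intro mult_right_mono) auto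
    thus "min k3 k4 \<le> real wp * k3" by linarith
  qed (use d in simp)
  hence "real wp * (1 - k3 * (1 - d)) \<le> W - min k3 k4 * (1 - d)" using W1 by (simp add: algebra_simps)
  from divide_right_mono[OF this, of "real n"]
  have 1: "real wp * (1 / real n - k3 * (1 - d) / real n) \<le> (W - min k3 k4 * (1 - d)) / real n"
    by (simp add: diff_divide_distrib right_diff_distrib)
  have "min k3 k4 * d \<le> real wm * k4 * d"
  proof (rule mult_right_mono)
    have "1 * k4 \<le> real wm * k4" using w' k by (intro mult_right_mono) auto
    thus "min k3 k4 \<le> real wm * k4" by linarith
  qed (use d in simp)
  hence "W + min k3 k4 * d \<le> real wm * (1 + k4 * d)" using W2 by (simp add: algebra_simps)
  from divide_right_mono[OF this, of "real n"]
  have "(W + min k3 k4 * d) / real n \<le> real wm * (1 / real n + k4 * d / real n)"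
    by (simp add: add_divide_distrib distrib_left)
  with 1 show "real wp * (1 / real n - k3 * (1 - real m / real n) / real n) \<le> (W - min k3 k4 * (1 - real m / real n)) / real n \<and>
      (m < n \<longrightarrow> (W + min k3 k4 * (real m / real n)) / real n \<le> real wm * (1 / real n + k4 * (real m / real n) / real n))"
    by (simp add: d_def)
qed (use k in auto)

text \<open>The surplus comes from the weights. With \<theta> = 1 - m/n the conditions give P >=
  \<theta>, so W exceeds wp by at least \<theta>, which settles the overloaded bins. For the
  underloaded ones the lower bound 1/n is too weak, as W may come close to wm when P is large; the
  average P/(n - m) grows along with W.\<close>

lemma alloc_step_P1_W2:
  fixes n m :: nat and x :: "nat \<Rightarrow> nat"
  assumes n: "1 \<le> n" and p: "\<And>j. j \<in> {1..n} \<Longrightarrow> 0 \<le> p j" "(\<Sum>j\<in>{1..n}. p j) = 1"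
    and w: "1 \<le> wp" "wp < wm" and k: "0 < k2"
    and x: "\<And>i j. i \<in> {1..n} \<Longrightarrow> j \<in> {1..n} \<Longrightarrow> i \<le> j \<Longrightarrow> x j \<le> x i"
    and m: "{j\<in>{1..n}. 0 \<le> dev n x j} = {1..m}" "m \<le> n"
    and po: "\<And>j. j \<in> {1..m} \<Longrightarrow> p j \<le> real k1 / real n"
    and pu: "\<And>j. j \<in> {Suc m..n} \<Longrightarrow> k2 / real n \<le> p j"
    and qo: "\<And>k. k \<le> m \<Longrightarrow> (\<Sum>j\<in>{1..k}. p j) \<le> real k * (1 / real n)"
    and qu1: "\<And>k. k \<le> n - m \<Longrightarrow> real k * (1 / real n) \<le> (\<Sum>j\<in>{Suc (n - k)..n}. p j)"
    and qu: "\<And>k. k \<le> n - m \<Longrightarrow>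
      real k * ((\<Sum>j\<in>{Suc m..n}. p j) / real (n - m)) \<le> (\<Sum>j\<in>{Suc (n - k)..n}. p j)"
  shows "alloc_step n x p wp wm k1 k2 1"
proof (rule alloc_stepI[OF n p w(1) _ _ _ k(1) x m po pu qo qu])
  fix W :: real
  define P where "P = (\<Sum>j\<in>{Suc m..n}. p j)"
  assume "W = real wp + (real wm - real wp) * (\<Sum>j\<in>{Suc m..n}. p j)"
  hence W: "W = real wp + (real wm - real wp) * P" by (simp add: P_def)
  define \<theta> where "\<theta> = 1 - real m / real n"
  have n0: "0 < real n" using n by simp
  have \<theta>n: "real (n - m) = \<theta> * real n" using m(2) n0 by (simp add: \<theta>_def algebra_simps of_nat_diff)
  have \<theta>: "0 \<le> \<theta>" "\<theta> \<le> 1" using m(2) n0 by (auto simp: \<theta>_def)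
  have P\<theta>: "\<theta> \<le> P"
    using qu1[of "n - m"] m(2) n0 by (simp add: P_def \<theta>n)
  have gap: "1 \<le> real wm - real wp" using w by linarith
  have "1 * \<theta> \<le> (real wm - real wp) * P" using gap P\<theta> \<theta> by (intro mult_mono) auto
  hence 1: "real wp * (1 / real n) \<le> (W - 1 * \<theta>) / real n" using n0 by (simp add: W divide_right_mono)
  have 2: "(W + 1 * (real m / real n)) / real n \<le> real wm * (P / real (n - m))" if "m < n"
  proof -
    have \<theta>0: "0 < \<theta>" using that n0 by (simp add: \<theta>_def)
    \<comment> \<open>wm P - \<theta> W = P (wm - \<theta> (wm - wp)) - \<theta> wp, so once the
      coefficient of P is nonnegative, P may be replaced by its lower bound \<theta>.\<close>
    have "real wm - \<theta> * (real wm - real wp) = (1 - \<theta>) * (real wm - real wp) + real wp"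
      by (simp add: algebra_simps)
    hence co: "0 \<le> real wm - \<theta> * (real wm - real wp)" using \<theta> gap by simp
    have "(1 - \<theta>) * 1 \<le> (1 - \<theta>) * (real wm - real wp)" using \<theta> gap by (intro mult_left_mono) auto
    from mult_left_mono[OF this \<theta>(1)]
    have "\<theta> * ((1 - \<theta>) * 1) \<le> \<theta> * ((1 - \<theta>) * (real wm - real wp))" .
    moreover have "\<theta> * (real wm - \<theta> * (real wm - real wp)) \<le> P * (real wm - \<theta> * (real wm - real wp))"
      using co P\<theta> by (intro mult_right_mono)
    ultimately have "\<theta> * (W + (1 - \<theta>)) \<le> real wm * P" by (simp add: W algebra_simps)
    hence "W + (1 - \<theta>) \<le> real wm * P / \<theta>" using \<theta>0 by (simp add: field_simps)
    from divide_right_mono[OF this, of "real n"] show ?thesis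
      using n0 by (simp add: \<theta>n) (simp add: \<theta>_def)
  qed
  show "real wp * (1 / real n) \<le> (W - 1 * (1 - real m / real n)) / real n \<and>
      (m < n \<longrightarrow> (W + 1 * (real m / real n)) / real n \<le> real wm * ((\<Sum>j\<in>{Suc m..n}. p j) / real (n - m)))"
    using 1 2 by (simp add: \<theta>_def P_def)
qed (use w in auto)

section \<open>Conditional expectations\<close>

text \<open>Every ingredient is a symmetric function of the deviations. This lets the drift be
  computed by rank while the process is followed by label.\<close>

lemma lyap_reindex:
  assumes bij: "bij_betw \<pi> {1..n} {1..n}" and eq: "\<And>i. i \<in> {1..n} \<Longrightarrow> x i = z (\<pi> i)"
  shows "lyap \<alpha> \<beta> \<beta>' lam \<epsilon> \<mu> wm n x = lyap \<alpha> \<beta> \<beta>' lam \<epsilon> \<mu> wm n z"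
proof -
  have "(\<Sum>i\<in>{1..n}. real (x i)) = (\<Sum>i\<in>{1..n}. real (z (\<pi> i)))" using eq by (intro sum.cong) auto
  hence avg: "avg n x = avg n z"
    using sum.reindex_bij_betw[OF bij, of "\<lambda>i. real (z i)"] by (simp add: avg_def)
  have S: "(\<Sum>i\<in>{1..n}. f (dev n x i)) = (\<Sum>i\<in>{1..n}. f (dev n z i))" for f :: "real \<Rightarrow> real"
  proof -
    have "(\<Sum>i\<in>{1..n}. f (dev n x i)) = (\<Sum>i\<in>{1..n}. f (dev n z (\<pi> i)))"
      using eq avg by (intro sum.cong) (auto simp: dev_def)
    thus ?thesis using sum.reindex_bij_betw[OF bij, of "\<lambda>i. f (dev n z i)"] by simp
  qed
  have card: "real (card {i\<in>{1..n}. dev n u i < 0}) = (\<Sum>i\<in>{1..n}. if dev n u i < 0 then 1 else 0)" for u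
    by (simp flip: sum.inter_filter)
  have c: "real (card {i\<in>{1..n}. dev n x i < 0}) = real (card {i\<in>{1..n}. dev n z i < 0})"
    unfolding card by (rule S[of "\<lambda>v. if v < 0 then 1 else 0"])
  have p: "pot \<alpha> s n x = pot \<alpha> s n z" for s
    unfolding pot_def using S[of "\<lambda>v. hinge \<alpha> (s * v)"] by simp
  have o: "over_slack lam \<epsilon> wm n x = over_slack lam \<epsilon> wm n z"
    unfolding over_slack_def c avg using S[of "\<lambda>v. exp (- lam * max (v + real wm / real n) 0)"] by simp
  have u: "under_slack \<mu> n x = under_slack \<mu> n z"
    unfolding under_slack_def using S[of "\<lambda>v. exp (\<mu> * min v 1)"] by simp
  show ?thesis by (simp add: lyap_def p o u)
qed

lemma lyap_cong:
  "(\<And>i. i \<in> {1..n} \<Longrightarrow> x i = z i) \<Longrightarrow> lyap \<alpha> \<beta> \<beta>' lam \<epsilon> \<mu> wm n x = lyap \<alpha> \<beta> \<beta>' lam \<epsilon> \<mu> wm n z"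
  by (rule lyap_reindex[of id]) auto

definition of_list :: "nat list \<Rightarrow> nat \<Rightarrow> nat" where
  "of_list l j = l ! (j - 1)"

lemma of_list_map: "j \<in> {1..n} \<Longrightarrow> of_list (map f [1..<Suc n]) j = f j"
  unfolding of_list_def by (subst nth_map) (auto simp del: upt_Suc)

section \<open>The process seen through its load vector and its sorted loads\<close>

locale balls_process =
  fixes n :: nat and A :: "'a alloc_proc"
  assumes ap: "allocation_process n A" and n_pos: "1 \<le> n"
begin

abbreviation "M \<equiv> prob_sp A"
abbreviation "F t \<equiv> alloc_filtration n A t"

text \<open>A list, because \<open>nat list\<close> is a countable type: measurability reduces to
  singletons, and every real function of the loads is measurable.\<close>

definition "loads t \<omega> = map (\<lambda>i. load A t i \<omega>) [1..<Suc n]"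
definition "sorted_load t \<omega> = of_list (rev (sort (loads t \<omega>)))"
definition "hit t j = {\<omega> \<in> space M. chosen A t \<omega> = relabel A t \<omega> j}"

lemma prob: "prob_space M" using ap by (simp add: allocation_process_def)

sublocale prob_space M by (rule prob)

lemma finite_subalgebra: "finite_measure_subalgebra M (F t)"
  using subalgebra_alloc_filtration[OF ap] by unfold_locales

lemma relabel_bij: "\<omega> \<in> space M \<Longrightarrow> bij_betw (relabel A t \<omega>) {1..n} {1..n}"
  and chosen_in: "\<omega> \<in> space M \<Longrightarrow> chosen A t \<omega> \<in> {1..n}"
  and load_other: "\<omega> \<in> space M \<Longrightarrow> i \<in> {1..n} \<Longrightarrow> i \<noteq> chosen A t \<omega> \<Longrightarrow> load A (Suc t) i \<omega> = load A t i \<omega>"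
  and load_0: "\<omega> \<in> space M \<Longrightarrow> i \<in> {1..n} \<Longrightarrow> load A 0 i \<omega> = 0"
  and relabel_sorted: "\<omega> \<in> space M \<Longrightarrow> i \<in> {1..n} \<Longrightarrow> j \<in> {1..n} \<Longrightarrow> i \<le> j \<Longrightarrow>
        load A t (relabel A t \<omega> j) \<omega> \<le> load A t (relabel A t \<omega> i) \<omega>"
  using ap unfolding allocation_process_def by blast+

lemma length_loads [simp]: "length (loads t \<omega>) = n" by (simp add: loads_def)

lemma of_list_loads: "i \<in> {1..n} \<Longrightarrow> of_list (loads t \<omega>) i = load A t i \<omega>"
  unfolding loads_def by (rule of_list_map)

text \<open>Ties make the relabelling ambiguous but not the sorted values: both sides list the same
  multiset in the same order.\<close>

lemma sorted_load_eq:
  assumes \<omega>: "\<omega> \<in> space M" and j: "j \<in> {1..n}"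
  shows "sorted_load t \<omega> j = load A t (relabel A t \<omega> j) \<omega>"
proof -
  let ?\<pi> = "relabel A t \<omega>" and ?f = "\<lambda>i. load A t i \<omega>"
  let ?l = "map (\<lambda>j. ?f (?\<pi> j)) [1..<Suc n]"
  have ran: "set [1..<Suc n] = {1..n}" by auto
  have "mset (map ?\<pi> [1..<Suc n]) = mset [1..<Suc n]"
  proof -
    have "distinct (map ?\<pi> [1..<Suc n])"
      using relabel_bij[OF \<omega>, of t] ran by (simp add: distinct_map bij_betw_def del: upt_Suc)
    moreover have "set (map ?\<pi> [1..<Suc n]) = {1..n}"
      using relabel_bij[OF \<omega>, of t] by (simp only: set_map ran bij_betw_def)
    ultimately show ?thesis using ran by (metis distinct_upt set_eq_iff_mset_eq_distinct)
  qed
  hence "image_mset ?f (mset (map ?\<pi> [1..<Suc n])) = image_mset ?f (mset [1..<Suc n])" by simp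
  hence m: "mset (rev ?l) = mset (loads t \<omega>)"
    by (simp add: loads_def image_mset.compositionality comp_def del: upt_Suc)
  have "sorted (rev ?l)"
  proof (subst sorted_iff_nth_mono, intro allI impI)
    fix i k assume ik: "i \<le> k" "k < length (rev ?l)"
    hence k: "k < n" by (simp del: upt_Suc)
    have nth: "rev ?l ! r = ?f (?\<pi> (n - r))" if "r < n" for r
      using that by (simp add: rev_nth One_nat_def Suc_diff_Suc del: upt_Suc)
    show "rev ?l ! i \<le> rev ?l ! k"
      using ik k by (simp only: nth nth[OF le_less_trans[OF ik(1) k]])
        (intro relabel_sorted[OF \<omega>], auto)
  qed
  with m have "sort (loads t \<omega>) = rev ?l" by (intro properties_for_sort)
  thus ?thesis using j by (simp add: sorted_load_def of_list_map del: upt_Suc)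
qed

text \<open>
  The labels \<open>relabel A t\<close> need not be measurable with respect to the filtration, but the sorted load
  vector is, as it is a function of the loads.
\<close>

lemma loads_measurable: "loads t \<in> measurable (F t) (count_space UNIV)"
proof (subst measurable_count_space_eq2_countable, intro conjI ballI)
  show "loads t \<in> space (F t) \<rightarrow> UNIV" by simp
  fix l :: "nat list"
  have sp: "space (F t) = space M"
    using subalgebra_alloc_filtration[OF ap] by (simp add: subalgebra_def)
  have gen: "load A t i -` {k} \<inter> space M \<in> sets (F t)" if "i \<in> {1..n}" for i k
  proof -
    have "{load A s i -` {k} \<inter> space M | s i k. s \<le> t \<and> i \<in> {1..n}} \<subseteq> Pow (space M)" by auto
    thus ?thesis unfolding alloc_filtration_def using that
      by (subst sets_measure_of) (auto intro!: sigma_sets.Basic)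
  qed
  show "loads t -` {l} \<inter> space (F t) \<in> sets (F t)"
  proof (cases "length l = n")
    case True
    have "loads t -` {l} \<inter> space (F t) = (\<Inter>i\<in>{1..n}. load A t i -` {of_list l i} \<inter> space M)"
    proof (intro set_eqI iffI)
      fix \<omega> assume "\<omega> \<in> loads t -` {l} \<inter> space (F t)"
      thus "\<omega> \<in> (\<Inter>i\<in>{1..n}. load A t i -` {of_list l i} \<inter> space M)" using of_list_loads sp by auto
    next
      fix \<omega> assume w: "\<omega> \<in> (\<Inter>i\<in>{1..n}. load A t i -` {of_list l i} \<inter> space M)"
      hence eq: "load A t i \<omega> = of_list l i" if "i \<in> {1..n}" for i using that by auto
      have "loads t \<omega> ! k = l ! k" if "k < n" for k
        using eq[of "Suc k"] that by (simp add: loads_def of_list_def One_nat_def del: upt_Suc)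
      hence "loads t \<omega> = l" using True by (intro nth_equalityI) auto
      thus "\<omega> \<in> loads t -` {l} \<inter> space (F t)" using w n_pos sp by auto
    qed
    also have "\<dots> \<in> sets (F t)" using gen n_pos by (intro sets.finite_INT) auto
    finally show ?thesis .
  next
    case False
    hence "loads t -` {l} \<inter> space (F t) = {}" by auto
    thus ?thesis by simp
  qed
qed

lemma loads_comp_measurable: "(\<lambda>\<omega>. \<phi> (loads t \<omega>)) \<in> borel_measurable (F t)"
  for \<phi> :: "nat list \<Rightarrow> real"
  by (rule measurable_compose[OF loads_measurable]) simp

lemma loads_comp_measurable_M: "(\<lambda>\<omega>. \<phi> (loads t \<omega>)) \<in> borel_measurable M"
  for \<phi> :: "nat list \<Rightarrow> real"
  by (rule measurable_from_subalg[OF subalgebra_alloc_filtration[OF ap] loads_comp_measurable])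

lemma loads_Collect: "{\<omega> \<in> space M. P (loads t \<omega>)} \<in> sets M"
proof -
  have "(\<lambda>\<omega>. of_bool (P (loads t \<omega>)) :: real) \<in> borel_measurable M"
    by (rule loads_comp_measurable_M)
  hence "{\<omega> \<in> space M. (of_bool (P (loads t \<omega>)) :: real) = 1} \<in> sets M" by measurable
  thus ?thesis by simp
qed

lemma hit_sets: "j \<in> {1..n} \<Longrightarrow> hit t j \<in> sets M"
proof -
  assume j: "j \<in> {1..n}"
  have c: "chosen A t \<in> measurable M (count_space UNIV)"
    and r: "(\<lambda>\<omega>. relabel A t \<omega> j) \<in> measurable M (count_space UNIV)"
    using ap j unfolding allocation_process_def by blast+
  have "hit t j = (\<Union>k. (chosen A t -` {k} \<inter> space M) \<inter> ((\<lambda>\<omega>. relabel A t \<omega> j) -` {k} \<inter> space M))"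
    by (auto simp: hit_def)
  also have "\<dots> \<in> sets M" using measurable_sets[OF c] measurable_sets[OF r] by auto
  finally show ?thesis .
qed

lemma rank_prob_eq: "rank_prob n A t j = real_cond_exp M (F t) (indicator (hit t j))"
  by (simp add: rank_prob_def hit_def)

text \<open>The relabelling is a bijection, so exactly one rank belongs to the chosen bin and the
  sum has one nonzero indicator.\<close>

lemma hit_sum: "\<omega> \<in> space M \<Longrightarrow> (\<Sum>j\<in>{1..n}. indicator (hit t j) \<omega> * g j) = g (the_inv_into {1..n} (relabel A t \<omega>) (chosen A t \<omega>))"
  for g :: "nat \<Rightarrow> real"
proof -
  assume \<omega>: "\<omega> \<in> space M"
  note b = relabel_bij[OF \<omega>, of t]
  let ?J = "the_inv_into {1..n} (relabel A t \<omega>) (chosen A t \<omega>)"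
  have J: "?J \<in> {1..n}" "relabel A t \<omega> ?J = chosen A t \<omega>"
    using b chosen_in[OF \<omega>, of t] unfolding bij_betw_def
    by (metis the_inv_into_into order_refl, metis f_the_inv_into_f)
  have "indicator (hit t j) \<omega> * g j = (if j = ?J then g j else 0)" if "j \<in> {1..n}" for j
    using \<omega> J that b by (auto simp: hit_def indicator_def bij_betw_def the_inv_into_f_f)
  hence "(\<Sum>j\<in>{1..n}. indicator (hit t j) \<omega> * g j) = (\<Sum>j\<in>{1..n}. if j = ?J then g j else 0)"
    by (intro sum.cong) auto
  thus ?thesis using J by simp
qed

lemma rank_prob_AE:
  "AE \<omega> in M. (\<forall>j\<in>{1..n}. 0 \<le> rank_prob n A t j \<omega>) \<and> (\<Sum>j\<in>{1..n}. rank_prob n A t j \<omega>) = 1"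
proof -
  interpret fs: finite_measure_subalgebra M "F t" by (rule finite_subalgebra)
  \<comment> \<open>Extended by 0 outside {1..n}, where the relabelling is not assumed measurable,
    so that \<open>f j\<close> is integrable for every \<open>j\<close>.\<close>
  define f where "f j = (if j \<in> {1..n} then indicator (hit t j) else (\<lambda>_. 0 :: real))" for j
  have int: "integrable M (f j)" for j
    using hit_sets[of j t] by (auto simp: f_def intro!: integrable_const_bound[of _ 1] split: split_indicator)
  have rf: "rank_prob n A t j = real_cond_exp M (F t) (f j)" if "j \<in> {1..n}" for j
    using that by (simp add: f_def rank_prob_eq)
  have "AE \<omega> in M. \<forall>j\<in>{1..n}. 0 \<le> rank_prob n A t j \<omega>"
  proof (intro AE_finite_allI)
    fix j assume j: "j \<in> {1..n}"
    show "AE \<omega> in M. 0 \<le> rank_prob n A t j \<omega>"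
      unfolding rank_prob_eq using hit_sets[OF j] by (intro fs.real_cond_exp_pos) auto
  qed simp
  moreover have "AE \<omega> in M. (\<Sum>j\<in>{1..n}. rank_prob n A t j \<omega>) = 1"
  proof -
    have one: "(\<Sum>j\<in>{1..n}. f j \<omega>) = 1" if "\<omega> \<in> space M" for \<omega>
      using hit_sum[OF that, of t "\<lambda>_. 1"] by (simp add: f_def)
    have "AE \<omega> in M. real_cond_exp M (F t) (\<lambda>\<omega>. \<Sum>j\<in>{1..n}. f j \<omega>) \<omega> = (\<Sum>j\<in>{1..n}. real_cond_exp M (F t) (f j) \<omega>)"
      using int by (rule fs.real_cond_exp_sum)
    moreover have "AE \<omega> in M. real_cond_exp M (F t) (\<lambda>\<omega>. \<Sum>j\<in>{1..n}. f j \<omega>) \<omega> = real_cond_exp M (F t) (\<lambda>_. 1) \<omega>"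
      using int one by (intro fs.real_cond_exp_cong) auto
    moreover have "AE \<omega> in M. real_cond_exp M (F t) (\<lambda>_. 1) \<omega> = 1"
      by (intro fs.real_cond_exp_F_meas) auto
    ultimately show ?thesis by eventually_elim (simp add: rf)
  qed
  ultimately show ?thesis by eventually_elim simp
qed

section \<open>From the almost sure conditions to an abstract step at a sample point\<close>

lemma norm_load_sorted:
  assumes "\<omega> \<in> space M" "j \<in> {1..n}"
  shows "norm_load n A t (relabel A t \<omega> j) \<omega> = dev n (sorted_load t \<omega>) j"
proof -
  have "(\<Sum>i\<in>{1..n}. real (sorted_load t \<omega> i)) = (\<Sum>i\<in>{1..n}. real (load A t (relabel A t \<omega> i) \<omega>))"
    using sorted_load_eq[OF assms(1)] by simp
  also have "\<dots> = real (total_load n A t \<omega>)"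
    using sum.reindex_bij_betw[OF relabel_bij[OF assms(1), of t], of "\<lambda>i. real (load A t i \<omega>)"]
    by (simp add: total_load_def)
  finally show ?thesis
    using sorted_load_eq[OF assms] by (simp add: norm_load_def dev_def avg_def)
qed

lemma over_bins_sorted: "\<omega> \<in> space M \<Longrightarrow> over_bins n A t \<omega> = {j\<in>{1..n}. 0 \<le> dev n (sorted_load t \<omega>) j}"
  using norm_load_sorted by (auto simp: over_bins_def)

definition "over_num t \<omega> = card (over_bins n A t \<omega>)"

lemma over_num:
  assumes "\<omega> \<in> space M"
  shows "over_bins n A t \<omega> = {1..over_num t \<omega>}" "over_num t \<omega> \<le> n"
    "under_bins n A t \<omega> = {Suc (over_num t \<omega>)..n}"
    "card (under_bins n A t \<omega>) = n - over_num t \<omega>"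
proof -
  show o: "over_bins n A t \<omega> = {1..over_num t \<omega>}"
    unfolding over_num_def by (rule over_bins_eq[OF ap assms])
  have "over_num t \<omega> \<le> card {1..n}" unfolding over_num_def
    by (rule card_mono) (auto simp: over_bins_def)
  thus "over_num t \<omega> \<le> n" by simp
  show "under_bins n A t \<omega> = {Suc (over_num t \<omega>)..n}" unfolding under_bins_def o by auto
  thus "card (under_bins n A t \<omega>) = n - over_num t \<omega>" by simp
qed

lemma sorted_load_mono: "\<omega> \<in> space M \<Longrightarrow> i \<in> {1..n} \<Longrightarrow> j \<in> {1..n} \<Longrightarrow> i \<le> j \<Longrightarrow>
    sorted_load t \<omega> j \<le> sorted_load t \<omega> i"
  using relabel_sorted by (simp add: sorted_load_eq)

lemma alloc_step_of_P2_W1: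
  assumes \<omega>: "\<omega> \<in> space M"
    and p: "\<forall>j\<in>{1..n}. 0 \<le> rank_prob n A t j \<omega>" "(\<Sum>j\<in>{1..n}. rank_prob n A t j \<omega>) = 1"
    and w: "1 \<le> wp" "wp \<le> wm" and k: "k2 \<in> {0<..1}" "k3 \<in> {0<..1}" "k4 \<in> {0<..1}"
    and P2: "\<forall>j\<in>over_bins n A t \<omega>. rank_prob n A t j \<omega> \<le> real k1 / real n"
      "dominates (replicate (card (over_bins n A t \<omega>)) (1 / real n - k3 * (1 - over_frac n A t \<omega>) / real n))
          (over_vec n A t \<omega>)"
      "\<forall>j\<in>under_bins n A t \<omega>. k2 / real n \<le> rank_prob n A t j \<omega>"
      "dominates (under_vec n A t \<omega>) (replicate (card (under_bins n A t \<omega>))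
            (1 / real n + k4 * over_frac n A t \<omega> / real n))"
  shows "alloc_step n (sorted_load t \<omega>) (\<lambda>j. rank_prob n A t j \<omega>) wp wm k1 k2 (min k3 k4)"
proof (rule alloc_step_P2_W1[where m = "over_num t \<omega>"])
  note o = over_num[OF \<omega>, of t]
  show "{j\<in>{1..n}. 0 \<le> dev n (sorted_load t \<omega>) j} = {1..over_num t \<omega>}"
    using o(1) over_bins_sorted[OF \<omega>] by simp
  show "(\<Sum>j\<in>{1..l}. rank_prob n A t j \<omega>)
      \<le> real l * (1 / real n - k3 * (1 - real (over_num t \<omega>) / real n) / real n)" if "l \<le> over_num t \<omega>" for l
    using dominates_overD[OF P2(2)[unfolded over_vec_def over_frac_def, folded over_num_def] that] .
  show "real l * (1 / real n + k4 * (real (over_num t \<omega>) / real n) / real n)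
      \<le> (\<Sum>j\<in>{Suc (n - l)..n}. rank_prob n A t j \<omega>)" if "l \<le> n - over_num t \<omega>" for l
    using dominates_underD[OF P2(4)[unfolded under_vec_def over_frac_def, folded over_num_def] that o(4)] .
qed (use n_pos p w k P2 over_num[OF \<omega>, of t] sorted_load_mono[OF \<omega>, of _ _ t] in auto)

lemma alloc_step_of_P1_W2:
  assumes \<omega>: "\<omega> \<in> space M"
    and p: "\<forall>j\<in>{1..n}. 0 \<le> rank_prob n A t j \<omega>" "(\<Sum>j\<in>{1..n}. rank_prob n A t j \<omega>) = 1"
    and w: "1 \<le> wp" "wp < wm" and k: "k2 \<in> {0<..1}"
    and P1: "\<forall>j\<in>over_bins n A t \<omega>. rank_prob n A t j \<omega> \<le> real k1 / real n"
      "dominates (replicate (card (over_bins n A t \<omega>)) (1 / real n)) (over_vec n A t \<omega>)"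
      "\<forall>j\<in>under_bins n A t \<omega>. k2 / real n \<le> rank_prob n A t j \<omega>"
      "dominates (under_vec n A t \<omega>) (replicate (card (under_bins n A t \<omega>)) (1 / real n))"
    and W2: "dominates (under_vec n A t \<omega>) (replicate (card (under_bins n A t \<omega>))
            (under_prob n A t \<omega> / real (card (under_bins n A t \<omega>))))"
  shows "alloc_step n (sorted_load t \<omega>) (\<lambda>j. rank_prob n A t j \<omega>) wp wm k1 k2 1"
proof (rule alloc_step_P1_W2[where m = "over_num t \<omega>"])
  note o = over_num[OF \<omega>, of t]
  show "{j\<in>{1..n}. 0 \<le> dev n (sorted_load t \<omega>) j} = {1..over_num t \<omega>}"
    using o(1) over_bins_sorted[OF \<omega>] by simp
  show "(\<Sum>j\<in>{1..l}. rank_prob n A t j \<omega>) \<le> real l * (1 / real n)" if "l \<le> over_num t \<omega>" for l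
    using dominates_overD[OF P1(2)[unfolded over_vec_def, folded over_num_def] that] .
  show "real l * (1 / real n) \<le> (\<Sum>j\<in>{Suc (n - l)..n}. rank_prob n A t j \<omega>)"
    if "l \<le> n - over_num t \<omega>" for l
    using dominates_underD[OF P1(4)[unfolded under_vec_def, folded over_num_def] that o(4)] .
  show "real l * ((\<Sum>j\<in>{Suc (over_num t \<omega>)..n}. rank_prob n A t j \<omega>) / real (n - over_num t \<omega>))
      \<le> (\<Sum>j\<in>{Suc (n - l)..n}. rank_prob n A t j \<omega>)" if "l \<le> n - over_num t \<omega>" for l
    using dominates_underD[OF W2[unfolded under_vec_def, folded over_num_def] that o(4)]
    unfolding under_prob_def o(3) by simp
qed (use n_pos p w k P1 over_num[OF \<omega>, of t] sorted_load_mono[OF \<omega>, of _ _ t] in auto)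

end

section \<open>Expectation bound and tail estimate\<close>

text \<open>A factor 2 for undoing the tilt and a factor 2 for undoing the smoothing.\<close>

lemma exp_dev_le_lyap:
  assumes n: "1 \<le> n" and i: "i \<in> {1..n}" and \<alpha>: "0 \<le> \<alpha>"
    and o: "\<bar>\<beta> * over_slack lam \<epsilon> wm n x\<bar> \<le> 1 / 2" and u: "\<bar>\<beta>' * under_slack \<mu> n x\<bar> \<le> 1 / 2"
  shows "exp (\<alpha> * \<bar>dev n x i\<bar>) \<le> 4 * lyap \<alpha> \<beta> \<beta>' lam \<epsilon> \<mu> wm n x"
proof -
  let ?X = "pot \<alpha> 1 n x" and ?Y = "pot \<alpha> (-1) n x"
  have n0: "0 < real n" using n by simp
  have X: "0 \<le> ?X" "0 \<le> ?Y" using pot_ge[of n \<alpha> _ x] n0 by (meson less_imp_le order_trans)+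
  have e: "?X * (1 / 2) \<le> ?X * exp (\<beta> * over_slack lam \<epsilon> wm n x)"
    "?Y * (1 / 2) \<le> ?Y * exp (\<beta>' * under_slack \<mu> n x)"
    by (rule mult_left_mono[OF exp_half_bounds(2)[OF o] X(1)])
      (rule mult_left_mono[OF exp_half_bounds(2)[OF u] X(2)])
  have "0 \<le> ?X * ?Y / real n" using X by simp
  hence V: "?X \<le> 2 * lyap \<alpha> \<beta> \<beta>' lam \<epsilon> \<mu> wm n x" "?Y \<le> 2 * lyap \<alpha> \<beta> \<beta>' lam \<epsilon> \<mu> wm n x"
    using e X unfolding lyap_def by argo+
  have s: "hexp \<alpha> (s * dev n x i) \<le> 2 * pot \<alpha> s n x" for s
  proof -
    have "hexp \<alpha> (s * dev n x i) \<le> (\<Sum>i\<in>{1..n}. hexp \<alpha> (s * dev n x i))"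
      using i by (intro member_le_sum) (auto simp: hexp_def)
    thus ?thesis using sum_hexp_le_pot[of \<alpha> s n x] by linarith
  qed
  show ?thesis
  proof (cases "0 \<le> dev n x i")
    case True
    thus ?thesis using s[of 1] V by (simp add: hexp_def)
  next
    case False
    thus ?thesis using s[of "-1"] V by (simp add: hexp_def)
  qed
qed

text \<open>5 = 1 + 2 + 2: the product contributes n and each tilted potential at most 2 n.\<close>

lemma lyap_zero_le:
  assumes n: "1 \<le> n"
    and o: "\<bar>\<beta> * over_slack lam \<epsilon> wm n (\<lambda>_. 0)\<bar> \<le> 1 / 2"
    and u: "\<bar>\<beta>' * under_slack \<mu> n (\<lambda>_. 0)\<bar> \<le> 1 / 2"
  shows "lyap \<alpha> \<beta> \<beta>' lam \<epsilon> \<mu> wm n (\<lambda>_. 0) \<le> 5 * real n"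
proof -
  have p: "pot \<alpha> s n (\<lambda>_. 0) = real n" for s
    by (simp add: pot_def dev_def avg_def hinge_nonpos_arg)
  have "real n * exp (\<beta> * over_slack lam \<epsilon> wm n (\<lambda>_. 0)) \<le> real n * 2"
    "real n * exp (\<beta>' * under_slack \<mu> n (\<lambda>_. 0)) \<le> real n * 2"
    using mult_left_mono[OF exp_half_bounds(1)[OF o]] mult_left_mono[OF exp_half_bounds(1)[OF u]] by auto
  moreover have "real n * real n / real n = real n" using n by simp
  ultimately show ?thesis unfolding lyap_def p by linarith
qed

context balls_process
begin

lemma norm_load_dev: "i \<in> {1..n} \<Longrightarrow> norm_load n A t i \<omega> = dev n (of_list (loads t \<omega>)) i"
  by (simp add: norm_load_def dev_def avg_def total_load_def of_list_loads)

definition "max_dev t \<omega> =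
  Max ((\<lambda>i. \<bar>real (load A t i \<omega>) - real (total_load n A t \<omega>) / real n\<bar>) ` {1..n})"

lemma max_dev_le_iff: "max_dev t \<omega> \<le> r \<longleftrightarrow> (\<forall>i\<in>{1..n}. \<bar>norm_load n A t i \<omega>\<bar> \<le> r)"
  unfolding max_dev_def using n_pos by (subst Max_le_iff) (auto simp: norm_load_def)

lemma gap_le_iff: "gap n A t \<omega> \<le> r \<longleftrightarrow> (\<forall>i\<in>{1..n}. norm_load n A t i \<omega> \<le> r)"
proof -
  have "gap n A t \<omega> \<le> r \<longleftrightarrow> real (Max ((\<lambda>i. load A t i \<omega>) ` {1..n})) \<le> r + real (total_load n A t \<omega>) / real n"
    by (auto simp: gap_def)
  also have "real (Max ((\<lambda>i. load A t i \<omega>) ` {1..n})) = Max (real ` (\<lambda>i. load A t i \<omega>) ` {1..n})"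
    using n_pos by (intro mono_Max_commute) (auto simp: mono_def)
  also have "\<dots> \<le> r + real (total_load n A t \<omega>) / real n \<longleftrightarrow>
      (\<forall>i\<in>{1..n}. real (load A t i \<omega>) \<le> r + real (total_load n A t \<omega>) / real n)"
    using n_pos by (subst Max_le_iff) auto
  finally show ?thesis by (auto simp: norm_load_def algebra_simps)
qed

lemma max_dev_sets: "{\<omega> \<in> space M. max_dev t \<omega> \<le> r} \<in> sets M"
  unfolding max_dev_le_iff
  using loads_Collect[of "\<lambda>l. \<forall>i\<in>{1..n}. \<bar>dev n (of_list l) i\<bar> \<le> r" t] by (simp add: norm_load_dev)

lemma gap_sets: "{\<omega> \<in> space M. gap n A t \<omega> \<le> r} \<in> sets M"
  unfolding gap_le_iff
  using loads_Collect[of "\<lambda>l. \<forall>i\<in>{1..n}. dev n (of_list l) i \<le> r" t] by (simp add: norm_load_dev)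

lemma lyap_loads:
  "lyap \<alpha> \<beta> \<beta>' lam \<epsilon> \<mu> wm n (\<lambda>i. load A t i \<omega>) = lyap \<alpha> \<beta> \<beta>' lam \<epsilon> \<mu> wm n (of_list (loads t \<omega>))"
  by (rule lyap_cong) (simp add: of_list_loads)

lemma lyap_sorted_load:
  assumes "\<omega> \<in> space M"
  shows "lyap \<alpha> \<beta> \<beta>' lam \<epsilon> \<mu> wm n (sorted_load t \<omega>) = lyap \<alpha> \<beta> \<beta>' lam \<epsilon> \<mu> wm n (\<lambda>i. load A t i \<omega>)"
  by (rule lyap_reindex[OF relabel_bij[OF assms, of t]]) (simp add: sorted_load_eq[OF assms])

end

section \<open>Integrability, the recursion for expectations and the tail\<close>

locale weighted_process = balls_process +
  fixes wp wm :: nat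
  assumes weights: "AE \<omega> in M. load A (Suc t) (chosen A t \<omega>) \<omega> = load A t (chosen A t \<omega>) \<omega> +
       (if norm_load n A t (chosen A t \<omega>) \<omega> < 0 then wm else wp)"
    and wp_le: "wp \<le> wm"
begin

text \<open>At a fixed time only finitely many load vectors occur almost surely, so every function
  of them is integrable.\<close>

lemma load_bound: "AE \<omega> in M. \<forall>i\<in>{1..n}. load A t i \<omega> \<le> wm * t"
proof (induction t)
  case 0
  show ?case using load_0 by (intro AE_I2) simp
next
  case (Suc t)
  show ?case
    using Suc.IH weights[of t] AE_space
  proof eventually_elim
    case (elim \<omega>)
    show ?case
    proof
      fix i assume i: "i \<in> {1..n}"
      have IH: "load A t i \<omega> \<le> wm * t" using elim(1) i by blast
      show "load A (Suc t) i \<omega> \<le> wm * Suc t"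
      proof (cases "i = chosen A t \<omega>")
        case True
        have "load A (Suc t) i \<omega> \<le> load A t i \<omega> + wm" using elim(2) True wp_le by simp
        thus ?thesis using IH by simp
      next
        case False
        thus ?thesis using load_other[OF elim(3) i, of t] IH by simp
      qed
    qed
  qed
qed

lemma loads_comp_integrable: "integrable M (\<lambda>\<omega>. \<phi> (loads t \<omega>))"
  for \<phi> :: "nat list \<Rightarrow> real"
proof -
  define S where "S = {l. set l \<subseteq> {..wm * t} \<and> length l = n}"
  have fin: "finite S" unfolding S_def by (rule finite_lists_length_eq) simp
  show ?thesis
  proof (rule integrable_const_bound)
    show "AE \<omega> in M. norm (\<phi> (loads t \<omega>)) \<le> Max ((\<lambda>l. norm (\<phi> l)) ` S)"
      using load_bound[of t]
    proof eventually_elim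
      case (elim \<omega>)
      hence "loads t \<omega> \<in> S" by (auto simp: S_def loads_def)
      thus ?case using fin by (intro Max_ge) auto
    qed
  qed (rule loads_comp_measurable_M)
qed

lemma lyap_integrable: "integrable M (\<lambda>\<omega>. lyap \<alpha> \<beta> \<beta>' lam \<epsilon> \<mu> v n (\<lambda>i. load A t i \<omega>))"
  unfolding lyap_loads
  by (rule loads_comp_integrable[of "\<lambda>l. lyap \<alpha> \<beta> \<beta>' lam \<epsilon> \<mu> v n (of_list l)"])

text \<open>The next value is a sum over ranks of a function of the current sorted loads times the
  indicator of that rank being hit. The first factor is measurable for the filtration, so under the
  expectation the indicator may be replaced by \<open>rank_prob\<close>, although the relabelling
  itself need not be adapted.\<close>

lemma lyap_expectation_step:
  fixes \<alpha> \<beta> \<beta>' lam \<epsilon> \<mu> :: real and V :: "(nat \<Rightarrow> nat) \<Rightarrow> real"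
  defines "V \<equiv> lyap \<alpha> \<beta> \<beta>' lam \<epsilon> \<mu> wm n"
  assumes step: "AE \<omega> in M. alloc_step n (sorted_load t \<omega>) (\<lambda>j. rank_prob n A t j \<omega>) wp wm k1 k2 c"
    and drift: "\<And>x p. alloc_step n x p wp wm k1 k2 c \<Longrightarrow>
        (\<Sum>j\<in>{1..n}. p j * V (allocate n wp wm x j)) \<le> r * V x + K"
  shows "expectation (\<lambda>\<omega>. V (\<lambda>i. load A (Suc t) i \<omega>)) \<le> r * expectation (\<lambda>\<omega>. V (\<lambda>i. load A t i \<omega>)) + K"
proof -
  interpret fs: finite_measure_subalgebra M "F t" by (rule finite_subalgebra)
  define \<psi> where "\<psi> j l = V (allocate n wp wm (of_list (rev (sort l))) j)" for j l
  have \<psi>: "\<psi> j (loads t \<omega>) = V (allocate n wp wm (sorted_load t \<omega>) j)" for j \<omega>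
    by (simp add: \<psi>_def sorted_load_def)
  have next_V: "AE \<omega> in M. V (\<lambda>i. load A (Suc t) i \<omega>)
      = (\<Sum>j\<in>{1..n}. \<psi> j (loads t \<omega>) * indicator (hit t j) \<omega>)"
    using weights[of t] AE_space
  proof eventually_elim
    case (elim \<omega>)
    note b = relabel_bij[OF elim(2), of t]
    define J where "J = the_inv_into {1..n} (relabel A t \<omega>) (chosen A t \<omega>)"
    have J: "J \<in> {1..n}" "relabel A t \<omega> J = chosen A t \<omega>"
      using b chosen_in[OF elim(2), of t] unfolding bij_betw_def J_def
      by (metis the_inv_into_into order_refl, metis f_the_inv_into_f)
    have "V (allocate n wp wm (sorted_load t \<omega>) J) = V (\<lambda>i. load A (Suc t) i \<omega>)"
      unfolding V_def
    proof (rule lyap_reindex[OF b])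
      fix i assume i: "i \<in> {1..n}"
      show "allocate n wp wm (sorted_load t \<omega>) J i = load A (Suc t) (relabel A t \<omega> i) \<omega>"
      proof (cases "i = J")
        case True
        thus ?thesis using J elim(1)
          by (simp add: allocate_def weight_def sorted_load_eq[OF elim(2)] norm_load_sorted[OF elim(2) J(1), symmetric])
      next
        case False
        hence "relabel A t \<omega> i \<noteq> chosen A t \<omega>"
          using b J i unfolding bij_betw_def by (metis inj_onD)
        moreover have "relabel A t \<omega> i \<in> {1..n}" using b i by (rule bij_betwE[rule_format])
        ultimately show ?thesis using False i load_other[OF elim(2)]
          by (simp add: allocate_def sorted_load_eq[OF elim(2)])
      qed
    qed
    thus ?case using hit_sum[OF elim(2), of t "\<lambda>j. \<psi> j (loads t \<omega>)"]
      by (simp add: \<psi> J_def mult.commute)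
  qed
  have int: "integrable M (\<lambda>\<omega>. \<psi> j (loads t \<omega>) * indicator (hit t j) \<omega>)" if "j \<in> {1..n}" for j
    using integrable_mult_indicator[OF hit_sets[OF that] loads_comp_integrable[of "\<psi> j" t]]
    by (simp add: mult.commute)
  have ce: "integrable M (\<lambda>\<omega>. \<psi> j (loads t \<omega>) * rank_prob n A t j \<omega>)"
    "expectation (\<lambda>\<omega>. \<psi> j (loads t \<omega>) * rank_prob n A t j \<omega>)
      = expectation (\<lambda>\<omega>. \<psi> j (loads t \<omega>) * indicator (hit t j) \<omega>)" if "j \<in> {1..n}" for j
    unfolding rank_prob_eq using hit_sets[OF that, of t]
    by (intro fs.real_cond_exp_intg int[OF that] loads_comp_measurable; simp)+
  have "expectation (\<lambda>\<omega>. V (\<lambda>i. load A (Suc t) i \<omega>))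
      = expectation (\<lambda>\<omega>. \<Sum>j\<in>{1..n}. \<psi> j (loads t \<omega>) * indicator (hit t j) \<omega>)"
  proof (rule integral_cong_AE[OF _ _ next_V])
    show "(\<lambda>\<omega>. V (\<lambda>i. load A (Suc t) i \<omega>)) \<in> borel_measurable M"
      unfolding V_def by (rule borel_measurable_integrable[OF lyap_integrable])
    show "(\<lambda>\<omega>. \<Sum>j\<in>{1..n}. \<psi> j (loads t \<omega>) * indicator (hit t j) \<omega>) \<in> borel_measurable M"
      by (intro borel_measurable_integrable Bochner_Integration.integrable_sum int)
  qed
  also have "\<dots> = (\<Sum>j\<in>{1..n}. expectation (\<lambda>\<omega>. \<psi> j (loads t \<omega>) * rank_prob n A t j \<omega>))"
    by (subst Bochner_Integration.integral_sum[OF int]) (auto simp: ce(2) intro!: sum.cong)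
  also have "\<dots> = expectation (\<lambda>\<omega>. \<Sum>j\<in>{1..n}. \<psi> j (loads t \<omega>) * rank_prob n A t j \<omega>)"
    using ce(1) by (subst Bochner_Integration.integral_sum) auto
  also have "\<dots> \<le> expectation (\<lambda>\<omega>. r * V (\<lambda>i. load A t i \<omega>) + K)"
  proof (rule integral_mono_AE)
    show "integrable M (\<lambda>\<omega>. \<Sum>j\<in>{1..n}. \<psi> j (loads t \<omega>) * rank_prob n A t j \<omega>)"
      using ce(1) by (rule Bochner_Integration.integrable_sum)
    show "integrable M (\<lambda>\<omega>. r * V (\<lambda>i. load A t i \<omega>) + K)" using lyap_integrable unfolding V_def by simp
    show "AE \<omega> in M. (\<Sum>j\<in>{1..n}. \<psi> j (loads t \<omega>) * rank_prob n A t j \<omega>) \<le> r * V (\<lambda>i. load A t i \<omega>) + K"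
      using step AE_space
    proof eventually_elim
      case (elim \<omega>)
      from drift[OF elim(1)] show ?case
        using lyap_sorted_load[OF elim(2)] by (simp add: \<psi> V_def mult.commute)
    qed
  qed
  also have "\<dots> = r * expectation (\<lambda>\<omega>. V (\<lambda>i. load A t i \<omega>)) + K"
    using lyap_integrable unfolding V_def by (simp add: prob_space)
  finally show ?thesis .
qed

lemma tail_bound:
  assumes \<alpha>: "0 < \<alpha>" "\<alpha> \<le> 1" "0 \<le> K"
    and o: "\<And>x. \<bar>\<beta> * over_slack lam \<epsilon> wm n x\<bar> \<le> 1 / 2"
    and u: "\<And>x. \<bar>\<beta>' * under_slack \<mu> n x\<bar> \<le> 1 / 2"
    and step: "\<And>t. AE \<omega> in M. alloc_step n (sorted_load t \<omega>) (\<lambda>j. rank_prob n A t j \<omega>) wp wm k1 k2 c"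
    and drift: "\<And>x p. alloc_step n x p wp wm k1 k2 c \<Longrightarrow>
        (\<Sum>j\<in>{1..n}. p j * lyap \<alpha> \<beta> \<beta>' lam \<epsilon> \<mu> wm n (allocate n wp wm x j))
        \<le> (1 - \<alpha>\<^sup>2 / real n) * lyap \<alpha> \<beta> \<beta>' lam \<epsilon> \<mu> wm n x + K"
    and n: "4 * (5 + K / \<alpha>\<^sup>2) \<le> real n"
  shows "1 - 1 / real n ^ 4 \<le> prob {\<omega> \<in> space M. max_dev t \<omega> \<le> 6 / \<alpha> * ln (real n)}"
    and "1 - 1 / real n ^ 4 \<le> prob {\<omega> \<in> space M. gap n A t \<omega> \<le> 6 / \<alpha> * ln (real n)}"
proof -
  define V where "V s \<omega> = lyap \<alpha> \<beta> \<beta>' lam \<epsilon> \<mu> wm n (\<lambda>i. load A s i \<omega>)" for s \<omega>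
  \<comment> \<open>K n/\<alpha>^2 is the fixed point of the recursion, and 5 n covers the initial
    value.\<close>
  define R where "R = (5 + K / \<alpha>\<^sup>2) * real n"
  have n0: "0 < real n" and n1: "1 \<le> real n" using n_pos by auto
  have "\<alpha>\<^sup>2 \<le> 1\<^sup>2" using \<alpha> by (intro power_mono) auto
  hence r0: "0 \<le> 1 - \<alpha>\<^sup>2 / real n" using n1 by (simp add: divide_le_eq)
  have EV: "expectation (V s) \<le> R" for s
  proof (induction s)
    case 0
    have "expectation (V 0) = expectation (\<lambda>_. lyap \<alpha> \<beta> \<beta>' lam \<epsilon> \<mu> wm n (\<lambda>_. 0))"
      unfolding V_def using load_0 by (intro Bochner_Integration.integral_cong refl lyap_cong) auto
    also have "\<dots> \<le> 5 * real n" using lyap_zero_le[OF n_pos o u] by (simp add: prob_space)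
    also have "\<dots> \<le> R" using \<alpha> n0 by (simp add: R_def distrib_right)
    finally show ?case .
  next
    case (Suc s)
    have "expectation (V (Suc s)) \<le> (1 - \<alpha>\<^sup>2 / real n) * expectation (V s) + K"
      unfolding V_def by (rule lyap_expectation_step[OF step drift])
    also have "\<dots> \<le> (1 - \<alpha>\<^sup>2 / real n) * R + K" using Suc r0 by (intro add_right_mono mult_left_mono)
    also have "\<dots> = R - 5 * \<alpha>\<^sup>2" using \<alpha> n0 by (simp add: R_def field_simps)
    also have "\<dots> \<le> R" by simp
    finally show ?case .
  qed
  have lower: "exp (\<alpha> * \<bar>norm_load n A t i \<omega>\<bar>) \<le> 4 * V t \<omega>" if "i \<in> {1..n}" for i \<omega>
    unfolding V_def lyap_loads norm_load_dev[OF that] using \<alpha> o u by (intro exp_dev_le_lyap n_pos that) auto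
  have V0: "0 \<le> V t \<omega>" for \<omega>
    using order_trans[OF exp_ge_zero lower[of 1 \<omega>]] n_pos by simp
  \<comment> \<open>Of the six powers of n in the threshold, one cancels the expectation of order n,
    four give the target probability and one absorbs the constants. The 4 matches
    \<open>lower\<close>.\<close>
  let ?bad = "{\<omega> \<in> space M. real n ^ 6 / 4 \<le> V t \<omega>}"
  let ?good = "{\<omega> \<in> space M. max_dev t \<omega> \<le> 6 / \<alpha> * ln (real n)}"
  have intV: "integrable M (V t)" unfolding V_def by (rule lyap_integrable)
  have bad_sets: "?bad \<in> sets M" using borel_measurable_integrable[OF intV] by measurable
  have "prob ?bad \<le> expectation (V t) / (real n ^ 6 / 4)"
    using intV V0 n0 by (intro integral_Markov_inequality_measure[where A = "{}"]) auto
  also have "\<dots> \<le> R / (real n ^ 6 / 4)" using EV n0 by (intro divide_right_mono) auto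
  also have "\<dots> = 4 * (5 + K / \<alpha>\<^sup>2) / real n / real n ^ 4"
  proof -
    have "real n ^ 6 = real n * (real n * real n ^ 4)"
      by (simp only: power_Suc[symmetric]) simp
    thus ?thesis using n0 by (simp add: R_def)
  qed
  also have "\<dots> \<le> 1 / real n ^ 4" using n n0 by (intro divide_right_mono) (auto simp: divide_le_eq)
  finally have bad: "prob ?bad \<le> 1 / real n ^ 4" .
  have "space M - ?bad \<subseteq> ?good"
  proof
    fix \<omega> assume w: "\<omega> \<in> space M - ?bad"
    have "\<bar>norm_load n A t i \<omega>\<bar> \<le> 6 / \<alpha> * ln (real n)" if "i \<in> {1..n}" for i
    proof -
      have "exp (\<alpha> * \<bar>norm_load n A t i \<omega>\<bar>) < real n ^ 6" using lower[OF that, of \<omega>] w by auto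
      also have "\<dots> = exp (6 * ln (real n))" using n0 powr_numeral[of "real n" "num.Bit0 (num.Bit1 num.One)"] by (simp add: powr_def)
      finally have "\<alpha> * \<bar>norm_load n A t i \<omega>\<bar> \<le> 6 * ln (real n)" by simp
      thus ?thesis using \<alpha> by (simp add: field_simps)
    qed
    thus "\<omega> \<in> ?good" using w by (simp add: max_dev_le_iff)
  qed
  hence "prob (space M - ?bad) \<le> prob ?good" by (intro finite_measure_mono max_dev_sets)
  thus good: "1 - 1 / real n ^ 4 \<le> prob ?good" using bad prob_compl[OF bad_sets] by simp
  have "?good \<subseteq> {\<omega> \<in> space M. gap n A t \<omega> \<le> 6 / \<alpha> * ln (real n)}"
    by (auto simp: max_dev_le_iff gap_le_iff)
  hence "prob ?good \<le> prob {\<omega> \<in> space M. gap n A t \<omega> \<le> 6 / \<alpha> * ln (real n)}"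
    by (intro finite_measure_mono gap_sets)
  with good show "1 - 1 / real n ^ 4 \<le> prob {\<omega> \<in> space M. gap n A t \<omega> \<le> 6 / \<alpha> * ln (real n)}" by simp
qed

end

lemma alloc_step_constants:
  fixes A :: "nat \<Rightarrow> 'a alloc_proc"
  assumes ap: "\<And>n. 1 \<le> n \<Longrightarrow> allocation_process n (A n)"
    and cond: "(cond_P2 A \<and> cond_W1 A) \<or> (cond_P1 A \<and> cond_W2 A)"
  obtains wp wm k1 k2 c where "1 \<le> wp" "wp \<le> wm" "0 < k2" "k2 \<le> 1" "0 < c" "c \<le> 1" "weight_rule A wp wm"
    "\<And>n t. 1 \<le> n \<Longrightarrow> AE \<omega> in prob_sp (A n). alloc_step n (balls_process.sorted_load n (A n) t \<omega>)
        (\<lambda>j. rank_prob n (A n) t j \<omega>) wp wm k1 k2 c"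
  using cond
proof
  assume c: "cond_P2 A \<and> cond_W1 A"
  obtain wp wm where w: "1 \<le> wp" "wp \<le> wm" "weight_rule A wp wm" using c unfolding cond_W1_def by blast
  from c obtain k1 k2 k3 k4 where k: "k2 \<in> {0<..1::real}" "k3 \<in> {0<..1::real}" "k4 \<in> {0<..1::real}"
    and P2: "\<forall>n\<ge>1. \<forall>t. AE \<omega> in prob_sp (A n).
        (\<forall>j\<in>over_bins n (A n) t \<omega>. rank_prob n (A n) t j \<omega> \<le> real k1 / real n) \<and>
        dominates (replicate (card (over_bins n (A n) t \<omega>))
            (1 / real n - k3 * (1 - over_frac n (A n) t \<omega>) / real n))
          (over_vec n (A n) t \<omega>) \<and>
        (\<forall>j\<in>under_bins n (A n) t \<omega>. k2 / real n \<le> rank_prob n (A n) t j \<omega>) \<and>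
        dominates (under_vec n (A n) t \<omega>)
          (replicate (card (under_bins n (A n) t \<omega>))
            (1 / real n + k4 * over_frac n (A n) t \<omega> / real n))"
    unfolding cond_P2_def by blast
  have "AE \<omega> in prob_sp (A n). alloc_step n (balls_process.sorted_load n (A n) t \<omega>)
        (\<lambda>j. rank_prob n (A n) t j \<omega>) wp wm k1 k2 (min k3 k4)" if n: "1 \<le> n" for n t
  proof -
    interpret balls_process n "A n" using ap[OF n] n by unfold_locales
    show ?thesis using P2[rule_format, OF n, of t] rank_prob_AE[of t] AE_space
    proof eventually_elim
      case (elim \<omega>)
      note P = elim(1)
      show ?case
        by (rule alloc_step_of_P2_W1[OF elim(3) elim(2)[THEN conjunct1] elim(2)[THEN conjunct2] w(1,2) k
            P[THEN conjunct1] P[THEN conjunct2, THEN conjunct1]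
            P[THEN conjunct2, THEN conjunct2, THEN conjunct1] P[THEN conjunct2, THEN conjunct2, THEN conjunct2]])
    qed
  qed
  thus thesis using w k by (intro that[of wp wm k2 "min k3 k4" k1]) auto
next
  assume c: "cond_P1 A \<and> cond_W2 A"
  obtain wp wm where w: "1 \<le> wp" "wp < wm" "weight_rule A wp wm"
    and W2: "\<forall>n\<ge>1. \<forall>t. AE \<omega> in prob_sp (A n).
        dominates (under_vec n (A n) t \<omega>)
          (replicate (card (under_bins n (A n) t \<omega>))
            (under_prob n (A n) t \<omega> / real (card (under_bins n (A n) t \<omega>))))"
    using c unfolding cond_W2_def by blast
  from c obtain k1 k2 where k: "k2 \<in> {0<..1::real}"
    and P1: "\<forall>n\<ge>1. \<forall>t. AE \<omega> in prob_sp (A n).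
        (\<forall>j\<in>over_bins n (A n) t \<omega>. rank_prob n (A n) t j \<omega> \<le> real k1 / real n) \<and>
        dominates (replicate (card (over_bins n (A n) t \<omega>)) (1 / real n))
          (over_vec n (A n) t \<omega>) \<and>
        (\<forall>j\<in>under_bins n (A n) t \<omega>. k2 / real n \<le> rank_prob n (A n) t j \<omega>) \<and>
        dominates (under_vec n (A n) t \<omega>)
          (replicate (card (under_bins n (A n) t \<omega>)) (1 / real n))"
    unfolding cond_P1_def by blast
  have "AE \<omega> in prob_sp (A n). alloc_step n (balls_process.sorted_load n (A n) t \<omega>)
        (\<lambda>j. rank_prob n (A n) t j \<omega>) wp wm k1 k2 1" if n: "1 \<le> n" for n t
  proof -
    interpret balls_process n "A n" using ap[OF n] n by unfold_locales
    show ?thesis using P1[rule_format, OF n, of t] W2[rule_format, OF n, of t] rank_prob_AE[of t] AE_space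
    proof eventually_elim
      case (elim \<omega>)
      note P = elim(1)
      show ?case
        by (rule alloc_step_of_P1_W2[OF elim(4) elim(3)[THEN conjunct1] elim(3)[THEN conjunct2] w(1,2) k
            P[THEN conjunct1] P[THEN conjunct2, THEN conjunct1]
            P[THEN conjunct2, THEN conjunct2, THEN conjunct1] P[THEN conjunct2, THEN conjunct2, THEN conjunct2] elim(2)])
    qed
  qed
  thus thesis using w k by (intro that[of wp wm k2 1 k1]) auto
qed

theorem theorem3p1:
  fixes A :: "nat \<Rightarrow> 'a alloc_proc"
  assumes "\<And>n. 1 \<le> n \<Longrightarrow> allocation_process n (A n)"
    and "(cond_P2 A \<and> cond_W1 A) \<or> (cond_P1 A \<and> cond_W2 A)"
  shows "\<exists>\<kappa>>0. \<forall>\<^sub>F n in sequentially. \<forall>m.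
      measure (prob_sp (A n))
        {\<omega> \<in> space (prob_sp (A n)).
           Max ((\<lambda>i. \<bar>real (load (A n) m i \<omega>) - real (total_load n (A n) m \<omega>) / real n\<bar>) ` {1..n})
             \<le> \<kappa> * ln (real n)} \<ge> 1 - 1 / real n ^ 4 \<and>
      measure (prob_sp (A n))
        {\<omega> \<in> space (prob_sp (A n)). gap n (A n) m \<omega> \<le> \<kappa> * ln (real n)} \<ge> 1 - 1 / real n ^ 4"
proof -
  obtain wp wm k1 k2 c where w: "1 \<le> wp" "wp \<le> wm" and k: "0 < k2" "k2 \<le> 1" and c: "0 < c" "c \<le> 1"
    and wr: "weight_rule A wp wm"
    and step: "\<And>n t. 1 \<le> n \<Longrightarrow> AE \<omega> in prob_sp (A n). alloc_step n (balls_process.sorted_load n (A n) t \<omega>)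
        (\<lambda>j. rank_prob n (A n) t j \<omega>) wp wm k1 k2 c"
    by (rule alloc_step_constants[OF assms]) (assumption, rule that)
  have wm: "1 \<le> wm" using w by simp
  obtain \<alpha> \<beta> \<beta>' lam \<epsilon> \<mu> K N where \<alpha>: "0 < \<alpha>" "\<alpha> \<le> 1" "0 \<le> K"
    and o: "\<And>n x. 1 \<le> n \<Longrightarrow> \<bar>\<beta> * over_slack lam \<epsilon> wm n x\<bar> \<le> 1 / 2"
    and u: "\<And>n x. 1 \<le> n \<Longrightarrow> \<bar>\<beta>' * under_slack \<mu> n x\<bar> \<le> 1 / 2"
    and drift: "\<And>n x p. N \<le> n \<Longrightarrow> alloc_step n x p wp wm k1 k2 c \<Longrightarrow>
      (\<Sum>j\<in>{1..n}. p j * lyap \<alpha> \<beta> \<beta>' lam \<epsilon> \<mu> wm n (allocate n wp wm x j))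
        \<le> (1 - \<alpha>\<^sup>2 / real n) * lyap \<alpha> \<beta> \<beta>' lam \<epsilon> \<mu> wm n x + K"
    by (rule lyap_drift[OF wm k c, of wp k1]) (rule that)
  show ?thesis
  proof (intro exI conjI)
    show "0 < 6 / \<alpha>" using \<alpha> by simp
    show "\<forall>\<^sub>F n in sequentially. \<forall>m.
      measure (prob_sp (A n))
        {\<omega> \<in> space (prob_sp (A n)).
           Max ((\<lambda>i. \<bar>real (load (A n) m i \<omega>) - real (total_load n (A n) m \<omega>) / real n\<bar>) ` {1..n})
             \<le> 6 / \<alpha> * ln (real n)} \<ge> 1 - 1 / real n ^ 4 \<and>
      measure (prob_sp (A n))
        {\<omega> \<in> space (prob_sp (A n)). gap n (A n) m \<omega> \<le> 6 / \<alpha> * ln (real n)} \<ge> 1 - 1 / real n ^ 4"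
      using eventually_ge_at_top[of "max 1 (max N (nat \<lceil>4 * (5 + K / \<alpha>\<^sup>2)\<rceil>))"]
    proof eventually_elim
      case (elim n)
      hence n: "1 \<le> n" "N \<le> n" and "4 * (5 + K / \<alpha>\<^sup>2) \<le> real n"
        by (auto simp: nat_le_iff ceiling_le_iff)
      interpret weighted_process n "A n" wp wm
        using assms(1)[OF n(1)] n(1) w wr unfolding weight_rule_def by unfold_locales auto
      note tail_bound[OF \<alpha> o[OF n(1)] u[OF n(1)] step[OF n(1)] drift[OF n(2)] \<open>4 * (5 + K / \<alpha>\<^sup>2) \<le> real n\<close>]
      thus ?case unfolding max_dev_def by blast
    qed
  qed
qed

end
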